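(* Let $Y$ be a topologically irreducible, topologically recurrent, weak Feller Markov chain that takes values in a separable metric space $\mathcal X$. Let $A\subset\mathcal X$ be a Borel set such that $\mathbb P_x(Y_1\in\operatorname{Int}(A))>0$ for some $x\in\operatorname{Int}(A^c)$. For a Borel measure $\mu$ on $\mathcal X$ put $$\mu_A^{entr}:=\int_{A^c}\mathbb P_x(Y_1\in\cdot)\,\mu(dx)\ \text{ on }A\qquad\text{and}\qquad \mu_{A^c}^{exit}(dx):=\mathbb P_x(Y_1\in A)\,\mu(dx)\ \text{ on }A^c.$$ Then the mapping $\mu\mapsto\mu_A^{entr}$ is a bijection between the set of locally finite invariant Borel measures of the chain $Y$ on $\mathcal X$ and the set of locally finite invariant Borel measures of the entrance chain $Y^{\rangle A}$ on $A$; respectively, the mapping $\mu\mapsto\mu_{A^c}^{exit}$ is a bijection between the set of locally finite invariant Borel measures of $Y$ on $\mathcal X$ and the set of locally finite invariant Borel measures of the exit chain $Y^{A^c\rangle}$ on $A^c$.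
   Context: All Markov chains are time-homogeneous. $\mathbb P_x$ is the law under which $Y=(Y_n)_{n\ge0}$ is a Markov chain with its transition kernel and $\mathbb P_x(Y_0=x)=1$. $\tau_G(Y):=\inf\{n\ge1:Y_n\in G\}$, $\inf\varnothing:=\infty$. $Y$ is topologically irreducible if $\mathbb P_x(\tau_G(Y)<\infty)>0$ for every $x\in\mathcal X$ and every non-empty open $G\subset\mathcal X$. $Y$ is topologically recurrent if $\mathbb P_x(\tau_G(Y)<\infty)=1$ for every non-empty open $G\subset\mathcal X$ and every $x\in G$. $Y$ is weak Feller if $\mathbb P_x(Y_1\in\cdot)$ is weakly continuous in $x$. A Borel measure on a metric space is locally finite if every point has an open neighbourhood of finite measure; $A$ and $A^c$ carry the subspace topologies. The zero measure is included among locally finite invariant measures. $\operatorname{Int}$ denotes the interior in $\mathcal X$. Entrance and exit chains. $T_0^{\rangle A}:=0$ and $T_n^{\rangle A}:=\inf\{k>T_{n-1}^{\rangle A}: Y_{k-1}\in A^c, Y_k\in A\}$ for $n\ge1$. Put $Y_n^{\rangle A}:=Y_{T_n^{\rangle A}}$, $Y_n^{A^c\rangle}:=Y_{T_n^{\rangle A}-1}$ for $n\ge1$, where $Y_\infty:=\dagger\notin\mathcal X$ is a cemetery state. The entrance chain $Y^{\rangle A}=(Y_n^{\rangle A})_{n\ge1}$ is a Markov chain on $A\cup\{\dagger\}$ with kernel $P_A^{entr}(x,dy)=\mathbb P_x(Y_1^{\rangle A}\in dy)$, $x\in A$. The exit chain $Y^{A^c\rangle}=(Y_n^{A^c\rangle})_{n\ge1}$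 is a Markov chain on $A^c\cup\{\dagger\}$ with kernel $P_{A^c}^{exit}(x,dy)=\int_A\mathbb P_z(Y_1^{A^c\rangle}\in dy)\,\mathbb P_x(Y_1\in dz\mid Y_1\in A)$ for $x\in A^c_{ex}:=\{x\in A^c:\mathbb P_x(Y_1\in A)>0\}$, and $P_{A^c}^{exit}(x,\{\dagger\})=1$ for $x\in A^c\setminus A^c_{ex}$. Both are absorbed at $\dagger$. A Borel measure $\nu$ on $E\in\{\mathcal X, A, A^c\}$ is invariant for a chain with kernel $K$ if $\int_E K(x,B)\,\nu(dx)=\nu(B)$ for every Borel $B\subset E$. *)

theory Defs
  imports "HOL-Probability.Probability"
begin

text \<open>
  The state space is a type \<open>'a\<close> of sort \<open>{metric_space, second_countable_topology}\<close>: a metric space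
  is separable iff it is second countable. Paths are functions \<open>\<omega> :: nat \<Rightarrow> 'a\<close> and \<open>Y\<^sub>n\<close> is the
  coordinate \<open>\<omega> n\<close>; a chain is given by its transition kernel \<open>K\<close> and the family \<open>P x\<close> of its path
  laws started at \<open>x\<close>. The clause \<open>Markov\<close> is the Markov property with respect to the natural
  filtration; it determines \<open>P\<close> from \<open>K\<close>.
\<close>

locale markov_chain =
  fixes K :: "'a::{metric_space, second_countable_topology} \<Rightarrow> 'a measure"
    and P :: "'a \<Rightarrow> (nat \<Rightarrow> 'a) measure"
  assumes kernel: "K \<in> borel \<rightarrow>\<^sub>M prob_algebra borel"
    and law_prob: "prob_space (P x)"
    and law_sets: "sets (P x) = sets (\<Pi>\<^sub>M n\<in>UNIV. borel)"
    and start: "measure (P x) {\<omega> \<in> space (P x). \<omega> 0 = x} = 1"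
    and Markov: "H \<in> sets (\<Pi>\<^sub>M i\<in>{..n}. borel) \<Longrightarrow> B \<in> sets borel \<Longrightarrow>
      emeasure (P x) {\<omega> \<in> space (P x). restrict \<omega> {..n} \<in> H \<and> \<omega> (Suc n) \<in> B} =
      (\<integral>\<^sup>+\<omega>. indicator H (restrict \<omega> {..n}) * emeasure (K (\<omega> n)) B \<partial>P x)"

definition hitting_time :: "'a set \<Rightarrow> (nat \<Rightarrow> 'a) \<Rightarrow> enat" where
  "hitting_time G \<omega> = Inf (enat ` {n. n \<ge> 1 \<and> \<omega> n \<in> G})"

definition topologically_irreducible :: "('a::topological_space \<Rightarrow> (nat \<Rightarrow> 'a) measure) \<Rightarrow> bool" where
  "topologically_irreducible P \<longleftrightarrow>
    (\<forall>x G. open G \<and> G \<noteq> {} \<longrightarrow> measure (P x) {\<omega> \<in> space (P x). hitting_time G \<omega> < \<infinity>} > 0)"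

definition topologically_recurrent :: "('a::topological_space \<Rightarrow> (nat \<Rightarrow> 'a) measure) \<Rightarrow> bool" where
  "topologically_recurrent P \<longleftrightarrow>
    (\<forall>G. open G \<and> G \<noteq> {} \<longrightarrow>
      (\<forall>x\<in>G. measure (P x) {\<omega> \<in> space (P x). hitting_time G \<omega> < \<infinity>} = 1))"

definition step_law :: "('a::topological_space \<Rightarrow> (nat \<Rightarrow> 'a) measure) \<Rightarrow> 'a \<Rightarrow> 'a measure" where
  "step_law P x = distr (P x) borel (\<lambda>\<omega>. \<omega> 1)"

definition weak_Feller :: "('a::topological_space \<Rightarrow> (nat \<Rightarrow> 'a) measure) \<Rightarrow> bool" where
  "weak_Feller P \<longleftrightarrow>
    (\<forall>f :: 'a \<Rightarrow> real. continuous_on UNIV f \<and> bounded (range f) \<longrightarrow>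
      continuous_on UNIV (\<lambda>x. \<integral>y. f y \<partial>step_law P x))"

text \<open>
  The infimum of the empty set of extended naturals is \<open>\<infinity>\<close>. Once \<open>entrance_time A \<omega> n = \<infinity>\<close>, all
  later entrance times are \<open>\<infinity>\<close> too.
\<close>

primrec entrance_time :: "'a set \<Rightarrow> (nat \<Rightarrow> 'a) \<Rightarrow> nat \<Rightarrow> enat" where
  "entrance_time A \<omega> 0 = 0"
| "entrance_time A \<omega> (Suc n) =
    Inf (enat ` {k. enat k > entrance_time A \<omega> n \<and> \<omega> (k - 1) \<in> - A \<and> \<omega> k \<in> A})"

text \<open>
  The cemetery state is \<open>None\<close>. Both \<open>entrance_state\<close> and \<open>exit_state\<close> are meant for \<open>n \<ge> 1\<close>,
  where \<open>T\<^sub>n \<ge> 1\<close> and the subtraction does not truncate.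
\<close>

definition entrance_state :: "'a set \<Rightarrow> (nat \<Rightarrow> 'a) \<Rightarrow> nat \<Rightarrow> 'a option" where
  "entrance_state A \<omega> n =
    (case entrance_time A \<omega> n of enat k \<Rightarrow> Some (\<omega> k) | \<infinity> \<Rightarrow> None)"

definition exit_state :: "'a set \<Rightarrow> (nat \<Rightarrow> 'a) \<Rightarrow> nat \<Rightarrow> 'a option" where
  "exit_state A \<omega> n =
    (case entrance_time A \<omega> n of enat k \<Rightarrow> Some (\<omega> (k - 1)) | \<infinity> \<Rightarrow> None)"

definition with_cemetery :: "'a::topological_space set \<Rightarrow> 'a option measure" where
  "with_cemetery E =
    sigma (insert None (Some ` E)) (insert {None} ((`) Some ` sets (restrict_space borel E)))"

text \<open>
  The kernels are only relevant at \<open>Some x\<close> with \<open>x \<in> A\<close> (entrance) or \<open>x \<in> - A\<close> (exit), and at the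
  absorbing state \<open>None\<close>.
\<close>

definition entrance_kernel ::
  "('a::topological_space \<Rightarrow> (nat \<Rightarrow> 'a) measure) \<Rightarrow> 'a set \<Rightarrow> 'a option \<Rightarrow> 'a option measure" where
  "entrance_kernel P A s =
    (case s of
      None \<Rightarrow> return (with_cemetery A) None
    | Some x \<Rightarrow> distr (P x) (with_cemetery A) (\<lambda>\<omega>. entrance_state A \<omega> 1))"

definition exit_points ::
  "('a::topological_space \<Rightarrow> (nat \<Rightarrow> 'a) measure) \<Rightarrow> 'a set \<Rightarrow> 'a set" where
  "exit_points P A = {x \<in> - A. measure (step_law P x) A > 0}"

text \<open>
  \<open>uniform_measure M A\<close> is the conditional measure \<open>M(\<cdot> \<inter> A) / M(A)\<close>, so that
  \<open>uniform_measure (step_law P x) A\<close> is the law of \<open>Y\<^sub>1\<close> under \<open>P x\<close> given \<open>Y\<^sub>1 \<in> A\<close>.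
\<close>

definition exit_kernel ::
  "('a::topological_space \<Rightarrow> (nat \<Rightarrow> 'a) measure) \<Rightarrow> 'a set \<Rightarrow> 'a option \<Rightarrow> 'a option measure" where
  "exit_kernel P A s =
    (case s of
      None \<Rightarrow> return (with_cemetery (- A)) None
    | Some x \<Rightarrow>
        if x \<in> exit_points P A then
          measure_of (space (with_cemetery (- A))) (sets (with_cemetery (- A)))
            (\<lambda>B. \<integral>\<^sup>+z\<in>A. emeasure (P z) {\<omega> \<in> space (P z). exit_state A \<omega> 1 \<in> B}
                    \<partial>uniform_measure (step_law P x) A)
        else return (with_cemetery (- A)) None)"

definition borel_measure_on :: "'a::topological_space set \<Rightarrow> 'a measure \<Rightarrow> bool" where
  "borel_measure_on E \<nu> \<longleftrightarrow> sets \<nu> = sets (restrict_space borel E)"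

definition locally_finite_on :: "'a::topological_space set \<Rightarrow> 'a measure \<Rightarrow> bool" where
  "locally_finite_on E \<nu> \<longleftrightarrow>
    (\<forall>x\<in>E. \<exists>U. openin (top_of_set E) U \<and> x \<in> U \<and> emeasure \<nu> U < \<infinity>)"

definition invariant_on ::
  "'a::topological_space set \<Rightarrow> ('a \<Rightarrow> 'a set \<Rightarrow> ennreal) \<Rightarrow> 'a measure \<Rightarrow> bool" where
  "invariant_on E k \<nu> \<longleftrightarrow>
    (\<forall>B\<in>sets (restrict_space borel E). (\<integral>\<^sup>+x. k x B \<partial>\<nu>) = emeasure \<nu> B)"

definition lf_invariant_measures ::
  "'a::topological_space set \<Rightarrow> ('a \<Rightarrow> 'a set \<Rightarrow> ennreal) \<Rightarrow> 'a measure set" where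
  "lf_invariant_measures E k =
    {\<nu>. borel_measure_on E \<nu> \<and> locally_finite_on E \<nu> \<and> invariant_on E k \<nu>}"

definition entrance_measure ::
  "('a::topological_space \<Rightarrow> (nat \<Rightarrow> 'a) measure) \<Rightarrow> 'a set \<Rightarrow> 'a measure \<Rightarrow> 'a measure" where
  "entrance_measure P A \<mu> =
    measure_of A (sets (restrict_space borel A))
      (\<lambda>B. \<integral>\<^sup>+x\<in>- A. emeasure (step_law P x) B \<partial>\<mu>)"

definition exit_measure ::
  "('a::topological_space \<Rightarrow> (nat \<Rightarrow> 'a) measure) \<Rightarrow> 'a set \<Rightarrow> 'a measure \<Rightarrow> 'a measure" where
  "exit_measure P A \<mu> = density (restrict_space \<mu> (- A)) (\<lambda>x. emeasure (step_law P x) A)"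

end

(*
  Kernels act on functions X -> [0,oo]. The kernel K of the chain splits as K = S + R, where R carries the
  steps from the complement of A into A and S all other steps. With the Green operator E = 1 + S + S^2 + ...,
  the entrance kernel is E R and, with r = R 1, the exit kernel is f |-> R E (r f) / r.
  If nu is invariant for E R, then mu = nu E satisfies mu R = nu and mu K = nu E S + nu = mu; if kappa is
  invariant for the exit kernel, then nu = (kappa / r) R is invariant for E R and r (nu E) = kappa.
  Conversely, recurrence gives E r = 1 (a superharmonic function that is bounded below by c on a non-empty
  open set is bounded below by c everywhere) and that locally finite excessive measures are invariant; both
  together show mu = mu R E for every locally finite invariant mu, so mu is determined by mu R.
  Local finiteness of mu propagates from a single open set of finite measure, by irreducibility and the
  lower semicontinuity of x |-> K^n(x, G); the crossing hypothesis on A supplies that open set.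
*)

theory Submission
  imports Defs
begin

section \<open>Positive operators\<close>

text \<open>The obstacle is infinite mass. Locally finite measures may be infinite, and for a lifted
  measure such as \<nu>E even sigma-finiteness is unknown until local finiteness has been proved, so
  identities between sums cannot be cancelled at will. Cancellation is therefore done for functions
  of finite integral, and a general f is reached through truncations min(f, h_n), where h_n has
  finite integral and increases to \<infinity> at every point. Such h_n are built twice, from the
  potential of an open set and from the functions S^k R 1_V; recurrence is behind both. For the same
  reason kernels are kept as countably additive operators on functions: E(x, X) may be infinite, but
  E f always makes sense and series can be rearranged. Measures act from the left, so \<nu>ER
  integrates f as the \<nu>-integral of \<open>occupation (entering f)\<close>. Weak continuity of
  the kernel gives only one-sided control, namely lower bounds near a point for the mass of open
  sets. This is why interiors enter the crossing hypothesis, and why every global statement is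
  derived from a lower bound on some open set.\<close>

definition positive_operator :: "(('a::topological_space \<Rightarrow> ennreal) \<Rightarrow> 'a \<Rightarrow> ennreal) \<Rightarrow> bool" where
  "positive_operator T \<longleftrightarrow>
    (\<forall>f\<in>borel_measurable borel. T f \<in> borel_measurable borel) \<and>
    (\<forall>c. \<forall>f\<in>borel_measurable borel. \<forall>x. T (\<lambda>y. c * f y) x = c * T f x) \<and>
    (\<forall>F x. (\<forall>n. F n \<in> borel_measurable borel) \<longrightarrow> T (\<lambda>y. \<Sum>n::nat. F n y) x = (\<Sum>n. T (F n) x))"

lemma positive_operatorI:
  assumes "\<And>f. f \<in> borel_measurable borel \<Longrightarrow> T f \<in> borel_measurable borel"
    and "\<And>c f x. f \<in> borel_measurable borel \<Longrightarrow> T (\<lambda>y. c * f y) x = c * T f x"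
    and "\<And>F x. (\<And>n. F n \<in> borel_measurable borel) \<Longrightarrow> T (\<lambda>y. \<Sum>n::nat. F n y) x = (\<Sum>n. T (F n) x)"
  shows "positive_operator T"
  using assms unfolding positive_operator_def by blast

context
  fixes T :: "('a::topological_space \<Rightarrow> ennreal) \<Rightarrow> 'a \<Rightarrow> ennreal"
  assumes T: "positive_operator T"
begin

lemma positive_operator_measurable:
  "f \<in> borel_measurable borel \<Longrightarrow> T f \<in> borel_measurable borel"
  using T unfolding positive_operator_def by blast

lemma positive_operator_cmult:
  "f \<in> borel_measurable borel \<Longrightarrow> T (\<lambda>y. c * f y) x = c * T f x"
  using T unfolding positive_operator_def by blast

lemma positive_operator_suminf:
  "(\<And>n. F n \<in> borel_measurable borel) \<Longrightarrow> T (\<lambda>y. \<Sum>n::nat. F n y) x = (\<Sum>n. T (F n) x)"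
  using T unfolding positive_operator_def by blast

lemma positive_operator_zero: "T (\<lambda>y. 0) x = 0"
  using positive_operator_cmult[of "\<lambda>y. 0" 0 x] by simp

text \<open>Countable additivity for the sequence f, g, 0, 0, ...; that 0 is sent to 0 is
  homogeneity with the constant 0.\<close>

lemma positive_operator_add:
  assumes "f \<in> borel_measurable borel" "g \<in> borel_measurable borel"
  shows "T (\<lambda>y. f y + g y) x = T f x + T g x"
proof -
  let ?F = "\<lambda>n::nat. if n = 0 then f else if n = 1 then g else (\<lambda>y. 0)"
  have sum2: "(\<Sum>n. h n) = h 0 + h 1" if "\<And>n. n \<notin> {0,1} \<Longrightarrow> h n = 0" for h :: "nat \<Rightarrow> ennreal"
    using suminf_finite[of "{0,1}" h] that by simp
  have "T (\<lambda>y. \<Sum>n. ?F n y) x = (\<Sum>n. T (?F n) x)"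
    using assms by (intro positive_operator_suminf) auto
  moreover have "(\<lambda>y. \<Sum>n. ?F n y) = (\<lambda>y. f y + g y)"
    by (rule ext, subst sum2) auto
  moreover have "(\<Sum>n. T (?F n) x) = T f x + T g x"
    by (subst sum2) (auto simp: positive_operator_zero)
  ultimately show ?thesis by simp
qed

lemma positive_operator_mono:
  assumes "f \<in> borel_measurable borel" "g \<in> borel_measurable borel" "\<And>y. f y \<le> g y"
  shows "T f x \<le> T g x"
proof -
  have "T g x = T (\<lambda>y. f y + (g y - f y)) x"
    using assms(3) by (simp add: add_diff_inverse_ennreal)
  also have "\<dots> = T f x + T (\<lambda>y. g y - f y) x"
    using assms by (intro positive_operator_add) auto
  finally show ?thesis by simp
qed

lemma positive_operator_sum:
  assumes "\<And>k. F k \<in> borel_measurable borel"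
  shows "T (\<lambda>y. \<Sum>k<(n::nat). F k y) x = (\<Sum>k<n. T (F k) x)"
  by (induction n) (use assms in \<open>auto simp: positive_operator_zero positive_operator_add\<close>)

text \<open>Telescoping: an increasing supremum is \<open>F 0\<close> plus the series of its
  increments, so continuity from below is countable additivity once more. The identity
  \<open>F (Suc n) = F n + D n\<close> holds also at infinite values.\<close>

lemma positive_operator_SUP:
  assumes F: "\<And>n. F n \<in> borel_measurable borel" and inc: "incseq F"
  shows "T (\<lambda>y. SUP n. F n y) x = (SUP n. T (F n) x)"
proof -
  define D where "D n = (\<lambda>y. F (Suc n) y - F n y)" for n
  have le: "F n y \<le> F (Suc n) y" for n y
    using inc by (auto simp: incseq_Suc_iff le_fun_def)
  have D[measurable]: "D n \<in> borel_measurable borel" for n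
    unfolding D_def using F by auto
  have partial: "F n = (\<lambda>y. F 0 y + (\<Sum>k<n. D k y))" for n
  proof (induction n)
    case (Suc n)
    show ?case
    proof
      fix y
      have "F (Suc n) y = F n y + D n y"
        using le by (simp add: D_def add_diff_inverse_ennreal)
      also have "F n y = F 0 y + (\<Sum>k<n. D k y)"
        using Suc.IH by (rule fun_cong)
      finally show "F (Suc n) y = F 0 y + (\<Sum>k<Suc n. D k y)"
        by (simp add: add.assoc)
    qed
  qed simp
  have sup: "(SUP n. F n y) = F 0 y + (\<Sum>k. D k y)" for y
    by (subst partial) (simp add: suminf_eq_SUP ennreal_SUP_add_right)
  have "T (\<lambda>y. SUP n. F n y) x = T (F 0) x + (\<Sum>k. T (D k) x)"
    unfolding sup using F D by (simp add: positive_operator_add positive_operator_suminf)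
  also have "\<dots> = (SUP n. T (F 0) x + (\<Sum>k<n. T (D k) x))"
    by (simp add: suminf_eq_SUP ennreal_SUP_add_right)
  also have "\<dots> = (SUP n. T (F n) x)"
    by (subst (2) partial) (use F D in \<open>simp add: positive_operator_add positive_operator_sum\<close>)
  finally show ?thesis .
qed

lemma positive_operator_funpow: "positive_operator (T ^^ n)"
proof (induction n)
  case 0
  show ?case by (rule positive_operatorI) auto
next
  case (Suc n)
  have m: "(T ^^ n) f \<in> borel_measurable borel" if "f \<in> borel_measurable borel" for f
    using Suc that unfolding positive_operator_def by blast
  have c: "(T ^^ n) (\<lambda>y. c * f y) = (\<lambda>x. c * (T ^^ n) f x)" if "f \<in> borel_measurable borel" for f c
    using Suc that unfolding positive_operator_def by blast
  have s: "(T ^^ n) (\<lambda>y. \<Sum>k::nat. F k y) = (\<lambda>x. \<Sum>k. (T ^^ n) (F k) x)"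
    if "\<And>k. F k \<in> borel_measurable borel" for F
    using Suc that unfolding positive_operator_def by blast
  show ?case
    by (rule positive_operatorI)
      (auto simp: m c s positive_operator_measurable positive_operator_cmult positive_operator_suminf)
qed

end

lemma positive_operator_comp:
  assumes "positive_operator S" "positive_operator T"
  shows "positive_operator (\<lambda>f. S (T f))"
proof (rule positive_operatorI)
  note S = positive_operator_measurable[OF assms(1)] positive_operator_cmult[OF assms(1)]
    positive_operator_suminf[OF assms(1)]
  note T = positive_operator_measurable[OF assms(2)] positive_operator_cmult[OF assms(2)]
    positive_operator_suminf[OF assms(2)]
  show "S (T f) \<in> borel_measurable borel" if "f \<in> borel_measurable borel" for f
    using that S T by blast
  show "S (T (\<lambda>y. c * f y)) x = c * S (T f) x" if "f \<in> borel_measurable borel" for c f x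
    using S(2)[OF T(1)[OF that], of c x] T(2)[OF that, of c] by presburger
  show "S (T (\<lambda>y. \<Sum>n::nat. F n y)) x = (\<Sum>n. S (T (F n)) x)"
    if "\<And>n. F n \<in> borel_measurable borel" for F x
    using S(3)[of "\<lambda>n. T (F n)" x] T(1)[OF that] T(3)[OF that] by presburger
qed

lemma positive_operator_plus:
  assumes "positive_operator S" "positive_operator T"
  shows "positive_operator (\<lambda>f x. S f x + T f x)"
proof (rule positive_operatorI)
  show "(\<lambda>x. S f x + T f x) \<in> borel_measurable borel" if "f \<in> borel_measurable borel" for f
    using that by (intro borel_measurable_add positive_operator_measurable[OF assms(1)] positive_operator_measurable[OF assms(2)])
qed (simp_all add: positive_operator_cmult[OF assms(1)] positive_operator_suminf[OF assms(1)]
    positive_operator_cmult[OF assms(2)] positive_operator_suminf[OF assms(2)] distrib_left suminf_add)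

lemma positive_operator_mult_left:
  assumes "positive_operator T" "g \<in> borel_measurable borel"
  shows "positive_operator (\<lambda>f x. g x * T f x)"
proof (rule positive_operatorI)
  show "(\<lambda>x. g x * T f x) \<in> borel_measurable borel" if "f \<in> borel_measurable borel" for f
    using positive_operator_measurable[OF assms(1) that] assms(2) by measurable
qed (simp_all add: positive_operator_cmult[OF assms(1)] positive_operator_suminf[OF assms(1)] mult.left_commute)

lemma positive_operator_mult_right:
  assumes "positive_operator T" "g \<in> borel_measurable borel"
  shows "positive_operator (\<lambda>f. T (\<lambda>y. g y * f y))"
proof -
  have "positive_operator (\<lambda>f y. g y * f y)"
    using assms(2) by (intro positive_operatorI) (simp_all add: mult.left_commute)
  from positive_operator_comp[OF assms(1) this] show ?thesis .
qed

section \<open>Potentials of positive operators\<close>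

definition green :: "(('a \<Rightarrow> ennreal) \<Rightarrow> 'a \<Rightarrow> ennreal) \<Rightarrow> ('a \<Rightarrow> ennreal) \<Rightarrow> 'a \<Rightarrow> ennreal" where
  "green T f x = (\<Sum>k. (T ^^ k) f x)"

lemma suminf_swap_ennreal: "(\<Sum>i. \<Sum>j. f i j) = (\<Sum>j. \<Sum>i. f i j)"
  for f :: "nat \<Rightarrow> nat \<Rightarrow> ennreal"
  using nn_integral_suminf[of "\<lambda>j i. f i j" "count_space UNIV"]
  by (simp only: nn_integral_count_space_nat borel_measurable_count_space simp_thms)

context
  fixes T :: "('a::topological_space \<Rightarrow> ennreal) \<Rightarrow> 'a \<Rightarrow> ennreal"
  assumes T: "positive_operator T"
begin

lemma funpow_measurable:
  "f \<in> borel_measurable borel \<Longrightarrow> (T ^^ n) f \<in> borel_measurable borel"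
  by (rule positive_operator_measurable[OF positive_operator_funpow[OF T]])

lemma positive_operator_green: "positive_operator (green T)"
proof (rule positive_operatorI)
  note Tn = positive_operator_funpow[OF T]
  show "green T f \<in> borel_measurable borel" if "f \<in> borel_measurable borel" for f
    using funpow_measurable[OF that] unfolding green_def[abs_def] by measurable
  show "green T (\<lambda>y. c * f y) x = c * green T f x" if "f \<in> borel_measurable borel" for c f x
    unfolding green_def using that by (simp add: positive_operator_cmult[OF Tn])
  show "green T (\<lambda>y. \<Sum>n::nat. F n y) x = (\<Sum>n. green T (F n) x)"
    if "\<And>n. F n \<in> borel_measurable borel" for F x
    unfolding green_def using that
    by (simp add: positive_operator_suminf[OF Tn]) (rule suminf_swap_ennreal)
qed

lemma green_unfold_right:
  assumes "f \<in> borel_measurable borel"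
  shows "green T f x = f x + green T (T f) x"
proof -
  have "green T f x = (\<Sum>k<1. (T ^^ k) f x) + (\<Sum>k. (T ^^ (k + 1)) f x)"
    unfolding green_def using suminf_offset[of "\<lambda>k. (T ^^ k) f x" 1] by (simp add: add.commute)
  then show ?thesis by (simp add: green_def funpow_Suc_right del: funpow.simps)
qed

lemma green_unfold:
  assumes "f \<in> borel_measurable borel"
  shows "green T f x = f x + T (green T f) x"
proof -
  have "T (green T f) x = (\<Sum>k. T ((T ^^ k) f) x)"
    unfolding green_def[abs_def] by (rule positive_operator_suminf[OF T]) (rule funpow_measurable[OF assms])
  also have "\<dots> = green T (T f) x"
    by (simp add: green_def funpow_swap1)
  finally show ?thesis using green_unfold_right[OF assms] by simp
qed

text \<open>The tail of the potential series from index n on is T^n applied to the whole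
  potential.\<close>

lemma funpow_green:
  assumes f: "f \<in> borel_measurable borel"
  shows "green T f x = (\<Sum>k<n. (T ^^ k) f x) + (T ^^ n) (green T f) x"
proof (induction n)
  case (Suc n)
  have "green T f = (\<lambda>x. f x + T (green T f) x)"
    using green_unfold[OF f] by (rule ext)
  then have "(T ^^ n) (green T f) x = (T ^^ n) (\<lambda>x. f x + T (green T f) x) x"
    by (rule arg_cong[where f = "\<lambda>h. (T ^^ n) h x"])
  also have "\<dots> = (T ^^ n) f x + (T ^^ n) (T (green T f)) x"
    by (rule positive_operator_add[OF positive_operator_funpow[OF T] f
          positive_operator_measurable[OF T positive_operator_measurable[OF positive_operator_green f]]])
  also have "(T ^^ n) (T (green T f)) = (T ^^ Suc n) (green T f)"
    by (simp only: funpow_Suc_right o_apply)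
  finally show ?case using Suc.IH by (simp add: add.assoc)
qed simp

text \<open>Minimality of the potential: iterating f + T g \<le> g leaves a remainder T^n g, which
  is dropped. Both the bound of hitting probabilities by 1 and optional stopping for superharmonic
  functions are instances.\<close>

lemma green_le:
  assumes "f \<in> borel_measurable borel" "g \<in> borel_measurable borel"
    and super: "\<And>x. T g x + f x \<le> g x"
  shows "green T f x \<le> g x"
proof -
  have "(\<Sum>k<n. (T ^^ k) f x) + (T ^^ n) g x \<le> g x" for n
  proof (induction n)
    case (Suc n)
    have "(T ^^ n) f x + (T ^^ Suc n) g x = (T ^^ n) f x + (T ^^ n) (T g) x"
      by (simp only: funpow_Suc_right o_apply)
    also have "\<dots> = (T ^^ n) (\<lambda>x. f x + T g x) x"
      by (rule positive_operator_add[OF positive_operator_funpow[OF T] assms(1)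
            positive_operator_measurable[OF T assms(2)], symmetric])
    also have "\<dots> \<le> (T ^^ n) g x"
      using assms positive_operator_measurable[OF T assms(2)]
      by (intro positive_operator_mono[OF positive_operator_funpow[OF T]]) (auto simp: add.commute)
    finally have "(\<Sum>k<n. (T ^^ k) f x) + ((T ^^ n) f x + (T ^^ Suc n) g x) \<le> g x"
      by (rule order_trans[OF add_left_mono Suc.IH])
    then show ?case by (simp add: add.assoc)
  qed simp
  then have "(\<Sum>k<n. (T ^^ k) f x) \<le> g x" for n
    by (rule order_trans[of _ "(\<Sum>k<n. (T ^^ k) f x) + (T ^^ n) g x", rotated]) simp
  then show ?thesis
    unfolding green_def suminf_eq_SUP by (intro SUP_least)
qed

end

section \<open>Measures transported by positive operators\<close>

definition operator_measure ::
  "'a measure \<Rightarrow> (('a::topological_space \<Rightarrow> ennreal) \<Rightarrow> 'a \<Rightarrow> ennreal) \<Rightarrow> 'a measure" where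
  "operator_measure \<nu> T = measure_of UNIV (sets borel) (\<lambda>B. \<integral>\<^sup>+x. T (indicator B) x \<partial>\<nu>)"

lemma sets_operator_measure[measurable_cong, simp]: "sets (operator_measure \<nu> T) = sets borel"
  unfolding operator_measure_def by (metis sets.sets_measure_of_eq space_borel)

lemma measurable_borel_restrict:
  "sets \<nu> = sets (restrict_space borel E) \<Longrightarrow> f \<in> borel_measurable borel \<Longrightarrow> f \<in> borel_measurable \<nu>"
  by (metis measurable_cong_sets measurable_restrict_space1)

context
  fixes T :: "('a::topological_space \<Rightarrow> ennreal) \<Rightarrow> 'a \<Rightarrow> ennreal" and \<nu> :: "'a measure" and E
  assumes T: "positive_operator T" and \<nu>: "sets \<nu> = sets (restrict_space borel E)"
begin

text \<open>\<open>measure_of\<close> takes the prescribed values only once countable additivity is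
  established; this comes from T and from monotone convergence under \<nu>. While \<nu> may live on
  a subset E, the image \<nu>T lives on the whole space.\<close>

lemma emeasure_operator_measure:
  assumes "B \<in> sets borel"
  shows "emeasure (operator_measure \<nu> T) B = (\<integral>\<^sup>+x. T (indicator B) x \<partial>\<nu>)"
proof -
  have "emeasure (measure_of UNIV (sets borel) (\<lambda>B. \<integral>\<^sup>+x. T (indicator B) x \<partial>\<nu>)) B =
      (\<integral>\<^sup>+x. T (indicator B) x \<partial>\<nu>)"
  proof (rule emeasure_measure_of_sigma)
    show "sigma_algebra UNIV (sets borel)"
      using sets.sigma_algebra_axioms[of borel] by simp
    show "positive (sets borel) (\<lambda>B. \<integral>\<^sup>+x. T (indicator B) x \<partial>\<nu>)"
      by (simp add: positive_def indicator_def[abs_def] positive_operator_zero[OF T, abs_def])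
    show "countably_additive (sets borel) (\<lambda>B. \<integral>\<^sup>+x. T (indicator B) x \<partial>\<nu>)"
    proof (rule countably_additiveI)
      fix F :: "nat \<Rightarrow> 'a set"
      assume F: "range F \<subseteq> sets borel" "disjoint_family F"
      then have m: "indicator (F n) \<in> borel_measurable borel" for n
        by (auto simp: range_subsetD)
      have "(\<Sum>n. \<integral>\<^sup>+x. T (indicator (F n)) x \<partial>\<nu>) = (\<integral>\<^sup>+x. (\<Sum>n. T (indicator (F n)) x) \<partial>\<nu>)"
        using m by (intro nn_integral_suminf[symmetric] measurable_borel_restrict[OF \<nu>]
            positive_operator_measurable[OF T])
      also have "\<dots> = (\<integral>\<^sup>+x. T (\<lambda>y. \<Sum>n. indicator (F n) y) x \<partial>\<nu>)"
        by (intro nn_integral_cong positive_operator_suminf[OF T, symmetric] m)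
      also have "(\<lambda>y. \<Sum>n. indicator (F n) y) = (indicator (\<Union>n. F n) :: 'a \<Rightarrow> ennreal)"
        using suminf_indicator[OF F(2)] by (simp add: fun_eq_iff)
      finally show "(\<Sum>n. \<integral>\<^sup>+x. T (indicator (F n)) x \<partial>\<nu>) = (\<integral>\<^sup>+x. T (indicator (\<Union>n. F n)) x \<partial>\<nu>)" .
    qed
  qed fact
  then show ?thesis unfolding operator_measure_def .
qed

lemma nn_integral_operator_measure:
  assumes "f \<in> borel_measurable borel"
  shows "(\<integral>\<^sup>+x. f x \<partial>operator_measure \<nu> T) = (\<integral>\<^sup>+x. T f x \<partial>\<nu>)"
  using assms
proof (induction rule: borel_measurable_induct)
  case (cong f g)
  then have "f = g" by auto
  then show ?case using cong by simp
next
  case (set B)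
  then show ?case by (simp add: emeasure_operator_measure)
next
  case (mult u c)
  have "(\<integral>\<^sup>+x. c * u x \<partial>operator_measure \<nu> T) = c * (\<integral>\<^sup>+x. u x \<partial>operator_measure \<nu> T)"
    using mult by (intro nn_integral_cmult) auto
  also have "\<dots> = (\<integral>\<^sup>+x. c * T u x \<partial>\<nu>)"
    unfolding mult.IH using mult.hyps
    by (intro nn_integral_cmult[symmetric] measurable_borel_restrict[OF \<nu>] positive_operator_measurable[OF T])
  also have "\<dots> = (\<integral>\<^sup>+x. T (\<lambda>x. c * u x) x \<partial>\<nu>)"
    using mult.hyps by (intro nn_integral_cong positive_operator_cmult[OF T, symmetric])
  finally show ?case .
next
  case (add u v)
  have "(\<integral>\<^sup>+x. v x + u x \<partial>operator_measure \<nu> T) =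
      (\<integral>\<^sup>+x. v x \<partial>operator_measure \<nu> T) + (\<integral>\<^sup>+x. u x \<partial>operator_measure \<nu> T)"
    using add by (intro nn_integral_add) auto
  also have "\<dots> = (\<integral>\<^sup>+x. T v x + T u x \<partial>\<nu>)"
    unfolding add.IH using add.hyps
    by (intro nn_integral_add[symmetric] measurable_borel_restrict[OF \<nu>] positive_operator_measurable[OF T])
  also have "\<dots> = (\<integral>\<^sup>+x. T (\<lambda>x. v x + u x) x \<partial>\<nu>)"
    using add.hyps by (intro nn_integral_cong positive_operator_add[OF T, symmetric])
  finally show ?case .
next
  case (seq U)
  have mono: "incseq (\<lambda>i. T (U i))"
    using seq by (intro incseq_SucI le_funI positive_operator_mono[OF T])
      (simp_all add: incseq_Suc_iff le_fun_def)
  have "(\<integral>\<^sup>+x. (SUP i. U i x) \<partial>operator_measure \<nu> T) = (SUP i. \<integral>\<^sup>+x. U i x \<partial>operator_measure \<nu> T)"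
    using seq by (intro nn_integral_monotone_convergence_SUP) auto
  also have "\<dots> = (SUP i. \<integral>\<^sup>+x. T (U i) x \<partial>\<nu>)"
    using seq.IH by presburger
  also have "\<dots> = (\<integral>\<^sup>+x. (SUP i. T (U i) x) \<partial>\<nu>)"
    using seq.hyps mono
    by (intro nn_integral_monotone_convergence_SUP[symmetric] measurable_borel_restrict[OF \<nu>]
        positive_operator_measurable[OF T])
  also have "\<dots> = (\<integral>\<^sup>+x. T (\<lambda>y. SUP i. U i y) x \<partial>\<nu>)"
    using seq.hyps by (intro nn_integral_cong positive_operator_SUP[OF T, symmetric])
  moreover have "Sup (range U) = (\<lambda>y. SUP i. U i y)"
    by (rule ext) (rule SUP_apply)
  ultimately show ?case by (simp only:)
qed

end

section \<open>First jumps of the chain\<close>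

context markov_chain
begin

text \<open>
  A jump is a step from \<open>C\<close> to \<open>D\<close>. For \<open>C = UNIV\<close> the first jump time is the hitting time of \<open>D\<close>; for
  \<open>C = - A\<close>, \<open>D = A\<close> it is the first entrance time into \<open>A\<close>.
\<close>

definition step :: "('a \<Rightarrow> ennreal) \<Rightarrow> 'a \<Rightarrow> ennreal" where
  "step f x = (\<integral>\<^sup>+y. f y \<partial>K x)"

definition jump :: "'a set \<Rightarrow> 'a set \<Rightarrow> ('a \<Rightarrow> ennreal) \<Rightarrow> 'a \<Rightarrow> ennreal" where
  "jump C D f x = indicator C x * step (\<lambda>y. indicator D y * f y) x"

definition stay :: "'a set \<Rightarrow> 'a set \<Rightarrow> ('a \<Rightarrow> ennreal) \<Rightarrow> 'a \<Rightarrow> ennreal" where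
  "stay C D f x = indicator (- C) x * step f x + indicator C x * step (\<lambda>y. indicator (- D) y * f y) x"

lemma K_prob_algebra: "K x \<in> space (prob_algebra borel)"
  using measurable_space[OF kernel, of x] by simp

lemma sets_K [measurable_cong, simp]: "sets (K x) = sets borel"
  using K_prob_algebra[of x] by (simp add: space_prob_algebra)

lemma prob_space_K: "prob_space (K x)"
  using K_prob_algebra[of x] by (simp add: space_prob_algebra)

lemma space_K [simp]: "space (K x) = UNIV"
  using sets_eq_imp_space_eq[OF sets_K] by simp

lemma step_mono: "(\<And>y. f y \<le> g y) \<Longrightarrow> step f x \<le> step g x"
  unfolding step_def by (rule nn_integral_mono)

lemma measurable_K_iff [simp]: "f \<in> borel_measurable (K x) \<longleftrightarrow> f \<in> borel_measurable borel"
  using measurable_cong_sets[OF sets_K refl] by blast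

lemma positive_operator_step: "positive_operator step"
proof (rule positive_operatorI)
  have K: "K \<in> borel \<rightarrow>\<^sub>M subprob_algebra borel"
    by (rule measurable_prob_algebraD[OF kernel])
  show "step f \<in> borel_measurable borel" if "f \<in> borel_measurable borel" for f
    unfolding step_def[abs_def] using measurable_compose[OF K nn_integral_measurable_subprob_algebra[OF that]] .
qed (auto simp: step_def nn_integral_cmult nn_integral_suminf)

context
  fixes C D :: "'a set"
  assumes C[measurable]: "C \<in> sets borel" and D[measurable]: "D \<in> sets borel"
begin

lemma positive_operator_jump: "positive_operator (jump C D)"
  unfolding jump_def[abs_def]
  by (intro positive_operator_mult_left[of "\<lambda>f. step (\<lambda>y. indicator D y * f y)"]
      positive_operator_mult_right[OF positive_operator_step]) auto

lemma positive_operator_stay: "positive_operator (stay C D)"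
  unfolding stay_def[abs_def]
  by (intro positive_operator_plus[of "\<lambda>f x. indicator (- C) x * step f x"]
      positive_operator_mult_left[of "\<lambda>f. step (\<lambda>y. indicator (- D) y * f y)"]
      positive_operator_mult_left[OF positive_operator_step]
      positive_operator_mult_right[OF positive_operator_step]) auto

lemma step_eq_stay_jump:
  assumes f: "f \<in> borel_measurable borel"
  shows "step f x = stay C D f x + jump C D f x"
proof -
  have "step f x = step (\<lambda>y. indicator (- D) y * f y + indicator D y * f y) x"
    by (rule arg_cong[where f = "\<lambda>h. step h x"]) (auto simp: indicator_def)
  also have "\<dots> = step (\<lambda>y. indicator (- D) y * f y) x + step (\<lambda>y. indicator D y * f y) x"
    using f by (intro positive_operator_add[OF positive_operator_step]) auto
  finally show ?thesis
    by (auto simp: stay_def jump_def indicator_def)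
qed

end

lemma step_const: "step (\<lambda>y. c) x = c"
  using prob_space.emeasure_space_1[OF prob_space_K, of x] by (simp add: step_def)

lemma sets_P [measurable_cong, simp]: "sets (P x) = sets (\<Pi>\<^sub>M n\<in>UNIV. borel)"
  by (rule law_sets)

lemma space_P [simp]: "space (P x) = UNIV"
  using sets_eq_imp_space_eq[OF law_sets] by (simp add: space_PiM PiE_def Pi_def)

lemma coordinate_measurable [measurable]: "(\<lambda>\<omega>. \<omega> n) \<in> P x \<rightarrow>\<^sub>M borel"
  by measurable

lemma AE_start: "AE \<omega> in P x. \<omega> 0 = x"
proof -
  interpret prob_space "P x" by (rule law_prob)
  have "{\<omega> \<in> space (P x). \<omega> 0 = x} \<in> sets (P x)"
    by measurable
  then show ?thesis using start[of x] prob_Collect_eq_1[of "\<lambda>\<omega>. \<omega> 0 = x"] by simp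
qed

text \<open>The clause \<open>Markov\<close> is the case of an indicator. Turning the past event H
  into a density makes the left-hand side an integral of f against one fixed measure
  \<open>?M\<close>, so the extension to all f is the usual induction on measurable
  functions.\<close>

lemma nn_integral_Markov:
  assumes H: "H \<in> sets (\<Pi>\<^sub>M i\<in>{..n}. borel)" and f: "f \<in> borel_measurable borel"
  shows "(\<integral>\<^sup>+\<omega>. indicator H (restrict \<omega> {..n}) * f (\<omega> (Suc n)) \<partial>P x) =
    (\<integral>\<^sup>+\<omega>. indicator H (restrict \<omega> {..n}) * step f (\<omega> n) \<partial>P x)"
proof -
  have [measurable]: "(\<lambda>\<omega>. restrict \<omega> {..n}) \<in> P x \<rightarrow>\<^sub>M (\<Pi>\<^sub>M i\<in>{..n}. borel)"
    using measurable_restrict_subset[of "{..n}" UNIV "\<lambda>_. borel"] by simp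
  note [measurable] = H
  define h :: "(nat \<Rightarrow> 'a) \<Rightarrow> ennreal" where "h \<omega> = indicator H (restrict \<omega> {..n})" for \<omega>
  have [measurable]: "h \<in> borel_measurable (P x)"
    unfolding h_def[abs_def] by measurable
  let ?M = "distr (density (P x) h) borel (\<lambda>\<omega>. \<omega> (Suc n))"
  have step_m: "(\<lambda>\<omega>. step g (\<omega> n)) \<in> borel_measurable (P x)" if "g \<in> borel_measurable borel" for g
    by (rule measurable_compose[OF coordinate_measurable
          positive_operator_measurable[OF positive_operator_step that]])
  have "(\<integral>\<^sup>+y. f y \<partial>?M) = (\<integral>\<^sup>+\<omega>. h \<omega> * step f (\<omega> n) \<partial>P x)"
    using f
  proof (induction rule: borel_measurable_induct)
    case (cong f g)
    then have "f = g" by auto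
    then show ?case using cong by simp
  next
    case (set B)
    note [measurable] = set
    have "(\<integral>\<^sup>+y. indicator B y \<partial>?M) = (\<integral>\<^sup>+\<omega>. h \<omega> * indicator B (\<omega> (Suc n)) \<partial>P x)"
      using set by (simp add: nn_integral_distr nn_integral_density emeasure_distr del: nn_integral_indicator)
    also have "\<dots> = (\<integral>\<^sup>+\<omega>. indicator {\<omega> \<in> space (P x). restrict \<omega> {..n} \<in> H \<and> \<omega> (Suc n) \<in> B} \<omega> \<partial>P x)"
      by (intro nn_integral_cong) (auto simp: indicator_def h_def)
    also have "\<dots> = emeasure (P x) {\<omega> \<in> space (P x). restrict \<omega> {..n} \<in> H \<and> \<omega> (Suc n) \<in> B}"
      using set by (intro nn_integral_indicator) measurable
    also have "\<dots> = (\<integral>\<^sup>+\<omega>. h \<omega> * step (indicator B) (\<omega> n) \<partial>P x)"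
      using set by (subst Markov[OF H]) (auto simp: step_def h_def)
    finally show ?case .
  next
    case (mult u c)
    then show ?case using step_m[of u]
      by (simp add: nn_integral_cmult positive_operator_cmult[OF positive_operator_step] mult.left_commute[of _ c])
  next
    case (add u v)
    then show ?case using step_m[of u] step_m[of v]
      by (simp add: nn_integral_add positive_operator_add[OF positive_operator_step] distrib_left)
  next
    case (seq U)
    have inc: "step (U i) z \<le> step (U (Suc i)) z" for i z
      using seq by (intro positive_operator_mono[OF positive_operator_step])
        (simp_all add: incseq_Suc_iff le_fun_def)
    have "(\<integral>\<^sup>+y. (SUP i. U i y) \<partial>?M) = (SUP i. \<integral>\<^sup>+y. U i y \<partial>?M)"
      using seq by (intro nn_integral_monotone_convergence_SUP) auto
    also have "\<dots> = (SUP i. \<integral>\<^sup>+\<omega>. h \<omega> * step (U i) (\<omega> n) \<partial>P x)"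
      by (simp only: seq.IH)
    also have "\<dots> = (\<integral>\<^sup>+\<omega>. (SUP i. h \<omega> * step (U i) (\<omega> n)) \<partial>P x)"
      using inc step_m[OF seq.hyps(1)]
      by (intro nn_integral_monotone_convergence_SUP[symmetric] incseq_SucI)
        (auto simp: le_fun_def intro!: mult_left_mono)
    also have "\<dots> = (\<integral>\<^sup>+\<omega>. h \<omega> * step (\<lambda>y. SUP i. U i y) (\<omega> n) \<partial>P x)"
      using seq.hyps
      by (intro nn_integral_cong) (simp add: positive_operator_SUP[OF positive_operator_step] SUP_mult_left_ennreal)
    moreover have "Sup (range U) = (\<lambda>y. SUP i. U i y)"
      by (rule ext) (rule SUP_apply)
    ultimately show ?case by (simp only:)
  qed
  then show ?thesis using f by (simp add: nn_integral_distr nn_integral_density h_def)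
qed

text \<open>Step k reads the coordinates k and k + 1, so this event depends on the coordinates 0,
  ..., n only. Hence the Markov property at time n can be applied to it.\<close>

definition no_jump :: "'a set \<Rightarrow> 'a set \<Rightarrow> nat \<Rightarrow> (nat \<Rightarrow> 'a) set" where
  "no_jump C D n = {\<omega>. \<forall>k<n. \<not> (\<omega> k \<in> C \<and> \<omega> (Suc k) \<in> D)}"

context
  fixes C D :: "'a set"
  assumes C[measurable]: "C \<in> sets borel" and D[measurable]: "D \<in> sets borel"
begin

lemma no_jump_measurable [measurable]: "no_jump C D n \<in> sets (\<Pi>\<^sub>M n\<in>UNIV. borel)"
proof -
  have "{\<omega> \<in> space (\<Pi>\<^sub>M n\<in>UNIV. borel). \<forall>k<n. \<not> (\<omega> k \<in> C \<and> \<omega> (Suc k) \<in> D)} \<in> sets (\<Pi>\<^sub>M n\<in>UNIV. borel)"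
    by measurable
  then show ?thesis by (simp add: no_jump_def space_PiM PiE_def Pi_def)
qed

lemma nn_integral_no_jump_Suc:
  assumes [measurable]: "f \<in> borel_measurable borel" and B[measurable]: "B \<in> sets borel"
  shows "(\<integral>\<^sup>+\<omega>. indicator (no_jump C D n) \<omega> * (indicator B (\<omega> n) * f (\<omega> (Suc n))) \<partial>P x) =
    (\<integral>\<^sup>+\<omega>. indicator (no_jump C D n) \<omega> * (indicator B (\<omega> n) * step f (\<omega> n)) \<partial>P x)"
proof -
  let ?H = "{\<omega> \<in> space (\<Pi>\<^sub>M i\<in>{..n}. borel). (\<forall>k<n. \<not> (\<omega> k \<in> C \<and> \<omega> (Suc k) \<in> D)) \<and> \<omega> n \<in> B}"
  have H: "?H \<in> sets (\<Pi>\<^sub>M i\<in>{..n}. borel)"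
    by measurable
  have eq: "indicator ?H (restrict \<omega> {..n}) = (indicator (no_jump C D n) \<omega> * indicator B (\<omega> n) :: ennreal)" for \<omega>
    by (auto simp: indicator_def no_jump_def space_PiM PiE_def Pi_def)
  show ?thesis
    using nn_integral_Markov[OF H assms(1), of x] by (simp only: eq mult.assoc)
qed

text \<open>\<open>stay\<close> is the kernel of the chain killed at its first jump. The last step
  is peeled off by the Markov property and becomes an application of \<open>stay\<close> to f, which
  is why f is general in the induction.\<close>

lemma nn_integral_no_jump:
  assumes "f \<in> borel_measurable borel"
  shows "(\<integral>\<^sup>+\<omega>. indicator (no_jump C D n) \<omega> * f (\<omega> n) \<partial>P x) = (stay C D ^^ n) f x"
  using assms
proof (induction n arbitrary: f)
  case 0
  have "(\<integral>\<^sup>+\<omega>. f (\<omega> 0) \<partial>P x) = (\<integral>\<^sup>+\<omega>. f x \<partial>P x)"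
    using AE_start[of x] by (intro nn_integral_cong_AE) auto
  then show ?case
    using prob_space.emeasure_space_1[OF law_prob, of x] by (simp add: no_jump_def)
next
  case (Suc n)
  note [measurable] = Suc.prems
  let ?N = "\<lambda>\<omega>. indicator (no_jump C D n) \<omega> :: ennreal"
  have m: "(\<lambda>\<omega>. step g (\<omega> n)) \<in> borel_measurable (P x)" if "g \<in> borel_measurable borel" for g
    by (rule measurable_compose[OF coordinate_measurable
          positive_operator_measurable[OF positive_operator_step that]])
  note [measurable] = m[OF Suc.prems] m[of "\<lambda>y. indicator (- D) y * f y"]
  have "(\<integral>\<^sup>+\<omega>. indicator (no_jump C D (Suc n)) \<omega> * f (\<omega> (Suc n)) \<partial>P x) =
    (\<integral>\<^sup>+\<omega>. ?N \<omega> * (indicator (- C) (\<omega> n) * f (\<omega> (Suc n))) +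
      ?N \<omega> * (indicator C (\<omega> n) * (indicator (- D) (\<omega> (Suc n)) * f (\<omega> (Suc n)))) \<partial>P x)"
    by (intro nn_integral_cong) (auto simp: indicator_def no_jump_def less_Suc_eq)
  also have "\<dots> = (\<integral>\<^sup>+\<omega>. ?N \<omega> * (indicator (- C) (\<omega> n) * f (\<omega> (Suc n))) \<partial>P x) +
      (\<integral>\<^sup>+\<omega>. ?N \<omega> * (indicator C (\<omega> n) * (indicator (- D) (\<omega> (Suc n)) * f (\<omega> (Suc n)))) \<partial>P x)"
    by (intro nn_integral_add) measurable
  also have "\<dots> = (\<integral>\<^sup>+\<omega>. ?N \<omega> * (indicator (- C) (\<omega> n) * step f (\<omega> n)) \<partial>P x) +
      (\<integral>\<^sup>+\<omega>. ?N \<omega> * (indicator C (\<omega> n) * step (\<lambda>y. indicator (- D) y * f y) (\<omega> n)) \<partial>P x)"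
    by (intro arg_cong2[where f = "(+)"] nn_integral_no_jump_Suc) measurable
  also have "\<dots> = (\<integral>\<^sup>+\<omega>. ?N \<omega> * (indicator (- C) (\<omega> n) * step f (\<omega> n)) +
      ?N \<omega> * (indicator C (\<omega> n) * step (\<lambda>y. indicator (- D) y * f y) (\<omega> n)) \<partial>P x)"
    by (intro nn_integral_add[symmetric]) measurable
  also have "\<dots> = (\<integral>\<^sup>+\<omega>. ?N \<omega> * stay C D f (\<omega> n) \<partial>P x)"
    by (intro nn_integral_cong) (simp add: stay_def distrib_left)
  also have "\<dots> = (stay C D ^^ n) (stay C D f) x"
    by (rule Suc.IH[OF positive_operator_measurable[OF positive_operator_stay[OF C D] Suc.prems]])
  also have "\<dots> = (stay C D ^^ Suc n) f x"
    by (simp only: funpow_Suc_right o_apply)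
  finally show ?case .
qed

text \<open>The events "first jump at step k" are disjoint, and surviving until k contributes the
  k-th power of \<open>stay\<close>. B marks the point before the jump and B' the point after it: B
  = UNIV yields the entrance law, B' = UNIV the exit law.\<close>

lemma emeasure_first_jump:
  assumes [measurable]: "B \<in> sets borel" "B' \<in> sets borel"
  shows "emeasure (P x) {\<omega>. \<exists>k. \<omega> \<in> no_jump C D k \<and> \<omega> k \<in> C \<inter> B \<and> \<omega> (Suc k) \<in> D \<inter> B'} =
    green (stay C D) (\<lambda>y. indicator B y * jump C D (indicator B') y) x" (is "emeasure _ ?S = _")
proof -
  let ?T = "\<lambda>k. {\<omega> \<in> space (P x). \<omega> \<in> no_jump C D k \<and> \<omega> k \<in> C \<inter> B \<and> \<omega> (Suc k) \<in> D \<inter> B'}"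
  have m: "?T k \<in> sets (P x)" for k
    by measurable
  have disj: "disjoint_family ?T"
    unfolding disjoint_family_on_def
  proof (intro ballI impI)
    fix k l :: nat assume "k \<noteq> l"
    then show "?T k \<inter> ?T l = {}"
      by (cases k l rule: linorder_cases) (auto simp: no_jump_def)
  qed
  have first: "emeasure (P x) (?T k) = (stay C D ^^ k) (\<lambda>y. indicator B y * jump C D (indicator B') y) x" for k
  proof -
    have "emeasure (P x) (?T k) = (\<integral>\<^sup>+\<omega>. indicator (?T k) \<omega> \<partial>P x)"
      using m by (simp only: nn_integral_indicator)
    also have "\<dots> = (\<integral>\<^sup>+\<omega>. indicator (no_jump C D k) \<omega> *
        (indicator (C \<inter> B) (\<omega> k) * (indicator D (\<omega> (Suc k)) * indicator B' (\<omega> (Suc k)))) \<partial>P x)"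
      by (intro nn_integral_cong) (auto simp: indicator_def)
    also have "\<dots> = (\<integral>\<^sup>+\<omega>. indicator (no_jump C D k) \<omega> *
        (indicator (C \<inter> B) (\<omega> k) * step (\<lambda>y. indicator D y * indicator B' y) (\<omega> k)) \<partial>P x)"
      by (intro nn_integral_no_jump_Suc) measurable
    also have "\<dots> = (\<integral>\<^sup>+\<omega>. indicator (no_jump C D k) \<omega> *
        (indicator B (\<omega> k) * jump C D (indicator B') (\<omega> k)) \<partial>P x)"
      by (intro nn_integral_cong) (auto simp: indicator_def jump_def)
    also have "\<dots> = (stay C D ^^ k) (\<lambda>y. indicator B y * jump C D (indicator B') y) x"
    proof (rule nn_integral_no_jump)
      have [measurable]: "jump C D (indicator B') \<in> borel_measurable borel"
        by (rule positive_operator_measurable[OF positive_operator_jump[OF C D]]) measurable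
      show "(\<lambda>y. indicator B y * jump C D (indicator B') y) \<in> borel_measurable borel"
        by measurable
    qed
    finally show ?thesis .
  qed
  have "?S = (\<Union>k. ?T k)" by auto
  moreover have "range ?T \<subseteq> sets (P x)"
    using m by blast
  ultimately have "emeasure (P x) ?S = (\<Sum>k. emeasure (P x) (?T k))"
    using suminf_emeasure[OF _ disj, of "P x"] by (simp only:)
  then show ?thesis by (simp only: first green_def)
qed

end

text \<open>For \<open>C = D = {}\<close> there are no jumps at all, so \<open>stay\<close> is
  \<open>step\<close> and the formula for surviving one step describes the law of the first
  coordinate.\<close>

lemma step_law_eq: "step_law P x = K x"
proof (rule measure_eqI)
  fix B assume "B \<in> sets (step_law P x)"
  then have B[measurable]: "B \<in> sets borel" by (simp add: step_law_def)
  have "emeasure (step_law P x) B = (\<integral>\<^sup>+y. indicator B y \<partial>step_law P x)"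
    by (simp add: step_law_def)
  also have "\<dots> = (\<integral>\<^sup>+\<omega>. indicator B (\<omega> (1::nat)) \<partial>P x)"
    unfolding step_law_def by (rule nn_integral_distr[OF coordinate_measurable]) simp
  also have "\<dots> = step (indicator B) x"
    using nn_integral_no_jump[where C = "{}" and D = "{}" and n = 1 and f = "indicator B" and x = x] by (simp add: no_jump_def stay_def)
  finally show "emeasure (step_law P x) B = emeasure (K x) B" by (simp add: step_def)
qed (simp add: step_law_def)

text \<open>The probability of a jump at any time, not in the next step; see
  \<open>emeasure_jump_ever\<close>. The form as a potential makes \<open>green_le\<close>
  applicable.\<close>

definition jump_prob :: "'a set \<Rightarrow> 'a set \<Rightarrow> 'a \<Rightarrow> ennreal" where
  "jump_prob C D = green (stay C D) (jump C D (\<lambda>_. 1))"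

lemma first_jump_iff:
  "(\<exists>k. \<omega> \<in> no_jump C D k \<and> \<omega> k \<in> C \<and> \<omega> (Suc k) \<in> D) \<longleftrightarrow> (\<exists>k. \<omega> k \<in> C \<and> \<omega> (Suc k) \<in> D)"
  unfolding no_jump_def mem_Collect_eq
  by (subst (2) exists_least_iff) blast

context
  fixes C D :: "'a set"
  assumes C[measurable]: "C \<in> sets borel" and D[measurable]: "D \<in> sets borel"
begin

lemma jump_one_measurable [measurable]: "jump C D (\<lambda>_. 1) \<in> borel_measurable borel"
  by (rule positive_operator_measurable[OF positive_operator_jump[OF C D]]) measurable

lemma jump_prob_measurable [measurable]: "jump_prob C D \<in> borel_measurable borel"
  unfolding jump_prob_def
  by (rule positive_operator_measurable[OF positive_operator_green[OF positive_operator_stay[OF C D]]]) measurable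

lemma emeasure_jump_ever:
  "emeasure (P x) {\<omega>. \<exists>k. \<omega> k \<in> C \<and> \<omega> (Suc k) \<in> D} = jump_prob C D x"
proof -
  have "(indicator UNIV :: 'a \<Rightarrow> ennreal) = (\<lambda>_. 1)"
    by auto
  then show ?thesis
    using emeasure_first_jump[OF C D, of UNIV UNIV x]
    by (simp add: first_jump_iff jump_prob_def)
qed

lemma stay_jump_one: "stay C D (\<lambda>_. 1) x + jump C D (\<lambda>_. 1) x = 1"
  using step_eq_stay_jump[OF C D, of "\<lambda>_. 1" x] by (simp add: step_const)

lemma jump_prob_unfold: "jump_prob C D x = jump C D (\<lambda>_. 1) x + stay C D (jump_prob C D) x"
  unfolding jump_prob_def by (rule green_unfold[OF positive_operator_stay[OF C D]]) measurable

lemma jump_prob_le_1: "jump_prob C D x \<le> 1"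
  unfolding jump_prob_def
  by (rule green_le[OF positive_operator_stay[OF C D]]) (use stay_jump_one in auto)

text \<open>Starting one step later can only lose jumps: if the first step is itself a jump, the
  weight 1 is replaced by the probability of yet another jump.\<close>

lemma jump_prob_superharmonic: "step (jump_prob C D) x \<le> jump_prob C D x"
proof -
  have "step (jump_prob C D) x = stay C D (jump_prob C D) x + jump C D (jump_prob C D) x"
    by (rule step_eq_stay_jump[OF C D]) measurable
  also have "\<dots> \<le> stay C D (jump_prob C D) x + jump C D (\<lambda>_. 1) x"
    by (intro add_left_mono positive_operator_mono[OF positive_operator_jump[OF C D]] jump_prob_le_1) measurable
  also have "\<dots> = jump_prob C D x"
    using jump_prob_unfold[of x] by (simp add: add.commute)
  finally show ?thesis .
qed

text \<open>Total probability: either the first n steps contain no jump, or one of them is the first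
  jump.\<close>

lemma funpow_stay_one: "(stay C D ^^ n) (\<lambda>_. 1) x + (\<Sum>k<n. (stay C D ^^ k) (jump C D (\<lambda>_. 1)) x) = 1"
proof (induction n)
  case (Suc n)
  note S = positive_operator_stay[OF C D]
  have "(stay C D ^^ n) (\<lambda>_. 1) x = (stay C D ^^ n) (\<lambda>y. stay C D (\<lambda>_. 1) y + jump C D (\<lambda>_. 1) y) x"
    by (simp only: stay_jump_one)
  also have "\<dots> = (stay C D ^^ n) (stay C D (\<lambda>_. 1)) x + (stay C D ^^ n) (jump C D (\<lambda>_. 1)) x"
    by (intro positive_operator_add[OF positive_operator_funpow[OF S]] positive_operator_measurable[OF S]) measurable
  also have "(stay C D ^^ n) (stay C D (\<lambda>_. 1)) x = (stay C D ^^ Suc n) (\<lambda>_. 1) x"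
    by (simp only: funpow_Suc_right o_apply)
  finally show ?case using Suc.IH by (simp only: sum.lessThan_Suc ac_simps)
qed simp

text \<open>A chain started in W stays in W almost surely, so an inequality between h and f on W is
  enough. It serves for a constant h and f = \<open>jump_prob C D\<close>, where the lower bound is
  known on W only.\<close>

lemma funpow_stay_mono_absorbing:
  assumes f: "f \<in> borel_measurable borel" and h: "h \<in> borel_measurable borel"
    and W: "\<And>y. y \<in> W \<Longrightarrow> AE z in K y. z \<in> W" and le: "\<And>y. y \<in> W \<Longrightarrow> h y \<le> f y"
    and "x \<in> W"
  shows "(stay C D ^^ n) h x \<le> (stay C D ^^ n) f x"
  using \<open>x \<in> W\<close>
proof (induction n arbitrary: x)
  case (Suc n)
  define h' f' where "h' = (stay C D ^^ n) h" and "f' = (stay C D ^^ n) f"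
  have le_AE: "AE z in K x. h' z \<le> f' z"
    unfolding h'_def f'_def using W[OF Suc.prems] by eventually_elim (rule Suc.IH)
  have "step (\<lambda>y. indicator B y * h' y) x \<le> step (\<lambda>y. indicator B y * f' y) x" for B
    unfolding step_def using le_AE by (intro nn_integral_mono_AE) (auto elim!: eventually_mono intro: mult_left_mono)
  from this[of UNIV] this[of "- D"] have "stay C D h' x \<le> stay C D f' x"
    by (auto simp: stay_def intro!: add_mono mult_left_mono)
  then show ?case by (simp add: h'_def f'_def)
qed (use le in auto)

text \<open>
  With \<open>a n\<close> the probability of a jump within \<open>n\<close> steps and \<open>g = jump_prob C D\<close>, on \<open>W\<close> the Markov
  property gives \<open>g - a n \<ge> \<delta> (1 - a n)\<close>; now let \<open>n\<close> tend to infinity.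
\<close>

lemma jump_prob_zero_one:
  assumes W: "\<And>y. y \<in> W \<Longrightarrow> AE z in K y. z \<in> W"
    and \<delta>: "\<delta> > 0" "\<delta> < \<infinity>" and ge: "\<And>y. y \<in> W \<Longrightarrow> \<delta> \<le> jump_prob C D y" and x: "x \<in> W"
  shows "jump_prob C D x = 1"
proof -
  let ?S = "stay C D" and ?r = "jump C D (\<lambda>_. 1)" and ?g = "jump_prob C D"
  note S = positive_operator_stay[OF C D]
  define a where "a n = (\<Sum>k<n. (?S ^^ k) ?r x)" for n
  have g_sup: "?g x = (SUP n. a n)"
    by (simp add: jump_prob_def green_def suminf_eq_SUP a_def)
  have g: "?g x = a n + (?S ^^ n) ?g x" for n
    unfolding a_def jump_prob_def by (rule funpow_green[OF S]) measurable
  \<comment> \<open>The mass without a jump in n steps is 1 - a n. It is bounded below by 1 - g, so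
    that n remains on the left only in a n and the supremum over n can be taken there.\<close>
  have "a n + \<delta> * (1 - ?g x) \<le> ?g x" for n
  proof -
    have "1 - ?g x \<le> (?S ^^ n) (\<lambda>_. 1) x"
    proof -
      have "a n \<le> ?g x" using g[of n] by simp
      then have "1 \<le> (?S ^^ n) (\<lambda>_. 1) x + ?g x"
        using add_left_mono[of "a n" "?g x" "(?S ^^ n) (\<lambda>_. 1) x"] funpow_stay_one[of n x]
        by (simp only: a_def)
      then show ?thesis by (simp only: ennreal_minus_le_iff add.commute) simp
    qed
    then have "\<delta> * (1 - ?g x) \<le> \<delta> * (?S ^^ n) (\<lambda>_. 1) x"
      by (rule mult_left_mono) simp
    also have "\<dots> = (?S ^^ n) (\<lambda>_. \<delta> * 1) x"
      by (rule positive_operator_cmult[OF positive_operator_funpow[OF S], symmetric]) simp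
    also have "\<dots> \<le> (?S ^^ n) ?g x"
      by (rule funpow_stay_mono_absorbing[OF jump_prob_measurable _ W _ x]) (simp_all add: ge)
    finally have "a n + \<delta> * (1 - ?g x) \<le> a n + (?S ^^ n) ?g x"
      by (rule add_left_mono)
    then show ?thesis by (simp only: g[of n, symmetric])
  qed
  then have "(SUP n. a n + \<delta> * (1 - ?g x)) \<le> ?g x"
    by (intro SUP_least)
  then have "?g x + \<delta> * (1 - ?g x) \<le> ?g x"
    by (simp add: g_sup ennreal_SUP_add_left)
  \<comment> \<open>Finiteness permits cancelling g on both sides, which leaves \<delta> * (1 - g) =
    0.\<close>
  moreover have "?g x < \<infinity>"
    by (rule le_less_trans[OF jump_prob_le_1]) simp
  ultimately have "\<not> 0 < \<delta> * (1 - ?g x)"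
    using ennreal_add_left_cancel_le[of "?g x" "\<delta> * (1 - ?g x)" 0]
    by (simp add: not_less less_top[symmetric])
  then have "\<not> 0 < 1 - ?g x"
    using \<delta>(1) by (simp only: ennreal_zero_less_mult_iff simp_thms)
  then have "\<not> ?g x < 1"
    using diff_gr0_ennreal by blast
  then show ?thesis using jump_prob_le_1[of x] by (simp only: not_less antisym)
qed

lemma superharmonic_ge_jump_prob:
  assumes f[measurable]: "f \<in> borel_measurable borel" and super: "\<And>y. step f y \<le> f y"
    and ge: "\<And>y. y \<in> D \<Longrightarrow> c \<le> f y"
  shows "c * jump_prob C D x \<le> f x"
proof -
  note J = positive_operator_jump[OF C D] and S = positive_operator_stay[OF C D]
  have "c * jump_prob C D x = green (stay C D) (\<lambda>y. c * jump C D (\<lambda>_. 1) y) x"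
    unfolding jump_prob_def by (rule positive_operator_cmult[OF positive_operator_green[OF S], symmetric]) measurable
  also have "\<dots> \<le> f x"
  proof (rule green_le[OF S])
    fix y
    have "c * jump C D (\<lambda>_. 1) y = jump C D (\<lambda>_. c * 1) y"
      by (rule positive_operator_cmult[OF J, symmetric]) simp
    \<comment> \<open>\<open>jump\<close> evaluates its argument on D only. Cutting the constant off
      outside D allows the comparison with f, whose lower bound holds on D alone.\<close>
    also have "\<dots> = jump C D (\<lambda>z. indicator D z * c) y"
    proof -
      have "(\<lambda>z. indicator D z * (c * 1)) = (\<lambda>z. indicator D z * (indicator D z * c))"
        by (auto simp: indicator_def)
      then show ?thesis by (simp only: jump_def)
    qed
    also have "\<dots> \<le> jump C D f y"
    proof -
      have "indicator D z * (indicator D z * c) \<le> (indicator D z * f z :: ennreal)" for z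
        using ge by (auto simp: indicator_def)
      then have "step (\<lambda>z. indicator D z * (indicator D z * c)) y \<le> step (\<lambda>z. indicator D z * f z) y"
        unfolding step_def by (rule nn_integral_mono)
      then show ?thesis
        unfolding jump_def by (rule mult_left_mono) simp
    qed
    finally show "stay C D f y + c * jump C D (\<lambda>_. 1) y \<le> f y"
      by (rule order_trans[OF add_left_mono])
        (use super[of y] step_eq_stay_jump[OF C D f, of y] in simp)
  qed measurable
  finally show ?thesis .
qed

end

lemma hitting_time_finite_iff: "hitting_time G \<omega> < \<infinity> \<longleftrightarrow> (\<exists>k. \<omega> (Suc k) \<in> G)"
proof
  assume "hitting_time G \<omega> < \<infinity>"
  then have "{n. n \<ge> 1 \<and> \<omega> n \<in> G} \<noteq> {}"
    unfolding hitting_time_def by (intro notI) (simp only: image_empty Inf_enat_def simp_thms if_True less_irrefl)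
  then obtain n where "n \<ge> 1" "\<omega> n \<in> G" by blast
  then show "\<exists>k. \<omega> (Suc k) \<in> G" by (intro exI[of _ "n - 1"]) simp
next
  assume "\<exists>k. \<omega> (Suc k) \<in> G"
  then obtain k where "\<omega> (Suc k) \<in> G" ..
  then have "hitting_time G \<omega> \<le> enat (Suc k)"
    unfolding hitting_time_def by (intro Inf_lower) auto
  also have "\<dots> < \<infinity>" by simp
  finally show "hitting_time G \<omega> < \<infinity>" .
qed

text \<open>Hitting times start at 1, as do the landing times of jumps; hence a visit that counts is
  exactly a jump from UNIV into G.\<close>

lemma emeasure_hitting:
  assumes "G \<in> sets borel"
  shows "ennreal (measure (P x) {\<omega> \<in> space (P x). hitting_time G \<omega> < \<infinity>}) = jump_prob UNIV G x"
proof -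
  interpret prob_space "P x" by (rule law_prob)
  have "{\<omega> \<in> space (P x). hitting_time G \<omega> < \<infinity>} = {\<omega>. \<exists>k. \<omega> k \<in> UNIV \<and> \<omega> (Suc k) \<in> G}"
    by (simp only: hitting_time_finite_iff) auto
  then show ?thesis
    using emeasure_jump_ever[of UNIV G x] assms emeasure_eq_measure by simp
qed

end

section \<open>Approximation of open sets by continuous functions\<close>

lemma open_indicator_eq_SUP_continuous:
  fixes G :: "'a::metric_space set"
  assumes "open G"
  obtains F :: "nat \<Rightarrow> 'a \<Rightarrow> real" where
    "\<And>n. continuous_on UNIV (F n)" "\<And>n y. 0 \<le> F n y" "\<And>n y. F n y \<le> 1"
    "\<And>y. incseq (\<lambda>n. F n y)" "\<And>y. (SUP n. ennreal (F n y)) = indicator G y"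
\<comment> \<open>\<open>infdist\<close> to the empty set is 0 by convention, so the distance
  formula below would give 0 instead of 1 for the whole space.\<close>
proof (cases "G = UNIV")
  case True
  then show ?thesis by (intro that[of "\<lambda>_ _. 1"]) auto
next
  case False
  define F where "F n y = min 1 (real n * infdist y (- G))" for n y
  have "(SUP n. ennreal (F n y)) = indicator G y" for y
  proof (cases "y \<in> G")
    case True
    have "infdist y (- G) \<noteq> 0"
      using in_closed_iff_infdist_zero[of "- G" y] assms False True by auto
    then have "infdist y (- G) > 0"
      using infdist_nonneg[of y "- G"] by linarith
    then obtain n :: nat where "1 < real n * infdist y (- G)"
      using reals_Archimedean3 by blast
    then have "F n y = 1" by (simp add: F_def)
    then have "ennreal (F n y) = 1" by (simp only: ennreal_1)
    then have "1 \<le> (SUP n. ennreal (F n y))"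
      using SUP_upper[of n UNIV "\<lambda>n. ennreal (F n y)"] by simp
    moreover have "(SUP n. ennreal (F n y)) \<le> 1"
      by (rule SUP_least) (simp add: F_def ennreal_le_1)
    ultimately show ?thesis using True by (metis antisym indicator_simps(1))
  next
    case y: False
    then have "infdist y (- G) = 0"
      by (intro infdist_zero) simp
    then show ?thesis using y by (simp add: F_def)
  qed
  moreover have "incseq (\<lambda>n. F n y)" for y
    unfolding F_def by (intro incseq_SucI min.mono mult_right_mono order_refl) (simp_all add: infdist_nonneg)
  moreover have "continuous_on UNIV (F n)" for n
    unfolding F_def[abs_def] by (intro continuous_intros)
  moreover have "0 \<le> F n y" "F n y \<le> 1" for n y
    by (simp_all add: F_def infdist_nonneg)
  ultimately show ?thesis
    using that by blast
qed

section \<open>Recurrence\<close>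

locale recurrent_Feller_chain = markov_chain K P
  for K :: "'a::{metric_space, second_countable_topology} \<Rightarrow> 'a measure"
    and P :: "'a \<Rightarrow> (nat \<Rightarrow> 'a) measure" +
  assumes irreducible: "topologically_irreducible P"
    and recurrent: "topologically_recurrent P"
    and Feller: "weak_Feller P"
begin

lemma step_continuous:
  assumes f: "continuous_on UNIV f" "\<And>y. 0 \<le> f y" "\<And>y. f y \<le> 1"
  obtains f' :: "'a \<Rightarrow> real" where "continuous_on UNIV f'" "\<And>y. 0 \<le> f' y" "\<And>y. f' y \<le> 1"
    "step (\<lambda>y. ennreal (f y)) = (\<lambda>x. ennreal (f' x))"
proof
  let ?f' = "\<lambda>x. \<integral>y. f y \<partial>K x"
  have m: "f \<in> borel_measurable borel"
    by (rule borel_measurable_continuous_onI[OF f(1)])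
  have "bounded (range f)"
    using f(2,3) by (intro boundedI[of _ 1]) (auto simp: abs_of_nonneg)
  then show "continuous_on UNIV ?f'"
    using Feller f(1) unfolding weak_Feller_def step_law_eq by blast
  show nonneg: "0 \<le> ?f' x" for x
    by (intro integral_nonneg_AE) (simp add: f)
  show eq: "step (\<lambda>y. ennreal (f y)) = (\<lambda>x. ennreal (?f' x))"
  proof
    fix x
    interpret prob_space "K x" by (rule prob_space_K)
    have "integrable (K x) f"
      by (rule integrable_const_bound[of _ 1]) (use f m in auto)
    then show "step (\<lambda>y. ennreal (f y)) x = ennreal (?f' x)"
      unfolding step_def by (intro nn_integral_eq_integral) (auto simp: f)
  qed
  show "?f' x \<le> 1" for x
  proof -
    have "ennreal (?f' x) = step (\<lambda>y. ennreal (f y)) x"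
      using fun_cong[OF eq, of x] by simp
    also have "\<dots> \<le> step (\<lambda>_. 1) x"
      by (rule step_mono) (simp add: f ennreal_le_1)
    finally show ?thesis by (simp add: step_const ennreal_le_1)
  qed
qed

lemma funpow_step_continuous:
  assumes "continuous_on UNIV f" "\<And>y. 0 \<le> f y" "\<And>y. f y \<le> 1"
  obtains f' :: "'a \<Rightarrow> real" where "continuous_on UNIV f'" "\<And>y. 0 \<le> f' y" "\<And>y. f' y \<le> 1"
    "(step ^^ n) (\<lambda>y. ennreal (f y)) = (\<lambda>x. ennreal (f' x))"
proof -
  have "\<exists>f' :: 'a \<Rightarrow> real. continuous_on UNIV f' \<and> (\<forall>y. 0 \<le> f' y) \<and> (\<forall>y. f' y \<le> 1) \<and>
    (step ^^ n) (\<lambda>y. ennreal (f y)) = (\<lambda>x. ennreal (f' x))"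
  proof (induction n)
    case (Suc n)
    then obtain h where h: "continuous_on UNIV h" "\<And>y. 0 \<le> h y" "\<And>y. h y \<le> 1"
      "(step ^^ n) (\<lambda>y. ennreal (f y)) = (\<lambda>x. ennreal (h x))" by blast
    obtain f' where "continuous_on UNIV f'" "\<And>y. 0 \<le> f' y" "\<And>y. f' y \<le> 1"
      "step (\<lambda>y. ennreal (h y)) = (\<lambda>x. ennreal (f' x))"
      using step_continuous[OF h(1-3)] by blast
    then show ?case using h(4) by (intro exI[of _ f']) simp
  qed (use assms in auto)
  then show ?thesis using that by blast
qed

text \<open>K^n(., G) is an increasing limit of continuous functions, hence lower semicontinuous,
  and positivity at x spreads to a neighbourhood. This is the gate through which the weak Feller
  property enters. The power n is arbitrary because irreducibility gives no control over the time of
  a visit.\<close>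

lemma funpow_step_lower_bound:
  assumes G: "open G" and pos: "(step ^^ n) (indicator G) x > 0"
  obtains U \<delta> where "open U" "x \<in> U" "\<delta> > 0" "\<delta> < \<infinity>" "\<And>y. y \<in> U \<Longrightarrow> \<delta> \<le> (step ^^ n) (indicator G) y"
proof -
  obtain F :: "nat \<Rightarrow> 'a \<Rightarrow> real" where F: "\<And>n. continuous_on UNIV (F n)" "\<And>n y. 0 \<le> F n y" "\<And>n y. F n y \<le> 1"
    "\<And>y. incseq (\<lambda>n. F n y)" "\<And>y. (SUP n. ennreal (F n y)) = indicator G y"
    using open_indicator_eq_SUP_continuous[OF G] by metis
  note T = positive_operator_funpow[OF positive_operator_step, of n]
  have [measurable]: "F m \<in> borel_measurable borel" for m
    by (rule borel_measurable_continuous_onI[OF F(1)])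
  have ind: "indicator G = (\<lambda>y. SUP m. ennreal (F m y))"
    using F(5) by auto
  have inc: "incseq (\<lambda>m y. ennreal (F m y))"
    using F(4) by (auto simp: incseq_def le_fun_def intro!: ennreal_leI)
  have "(step ^^ n) (indicator G) x = (SUP m. (step ^^ n) (\<lambda>y. ennreal (F m y)) x)"
    unfolding ind by (rule positive_operator_SUP[OF T _ inc]) measurable
  with pos obtain m where m: "(step ^^ n) (\<lambda>y. ennreal (F m y)) x > 0"
    by (auto simp: less_SUP_iff)
  obtain f where f: "continuous_on UNIV f" "(step ^^ n) (\<lambda>y. ennreal (F m y)) = (\<lambda>x. ennreal (f x))"
    using funpow_step_continuous[OF F(1-3)] by blast
  have "f x > 0" using m f(2) by (simp add: ennreal_less_zero_iff)
  show ?thesis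
  proof (rule that[of "{y. f y > f x / 2}" "ennreal (f x / 2)"])
    show "open {y. f x / 2 < f y}"
      by (rule open_Collect_less[OF continuous_on_const f(1)])
    fix y assume "y \<in> {y. f x / 2 < f y}"
    then have "ennreal (f x / 2) \<le> (step ^^ n) (\<lambda>y. ennreal (F m y)) y"
      unfolding f(2) by (intro ennreal_leI) simp
    also have "\<dots> \<le> (step ^^ n) (indicator G) y"
      using F(2,3) by (intro positive_operator_mono[OF T]) (auto simp: ind intro: SUP_upper)
    finally show "ennreal (f x / 2) \<le> (step ^^ n) (indicator G) y" .
  qed (use \<open>f x > 0\<close> in auto)
qed

lemma stay_le_step:
  assumes [measurable]: "C \<in> sets borel" "D \<in> sets borel" "f \<in> borel_measurable borel"
  shows "stay C D f x \<le> step f x"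
  using step_eq_stay_jump[of C D f x] by simp

lemma jump_UNIV_one: "jump UNIV G (\<lambda>_. 1) = step (indicator G)"
  by (simp add: jump_def[abs_def])

text \<open>Irreducibility concerns a hit at some unspecified time, that is, a series over the time
  of the first hit. One term of the series must be positive, and it only grows when the killing is
  removed, since \<open>stay\<close> is dominated by \<open>step\<close>.\<close>

lemma positive_step_probability:
  assumes G: "open G" "G \<noteq> {}"
  obtains n where "n > 0" "(step ^^ n) (indicator G) x > 0"
proof -
  have [measurable]: "G \<in> sets borel" using G by simp
  note S = positive_operator_stay[of UNIV G]
  have "jump_prob UNIV G x > 0"
    using irreducible G emeasure_hitting[of G x]
    unfolding topologically_irreducible_def by (simp add: ennreal_less_zero_iff flip: emeasure_hitting)
  moreover have "jump_prob UNIV G x = 0" if "\<forall>k. (stay UNIV G ^^ k) (step (indicator G)) x = 0"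
    unfolding jump_prob_def green_def jump_UNIV_one using that by simp
  ultimately have "\<not> (\<forall>k. (stay UNIV G ^^ k) (step (indicator G)) x = 0)"
    by (metis less_irrefl)
  then obtain k where k: "(stay UNIV G ^^ k) (step (indicator G)) x > 0"
    by (auto simp: zero_less_iff_neq_zero)
  have le: "(stay UNIV G ^^ k) f y \<le> (step ^^ k) f y" if f: "f \<in> borel_measurable borel" for f y
  proof (induction k arbitrary: y)
    case (Suc k)
    have m: "(stay UNIV G ^^ k) f \<in> borel_measurable borel" "(step ^^ k) f \<in> borel_measurable borel"
      using f by (auto intro!: funpow_measurable[OF S] funpow_measurable[OF positive_operator_step])
    have "stay UNIV G ((stay UNIV G ^^ k) f) y \<le> step ((stay UNIV G ^^ k) f) y"
      using m by (intro stay_le_step) auto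
    also have "\<dots> \<le> step ((step ^^ k) f) y"
      by (rule positive_operator_mono[OF positive_operator_step m Suc.IH])
    finally show ?case by simp
  qed simp
  have "(stay UNIV G ^^ k) (step (indicator G)) x \<le> (step ^^ k) (step (indicator G)) x"
    by (intro le positive_operator_measurable[OF positive_operator_step]) simp
  also have "\<dots> = (step ^^ Suc k) (indicator G) x"
    by (simp only: funpow_Suc_right o_apply)
  finally have "(step ^^ Suc k) (indicator G) x > 0"
    using k by (rule less_le_trans[rotated])
  then show ?thesis by (intro that[of "Suc k"]) auto
qed

text \<open>Superharmonicity replaces the inclusion of path events: with h the hitting probability,
  K^(n+1) 1_G \<le> K h \<le> h. The induction starts from n = 1, since a visit at time 0 is not a
  hit.\<close>

lemma funpow_step_le_jump_prob:
  assumes [measurable]: "G \<in> sets borel" and "n > 0"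
  shows "(step ^^ n) (indicator G) x \<le> jump_prob UNIV G x"
  using \<open>n > 0\<close>
proof (induction n arbitrary: x)
  case (Suc n)
  show ?case
  proof (cases "n = 0")
    case True
    have "jump UNIV G (\<lambda>_. 1) x \<le> jump_prob UNIV G x"
      by (subst jump_prob_unfold) auto
    then show ?thesis using True by (simp add: jump_UNIV_one)
  next
    case False
    have "step ((step ^^ n) (indicator G)) x \<le> step (jump_prob UNIV G) x"
      using False by (intro positive_operator_mono[OF positive_operator_step] Suc.IH
          funpow_measurable[OF positive_operator_step] jump_prob_measurable) auto
    also have "\<dots> \<le> jump_prob UNIV G x"
      by (rule jump_prob_superharmonic) auto
    finally show ?thesis by simp
  qed
qed simp

text \<open>The average over one step of a function bounded by 1 equals 1, so the function equals 1
  almost surely.\<close>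

lemma AE_absorbing_jump_prob_1:
  assumes U[measurable]: "U \<in> sets borel" and h1: "\<And>y. y \<in> U \<Longrightarrow> jump_prob UNIV U y = 1"
    and y: "jump_prob UNIV U y = 1"
  shows "AE z in K y. jump_prob UNIV U z = 1"
proof -
  interpret prob_space "K y" by (rule prob_space_K)
  let ?h = "jump_prob UNIV U"
  \<comment> \<open>The conditional chance of a hit after one step: certain on U, and
    \<open>?h\<close> elsewhere. The assumption \<open>h1\<close> makes it agree with
    \<open>?h\<close> on U wherever it equals 1.\<close>
  let ?f = "\<lambda>z. indicator U z + indicator (- U) z * ?h z :: ennreal"
  have h[measurable]: "?h \<in> borel_measurable borel"
    by (rule jump_prob_measurable) auto
  have le: "?f z \<le> 1" for z
    using jump_prob_le_1[of UNIV U z] by (auto simp: indicator_def)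
  have "1 = step (indicator U) y + step (\<lambda>z. indicator (- U) z * ?h z) y"
    using jump_prob_unfold[of UNIV U y] y by (simp add: jump_UNIV_one stay_def)
  also have "\<dots> = (\<integral>\<^sup>+z. ?f z \<partial>K y)"
    unfolding step_def by (rule nn_integral_add[symmetric]) simp_all
  finally have int: "(\<integral>\<^sup>+z. ?f z \<partial>K y) = 1"
    by (rule sym)
  have f: "?f \<in> borel_measurable (K y)"
    by simp
  have "(\<integral>\<^sup>+z. 1 - ?f z \<partial>K y) = (\<integral>\<^sup>+z. 1 \<partial>K y) - (\<integral>\<^sup>+z. ?f z \<partial>K y)"
  proof (rule nn_integral_diff[OF _ f])
    show "AE z in K y. ?f z \<le> 1" using le by (intro AE_I2)
  qed (simp_all only: int, simp_all)
  also have "\<dots> = 0"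
    using emeasure_space_1 by (simp only: int) simp
  finally have "AE z in K y. 1 - ?f z = 0"
    using f by (subst (asm) nn_integral_0_iff_AE) simp_all
  then show ?thesis
  proof eventually_elim
    case (elim z)
    then have "\<not> ?f z < 1" using diff_gr0_ennreal[of "?f z" 1] by (metis less_irrefl)
    then have "?f z = 1" using le[of z] by (metis antisym not_less)
    then show ?case using h1[of z] by (cases "z \<in> U") simp_all
  qed
qed

text \<open>
  From \<open>U\<close> the chain returns to \<open>U\<close> almost surely, and each visit offers a chance of at least \<open>\<delta>\<close> to hit \<open>G\<close>.
  The points from which \<open>U\<close> is hit almost surely form an absorbing set.
\<close>

lemma jump_prob_open:
  assumes G: "open G" "G \<noteq> {}"
  shows "jump_prob UNIV G x = 1"
proof -
  have [measurable]: "G \<in> sets borel" using G by simp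
  obtain n where n: "n > 0" "(step ^^ n) (indicator G) x > 0"
    by (rule positive_step_probability[OF G])
  obtain U \<delta> where U: "open U" "x \<in> U" "\<delta> > 0" "\<delta> < \<infinity>"
    "\<And>y. y \<in> U \<Longrightarrow> \<delta> \<le> (step ^^ n) (indicator G) y"
    using funpow_step_lower_bound[OF G(1) n(2)] by metis
  then have [measurable]: "U \<in> sets borel" by simp
  have ge: "\<delta> \<le> jump_prob UNIV G y" if "y \<in> U" for y
    using U(5)[OF that] funpow_step_le_jump_prob[of G n y] n by auto
  have return: "jump_prob UNIV U y = 1" if "y \<in> U" for y
  proof -
    have "measure (P y) {\<omega> \<in> space (P y). hitting_time U \<omega> < \<infinity>} = 1"
      using recurrent U(1) that unfolding topologically_recurrent_def by blast
    then show ?thesis using emeasure_hitting[of U y] \<open>open U\<close> by simp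
  qed
  show ?thesis
  proof (rule jump_prob_zero_one[where W = "{y. jump_prob UNIV U y = 1}" and \<delta> = \<delta>])
    show "AE z in K y. z \<in> {y. jump_prob UNIV U y = 1}" if "y \<in> {y. jump_prob UNIV U y = 1}" for y
      using AE_absorbing_jump_prob_1[of U y] return that by simp
    show "\<delta> \<le> jump_prob UNIV G y" if "y \<in> {y. jump_prob UNIV U y = 1}" for y
    proof -
      have "\<delta> * jump_prob UNIV U y \<le> jump_prob UNIV G y"
        by (rule superharmonic_ge_jump_prob) (auto intro: ge jump_prob_superharmonic jump_prob_measurable)
      then show ?thesis using that by simp
    qed
  qed (use U return in auto)
qed

text \<open>Optional stopping at the hitting time of G, which by now is almost surely finite from
  every starting point.\<close>

lemma superharmonic_minimum:
  assumes "f \<in> borel_measurable borel" "\<And>y. step f y \<le> f y"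
    and "open G" "G \<noteq> {}" "\<And>y. y \<in> G \<Longrightarrow> c \<le> f y"
  shows "c \<le> f x"
  using superharmonic_ge_jump_prob[of UNIV G f c x] jump_prob_open[of G x] assms by simp

text \<open>On \<open>G\<close> the potential \<open>u\<close> satisfies \<open>u = 1 + step u\<close>, so a lower bound \<open>n\<close> of \<open>u\<close> improves to \<open>n + 1\<close>.\<close>

lemma potential_infinite:
  assumes G: "open G" "G \<noteq> {}"
  shows "green step (indicator G) x = \<infinity>"
proof -
  let ?u = "green step (indicator G)"
  have u[measurable]: "?u \<in> borel_measurable borel"
    using G by (intro positive_operator_measurable[OF positive_operator_green[OF positive_operator_step]]) auto
  have unfold: "?u y = indicator G y + step ?u y" for y
    using G by (intro green_unfold[OF positive_operator_step]) auto
  have super: "step ?u y \<le> ?u y" for y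
    using unfold[of y] by simp
  have "of_nat n \<le> ?u y" for n y
  proof (induction n arbitrary: y)
    case (Suc n)
    show ?case
    proof (rule superharmonic_minimum[OF u super G])
      fix y assume "y \<in> G"
      have "(of_nat n :: ennreal) = step (\<lambda>_. of_nat n) y" by (simp add: step_const)
      also have "\<dots> \<le> step ?u y"
        by (rule step_mono) (rule Suc.IH)
      finally show "of_nat (Suc n) \<le> ?u y"
        using \<open>y \<in> G\<close> by (subst unfold) (simp add: add_left_mono)
    qed
  qed simp
  then have "\<not> ?u x < top"
    using ennreal_Ex_less_of_nat[of "?u x"] by (auto simp: not_less[symmetric])
  then show ?thesis by (simp add: not_less top_unique)
qed

end

section \<open>Truncation, locally finite measures and invariance on a subset\<close>

lemma SUP_min_eq:
  fixes h :: "nat \<Rightarrow> ennreal"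
  assumes "(SUP n. h n) = \<infinity>"
  shows "(SUP n. min a (h n)) = a"
proof (rule antisym)
  show "(SUP n. min a (h n)) \<le> a" by (rule SUP_least) simp
  show "a \<le> (SUP n. min a (h n))"
  proof (rule dense_le)
    fix z assume "z < a"
    then have "z < (SUP n. h n)"
      unfolding assms infinity_ennreal_def by (rule less_le_trans[OF _ top_greatest])
    then obtain n where "z < h n" by (auto simp only: less_SUP_iff)
    then have "z \<le> min a (h n)"
      using \<open>z < a\<close> by (simp add: less_imp_le)
    then show "z \<le> (SUP n. min a (h n))"
      by (rule order_trans) (rule SUP_upper, simp)
  qed
qed

text \<open>With h n of finite integral, the truncations of f have finite integral too, whatever f
  is, and there subtraction is legitimate. Two measures are thus compared by their truncated
  integrals.\<close>

lemma nn_integral_eq_SUP_min: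
  fixes h :: "nat \<Rightarrow> 'a \<Rightarrow> ennreal"
  assumes [measurable]: "f \<in> borel_measurable M" "\<And>n. h n \<in> borel_measurable M"
    and inc: "\<And>n x. h n x \<le> h (Suc n) x" and sup: "\<And>x. (SUP n. h n x) = \<infinity>"
  shows "(\<integral>\<^sup>+x. f x \<partial>M) = (SUP n. \<integral>\<^sup>+x. min (f x) (h n x) \<partial>M)"
proof -
  have "(\<integral>\<^sup>+x. f x \<partial>M) = (\<integral>\<^sup>+x. (SUP n. min (f x) (h n x)) \<partial>M)"
    by (simp only: SUP_min_eq[OF sup])
  also have "\<dots> = (SUP n. \<integral>\<^sup>+x. min (f x) (h n x) \<partial>M)"
  proof (rule nn_integral_monotone_convergence_SUP)
    show "incseq (\<lambda>n x. min (f x) (h n x))"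
      by (intro incseq_SucI le_funI min.mono order_refl inc)
  qed measurable
  finally show ?thesis .
qed

lemma locally_finite_UNIV_iff:
  "locally_finite_on UNIV \<mu> \<longleftrightarrow> (\<forall>x. \<exists>U. open U \<and> x \<in> U \<and> emeasure \<mu> U < \<infinity>)"
  by (simp add: locally_finite_on_def)

text \<open>Second countability reduces the cover by open sets of finite measure to a countable one;
  finite unions make it increasing.\<close>

lemma locally_finite_exhaustion:
  fixes \<mu> :: "'a::{metric_space, second_countable_topology} measure"
  assumes sets: "sets \<mu> = sets borel" and lf: "locally_finite_on UNIV \<mu>"
  obtains V :: "nat \<Rightarrow> 'a set" where "\<And>i. open (V i)" "incseq V" "(\<Union>i. V i) = UNIV" "\<And>i. emeasure \<mu> (V i) < \<infinity>"
proof -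
  let ?F = "{U. open U \<and> emeasure \<mu> U < \<infinity>}"
  have cover: "\<Union>?F = UNIV" using lf unfolding locally_finite_UNIV_iff by blast
  obtain F' where F': "F' \<subseteq> ?F" "countable F'" "\<Union>F' = \<Union>?F"
    using Lindelof[of ?F] by blast
  \<comment> \<open>\<open>from_nat_into\<close> enumerates non-empty sets only. F' covers the state
    space, which is non-empty as a type.\<close>
  have "F' \<noteq> {}"
  proof
    assume "F' = {}"
    then have "(UNIV :: 'a set) = {}" using F'(3) cover by (simp only: Union_empty)
    then show False by simp
  qed
  have V: "from_nat_into F' i \<in> ?F" for i
    by (rule subsetD[OF F'(1) from_nat_into[OF \<open>F' \<noteq> {}\<close>]])
  let ?V = "\<lambda>i. \<Union>j\<le>i. from_nat_into F' j"
  show ?thesis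
  proof (rule that)
    show "open (?V i)" for i using V by (intro open_UN) blast
    show "incseq ?V"
      by (intro incseq_SucI UN_mono order_refl) simp
    have cover': "(\<Union>i. from_nat_into F' i) = UNIV"
      by (simp only: range_from_nat_into[OF \<open>F' \<noteq> {}\<close> F'(2)] F'(3) cover)
    show "(\<Union>i. ?V i) = UNIV"
    proof (rule UNIV_eq_I[symmetric])
      fix x
      have "x \<in> (\<Union>i. from_nat_into F' i)" unfolding cover' by simp
      then obtain i where "x \<in> from_nat_into F' i" by (rule UN_E)
      then show "x \<in> (\<Union>i. ?V i)" by (intro UN_I[of i UNIV] UN_I[of i "{..i}"]) simp_all
    qed
    show "emeasure \<mu> (?V i) < \<infinity>" for i
    proof -
      have "emeasure \<mu> (?V i) \<le> (\<Sum>j\<le>i. emeasure \<mu> (from_nat_into F' j))"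
      proof (rule emeasure_subadditive_finite)
        show "from_nat_into F' ` {..i} \<subseteq> sets \<mu>"
          unfolding sets using V by (intro image_subsetI borel_open) simp
      qed simp
      also have "\<dots> < \<infinity>" using V by (simp add: ennreal_sum_less_top)
      finally show ?thesis .
    qed
  qed
qed

lemma space_eq_restrict:
  "sets \<nu> = sets (restrict_space borel E) \<Longrightarrow> space \<nu> = E"
  by (drule sets_eq_imp_space_eq) (simp add: space_restrict_space)

lemma emeasure_restrict_borel:
  assumes "sets \<nu> = sets (restrict_space borel E)" "E \<in> sets borel" "B \<in> sets (restrict_space borel E)"
  shows "B \<in> sets borel" "B \<subseteq> E" "(\<integral>\<^sup>+x. indicator B x \<partial>\<nu>) = emeasure \<nu> B"
  using assms by (auto simp: sets_restrict_space_iff)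

lemma mult_emeasure_le_nn_integral:
  assumes "U \<in> sets M" "\<And>y. y \<in> U \<Longrightarrow> \<delta> \<le> f y"
  shows "\<delta> * emeasure M U \<le> (\<integral>\<^sup>+x. f x \<partial>M)"
proof -
  have "\<delta> * emeasure M U = (\<integral>\<^sup>+x. \<delta> * indicator U x \<partial>M)"
    using assms(1) by (rule nn_integral_cmult_indicator[symmetric])
  also have "\<dots> \<le> (\<integral>\<^sup>+x. f x \<partial>M)"
    using assms(2) by (intro nn_integral_mono) (auto split: split_indicator)
  finally show ?thesis .
qed

lemma measure_on_eqI:
  fixes \<nu> \<nu>' :: "'a::topological_space measure"
  assumes "sets \<nu> = sets (restrict_space borel E)" "sets \<nu>' = sets (restrict_space borel E)" "E \<in> sets borel"
    and eq: "\<And>f. f \<in> borel_measurable borel \<Longrightarrow> (\<integral>\<^sup>+x. f x \<partial>\<nu>) = (\<integral>\<^sup>+x. f x \<partial>\<nu>')"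
  shows "\<nu> = \<nu>'"
proof (rule measure_eqI)
  show "sets \<nu> = sets \<nu>'" using assms(1,2) by simp
  fix B assume "B \<in> sets \<nu>"
  then have B: "B \<in> sets (restrict_space borel E)" using assms(1) by simp
  have "(\<integral>\<^sup>+x. indicator B x \<partial>\<nu>) = (\<integral>\<^sup>+x. indicator B x \<partial>\<nu>')"
    using emeasure_restrict_borel(1)[OF assms(1,3) B] by (intro eq borel_measurable_indicator)
  then show "emeasure \<nu> B = emeasure \<nu>' B"
    by (simp only: emeasure_restrict_borel(3)[OF assms(1,3) B] emeasure_restrict_borel(3)[OF assms(2,3) B])
qed

text \<open>Local finiteness on E supplies only relatively open sets; at an interior point,
  intersecting with the interior yields a set open in the whole space.\<close>

lemma locally_finite_on_open_subset:
  assumes sets: "sets \<nu> = sets (restrict_space borel E)" and E: "E \<in> sets borel"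
    and lf: "locally_finite_on E \<nu>" and x: "x \<in> interior E"
  obtains V where "open V" "x \<in> V" "V \<subseteq> E" "emeasure \<nu> V < \<infinity>"
proof -
  obtain U where U: "openin (top_of_set E) U" "x \<in> U" "emeasure \<nu> U < \<infinity>"
    using lf x interior_subset[of E] unfolding locally_finite_on_def by blast
  then obtain W where W: "open W" "U = E \<inter> W"
    by (auto simp: openin_open)
  have "U \<in> sets \<nu>"
    unfolding sets W(2) using E W(1) by (simp add: sets_restrict_space_iff)
  moreover have sub: "W \<inter> interior E \<subseteq> U"
    using interior_subset[of E] W(2) by blast
  ultimately have "emeasure \<nu> (W \<inter> interior E) \<le> emeasure \<nu> U"
    by (intro emeasure_mono)
  then have "emeasure \<nu> (W \<inter> interior E) < \<infinity>"
    using U(3) by (rule le_less_trans)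
  then show ?thesis
    using W U(2) x sub by (intro that[of "W \<inter> interior E"]) auto
qed

lemma locally_finite_on_if_dominated:
  assumes sets: "sets \<nu> = sets (restrict_space borel E)" and E: "E \<in> sets borel"
    and lf: "locally_finite_on UNIV \<mu>" and \<mu>: "sets \<mu> = sets borel"
    and le: "\<And>f. f \<in> borel_measurable borel \<Longrightarrow> (\<integral>\<^sup>+x. f x \<partial>\<nu>) \<le> (\<integral>\<^sup>+x. f x \<partial>\<mu>)"
  shows "locally_finite_on E \<nu>"
  unfolding locally_finite_on_def
proof
  fix x assume "x \<in> E"
  obtain U where U: "open U" "x \<in> U" "emeasure \<mu> U < \<infinity>"
    using lf unfolding locally_finite_UNIV_iff by blast
  have B: "E \<inter> U \<in> sets (restrict_space borel E)"
    using E U(1) by (simp add: sets_restrict_space_iff)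
  have "emeasure \<nu> (E \<inter> U) = (\<integral>\<^sup>+x. indicator (E \<inter> U) x \<partial>\<nu>)"
    by (rule emeasure_restrict_borel(3)[OF sets E B, symmetric])
  also have "\<dots> \<le> (\<integral>\<^sup>+x. indicator (E \<inter> U) x \<partial>\<mu>)"
    using E U(1) by (intro le borel_measurable_indicator) auto
  also have "\<dots> \<le> (\<integral>\<^sup>+x. indicator U x \<partial>\<mu>)"
    by (intro nn_integral_mono) (auto split: split_indicator)
  also have "\<dots> = emeasure \<mu> U" using U(1) \<mu> by simp
  finally have "emeasure \<nu> (E \<inter> U) < \<infinity>" using U(3) by (rule le_less_trans)
  then show "\<exists>U. openin (top_of_set E) U \<and> x \<in> U \<and> emeasure \<nu> U < \<infinity>"
    using U(1,2) \<open>x \<in> E\<close> by (intro exI[of _ "E \<inter> U"]) (simp add: openin_open_Int)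
qed

text \<open>Testing on Borel subsets of E says that \<nu> is the restriction of \<nu>T to E. The
  assumption \<open>T_E\<close> says that T ignores values outside E, so that the restriction makes
  no difference for functions on the whole space.\<close>

lemma invariance_sets_iff_functions:
  fixes T :: "('a::topological_space \<Rightarrow> ennreal) \<Rightarrow> 'a \<Rightarrow> ennreal" and \<nu> :: "'a measure"
  assumes T: "positive_operator T" and sets: "sets \<nu> = sets (restrict_space borel E)" and E: "E \<in> sets borel"
    and T_E: "\<And>f. f \<in> borel_measurable borel \<Longrightarrow> T (\<lambda>y. indicator E y * f y) = T f"
  shows "(\<forall>B\<in>sets (restrict_space borel E). (\<integral>\<^sup>+x. T (indicator B) x \<partial>\<nu>) = emeasure \<nu> B) \<longleftrightarrow>
    (\<forall>f\<in>borel_measurable borel. (\<integral>\<^sup>+x. T f x \<partial>\<nu>) = (\<integral>\<^sup>+x. f x \<partial>\<nu>))" (is "?L \<longleftrightarrow> ?R")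
proof
  assume L: ?L
  let ?N = "restrict_space (operator_measure \<nu> T) E"
  have eq: "\<nu> = ?N"
  proof (rule measure_eqI)
    show sets_N: "sets \<nu> = sets ?N"
      unfolding sets by (intro sets_restrict_space_cong) simp
    fix B assume "B \<in> sets \<nu>"
    then have B: "B \<in> sets (restrict_space borel E)" using sets by simp
    have "emeasure ?N B = emeasure (operator_measure \<nu> T) B"
      using emeasure_restrict_borel[OF sets E B] E by (intro emeasure_restrict_space) auto
    also have "\<dots> = (\<integral>\<^sup>+x. T (indicator B) x \<partial>\<nu>)"
      by (rule emeasure_operator_measure[OF T sets emeasure_restrict_borel(1)[OF sets E B]])
    finally show "emeasure \<nu> B = emeasure ?N B" using L B by simp
  qed
  show ?R
  proof
    fix f :: "'a \<Rightarrow> ennreal" assume f: "f \<in> borel_measurable borel"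
    have m: "(\<lambda>x. indicator E x * f x) \<in> borel_measurable borel"
      using E f by measurable
    have "(\<integral>\<^sup>+x. f x \<partial>\<nu>) = (\<integral>\<^sup>+x. f x \<partial>?N)"
      using eq by (rule arg_cong)
    also have "\<dots> = (\<integral>\<^sup>+x. f x * indicator E x \<partial>operator_measure \<nu> T)"
      using E by (intro nn_integral_restrict_space) simp
    also have "\<dots> = (\<integral>\<^sup>+x. indicator E x * f x \<partial>operator_measure \<nu> T)"
      by (simp only: mult.commute)
    also have "\<dots> = (\<integral>\<^sup>+x. T (\<lambda>x. indicator E x * f x) x \<partial>\<nu>)"
      by (rule nn_integral_operator_measure[OF T sets m])
    finally show "(\<integral>\<^sup>+x. T f x \<partial>\<nu>) = (\<integral>\<^sup>+x. f x \<partial>\<nu>)" by (simp only: T_E[OF f])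
  qed
next
  assume ?R
  then show ?L using emeasure_restrict_borel[OF sets E] by fastforce
qed

section \<open>Excessive measures of the recurrent chain\<close>

context recurrent_Feller_chain
begin

text \<open>Near any x, with n and \<delta> depending on x, one has \<delta> * \<mu> U \<le>
  \<integral> K^n 1_G d\<mu> \<le> \<mu> G; the last inequality is excessiveness applied n
  times.\<close>

lemma locally_finite_if_excessive:
  assumes sets: "sets \<mu> = sets borel"
    and exc: "\<And>f. f \<in> borel_measurable borel \<Longrightarrow> (\<integral>\<^sup>+x. step f x \<partial>\<mu>) \<le> (\<integral>\<^sup>+x. f x \<partial>\<mu>)"
    and G: "open G" "G \<noteq> {}" "emeasure \<mu> G < \<infinity>"
  shows "locally_finite_on UNIV \<mu>"
  unfolding locally_finite_UNIV_iff
proof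
  fix x
  have m: "f \<in> borel_measurable \<mu>" if "f \<in> borel_measurable borel" for f :: "'a \<Rightarrow> ennreal"
    using that sets by (simp cong: measurable_cong_sets)
  obtain n where n: "(step ^^ n) (indicator G) x > 0"
    using positive_step_probability[OF G(1,2), of x] by blast
  obtain U \<delta> where U: "open U" "x \<in> U" "\<delta> > 0" "\<delta> < \<infinity>"
    "\<And>y. y \<in> U \<Longrightarrow> \<delta> \<le> (step ^^ n) (indicator G) y"
    using funpow_step_lower_bound[OF G(1) n] by metis
  have le: "(\<integral>\<^sup>+x. (step ^^ k) (indicator G) x \<partial>\<mu>) \<le> emeasure \<mu> G" for k
  proof (induction k)
    case 0
    show ?case using G sets by simp
  next
    case (Suc k)
    have "(\<integral>\<^sup>+x. step ((step ^^ k) (indicator G)) x \<partial>\<mu>) \<le> (\<integral>\<^sup>+x. (step ^^ k) (indicator G) x \<partial>\<mu>)"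
      using G by (intro exc funpow_measurable[OF positive_operator_step]) auto
    then show ?case using Suc.IH by (simp add: order_trans)
  qed
  have "\<delta> * emeasure \<mu> U = (\<integral>\<^sup>+x. \<delta> * indicator U x \<partial>\<mu>)"
    using U(1) sets by (subst nn_integral_cmult_indicator) auto
  also have "\<dots> \<le> (\<integral>\<^sup>+x. (step ^^ n) (indicator G) x \<partial>\<mu>)"
    using U(5) by (intro nn_integral_mono) (auto simp: indicator_def)
  also have "\<dots> \<le> emeasure \<mu> G" by (rule le)
  finally have "\<delta> * emeasure \<mu> U < \<infinity>" using G(3) by (rule le_less_trans)
  then have "emeasure \<mu> U < \<infinity>"
    using U(3) by (auto simp: ennreal_mult_less_top)
  then show "\<exists>U. open U \<and> x \<in> U \<and> emeasure \<mu> U < \<infinity>" using U by blast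
qed

text \<open>
  The defect \<open>\<lambda> = \<mu> - \<mu>K\<close> gives the partial potentials \<open>H n\<close> of an open set \<open>G\<close> mass at most \<open>\<mu> G < \<infinity>\<close>,
  while \<open>H n\<close> tends to \<open>\<infinity>\<close> everywhere. Truncating at \<open>e * H n\<close> avoids the subtraction of infinite measures.
\<close>

lemma excessive_imp_invariant:
  assumes sets: "sets \<mu> = sets borel" and lf: "locally_finite_on UNIV \<mu>"
    and exc: "\<And>f. f \<in> borel_measurable borel \<Longrightarrow> (\<integral>\<^sup>+x. step f x \<partial>\<mu>) \<le> (\<integral>\<^sup>+x. f x \<partial>\<mu>)"
    and f: "f \<in> borel_measurable borel"
  shows "(\<integral>\<^sup>+x. step f x \<partial>\<mu>) = (\<integral>\<^sup>+x. f x \<partial>\<mu>)"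
proof (rule antisym[OF exc[OF f]])
  note step_m = positive_operator_measurable[OF positive_operator_step]
  have m: "f \<in> borel_measurable \<mu>" if "f \<in> borel_measurable borel" for f :: "'a \<Rightarrow> ennreal"
    using that sets by (simp cong: measurable_cong_sets)
  obtain G where G: "open G" "G \<noteq> {}" "emeasure \<mu> G < \<infinity>"
    using lf unfolding locally_finite_UNIV_iff by blast
  define H where "H n x = (\<Sum>k<n. (step ^^ k) (indicator G) x)" for n x
  have pow_m: "(step ^^ k) (indicator G) \<in> borel_measurable borel" for k
    using G(1) by (intro funpow_measurable[OF positive_operator_step]) auto
  then have H_m: "H n \<in> borel_measurable borel" for n
    unfolding H_def[abs_def] by measurable
  have pow_fin: "(\<integral>\<^sup>+x. (step ^^ k) (indicator G) x \<partial>\<mu>) < \<infinity>" for k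
  proof (induction k)
    case 0
    show ?case using G sets by simp
  next
    case (Suc k)
    show ?case using le_less_trans[OF exc[OF pow_m] Suc.IH] by simp
  qed
  have H_fin: "(\<integral>\<^sup>+x. H n x \<partial>\<mu>) < \<infinity>" for n
    unfolding H_def using pow_fin
    by (subst nn_integral_sum[OF m[OF pow_m]]) (simp add: ennreal_sum_less_top)
  \<comment> \<open>H n is at most H (n + 1) = 1_G + K (H n). In additive form this bounds what H n
    loses under K by \<mu> G, uniformly in n.\<close>
  have H_le: "(\<integral>\<^sup>+x. H n x \<partial>\<mu>) \<le> (\<integral>\<^sup>+x. step (H n) x \<partial>\<mu>) + emeasure \<mu> G" for n
  proof -
    have "H n x \<le> indicator G x + step (H n) x" for x
    proof -
      have "H n x \<le> (\<Sum>k<Suc n. (step ^^ k) (indicator G) x)"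
        by (simp add: H_def)
      also have "\<dots> = indicator G x + (\<Sum>k<n. (step ^^ Suc k) (indicator G) x)"
        by (subst sum.lessThan_Suc_shift) (simp only: funpow_0)
      also have "(\<Sum>k<n. (step ^^ Suc k) (indicator G) x) = step (H n) x"
        unfolding H_def[abs_def] by (subst positive_operator_sum[OF positive_operator_step pow_m]) simp
      finally show ?thesis .
    qed
    then have "(\<integral>\<^sup>+x. H n x \<partial>\<mu>) \<le> (\<integral>\<^sup>+x. indicator G x + step (H n) x \<partial>\<mu>)"
      by (rule nn_integral_mono)
    also have "\<dots> = emeasure \<mu> G + (\<integral>\<^sup>+x. step (H n) x \<partial>\<mu>)"
      using G(1) sets m[OF step_m[OF H_m]] m[of "indicator G"] by (subst nn_integral_add) auto
    finally show ?thesis by (simp add: add.commute)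
  qed
  have main: "(\<integral>\<^sup>+x. f x \<partial>\<mu>) \<le> (\<integral>\<^sup>+x. step f x \<partial>\<mu>) + e * emeasure \<mu> G" if e: "e > 0" "e < \<infinity>" for e
  proof -
    let ?b = "\<lambda>n x. min (f x) (e * H n x)"
    have b_m: "?b n \<in> borel_measurable borel" for n
      using f H_m by measurable
    have "(SUP n. e * H n x) = \<infinity>" for x
    proof -
      have "(SUP n. H n x) = green step (indicator G) x"
        by (simp add: H_def green_def suminf_eq_SUP)
      then have "(SUP n. e * H n x) = e * \<infinity>"
        by (simp only: SUP_mult_left_ennreal[symmetric] potential_infinite[OF G(1,2)])
      then show ?thesis
        using e by (simp add: ennreal_mult_top)
    qed
    then have "(\<integral>\<^sup>+x. f x \<partial>\<mu>) = (SUP n. \<integral>\<^sup>+x. ?b n x \<partial>\<mu>)"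
    proof (intro nn_integral_eq_SUP_min m f)
      show "(\<lambda>x. e * H n x) \<in> borel_measurable borel" for n
        using H_m by measurable
      show "e * H n x \<le> e * H (Suc n) x" for n x
        by (intro mult_left_mono) (simp_all add: H_def)
    qed
    also have "\<dots> \<le> (\<integral>\<^sup>+x. step f x \<partial>\<mu>) + e * emeasure \<mu> G"
    proof (rule SUP_least)
      fix n
      \<comment> \<open>The loss under K is additive and nonnegative, and the loss of
        \<open>e * H n\<close>, at most e * \<mu> G, is shared between \<open>?b n\<close> and
        \<open>?d\<close>. Excessiveness for \<open>?d\<close>, whose integral is finite and can be
        cancelled, leaves the whole bound for \<open>?b n\<close>.\<close>
      let ?d = "\<lambda>x. e * H n x - ?b n x"
      have d_m: "?d \<in> borel_measurable borel"
        using b_m H_m by measurable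
      have split: "e * H n x = ?b n x + ?d x" for x
        by (rule add_diff_inverse_ennreal[symmetric]) simp
      have d_fin: "(\<integral>\<^sup>+x. ?d x \<partial>\<mu>) < \<infinity>"
      proof -
        have "(\<integral>\<^sup>+x. ?d x \<partial>\<mu>) \<le> (\<integral>\<^sup>+x. e * H n x \<partial>\<mu>)"
          by (intro nn_integral_mono diff_le_self_ennreal)
        also have "\<dots> = e * (\<integral>\<^sup>+x. H n x \<partial>\<mu>)"
          by (intro nn_integral_cmult m H_m)
        also have "\<dots> < \<infinity>" using e H_fin by (simp add: ennreal_mult_less_top)
        finally show ?thesis .
      qed
      have "(\<integral>\<^sup>+x. ?b n x \<partial>\<mu>) + (\<integral>\<^sup>+x. ?d x \<partial>\<mu>) = (\<integral>\<^sup>+x. ?b n x + ?d x \<partial>\<mu>)"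
        by (intro nn_integral_add[symmetric] m b_m d_m)
      also have "\<dots> = (\<integral>\<^sup>+x. e * H n x \<partial>\<mu>)"
        by (simp only: split[symmetric])
      also have "\<dots> = e * (\<integral>\<^sup>+x. H n x \<partial>\<mu>)"
        by (intro nn_integral_cmult m H_m)
      also have "\<dots> \<le> e * ((\<integral>\<^sup>+x. step (H n) x \<partial>\<mu>) + emeasure \<mu> G)"
        by (intro mult_left_mono H_le) simp
      also have "\<dots> = (\<integral>\<^sup>+x. e * step (H n) x \<partial>\<mu>) + e * emeasure \<mu> G"
        by (simp add: distrib_left nn_integral_cmult m step_m H_m)
      also have "(\<integral>\<^sup>+x. e * step (H n) x \<partial>\<mu>) = (\<integral>\<^sup>+x. step (\<lambda>y. e * H n y) x \<partial>\<mu>)"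
        by (intro nn_integral_cong positive_operator_cmult[OF positive_operator_step H_m, symmetric])
      also have "\<dots> = (\<integral>\<^sup>+x. step (\<lambda>y. ?b n y + ?d y) x \<partial>\<mu>)"
        by (simp only: split[symmetric])
      also have "\<dots> = (\<integral>\<^sup>+x. step (?b n) x + step ?d x \<partial>\<mu>)"
        by (intro nn_integral_cong positive_operator_add[OF positive_operator_step b_m d_m])
      also have "\<dots> = (\<integral>\<^sup>+x. step (?b n) x \<partial>\<mu>) + (\<integral>\<^sup>+x. step ?d x \<partial>\<mu>)"
        by (intro nn_integral_add m step_m b_m d_m)
      also have "\<dots> \<le> (\<integral>\<^sup>+x. step f x \<partial>\<mu>) + (\<integral>\<^sup>+x. ?d x \<partial>\<mu>)"
        by (intro add_mono nn_integral_mono step_mono exc[OF d_m]) simp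
      finally have "(\<integral>\<^sup>+x. ?d x \<partial>\<mu>) + (\<integral>\<^sup>+x. ?b n x \<partial>\<mu>)
          \<le> (\<integral>\<^sup>+x. ?d x \<partial>\<mu>) + ((\<integral>\<^sup>+x. step f x \<partial>\<mu>) + e * emeasure \<mu> G)"
        by (simp only: ac_simps add_right_mono)
      then show "(\<integral>\<^sup>+x. ?b n x \<partial>\<mu>) \<le> (\<integral>\<^sup>+x. step f x \<partial>\<mu>) + e * emeasure \<mu> G"
        unfolding ennreal_add_left_cancel_le by (rule disjE) (use d_fin in simp_all)
    qed
    finally show ?thesis .
  qed
  obtain g where g: "emeasure \<mu> G = ennreal g" "g \<ge> 0"
    using G(3) by (cases "emeasure \<mu> G") auto
  show "(\<integral>\<^sup>+x. f x \<partial>\<mu>) \<le> (\<integral>\<^sup>+x. step f x \<partial>\<mu>)"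
  proof (rule ennreal_le_epsilon)
    fix e :: real assume "0 < e"
    \<comment> \<open>The divisor is g + 1 since g = \<mu> G may be 0.\<close>
    then have "ennreal (e / (g + 1)) * emeasure \<mu> G \<le> ennreal e"
      using g by (simp add: ennreal_mult[symmetric] field_simps)
    moreover have "(\<integral>\<^sup>+x. f x \<partial>\<mu>) \<le> (\<integral>\<^sup>+x. step f x \<partial>\<mu>) + ennreal (e / (g + 1)) * emeasure \<mu> G"
      using \<open>0 < e\<close> g by (intro main) auto
    ultimately show "(\<integral>\<^sup>+x. f x \<partial>\<mu>) \<le> (\<integral>\<^sup>+x. step f x \<partial>\<mu>) + ennreal e"
      by (meson add_left_mono order_trans)
  qed
qed

end

section \<open>Entrance and exit measures\<close>

locale transition_chain = recurrent_Feller_chain K P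
  for K :: "'a::{metric_space, second_countable_topology} \<Rightarrow> 'a measure"
    and P :: "'a \<Rightarrow> (nat \<Rightarrow> 'a) measure" +
  fixes A :: "'a set"
  assumes A_borel: "A \<in> sets borel"
    and transition: "\<exists>x\<in>interior (- A). measure (step_law P x) (interior A) > 0"
begin

abbreviation staying where "staying \<equiv> stay (- A) A"
abbreviation entering where "entering \<equiv> jump (- A) A"
abbreviation occupation where "occupation \<equiv> green staying"
abbreviation exit_prob where "exit_prob \<equiv> entering (\<lambda>_. 1)"

lemma Compl_A_borel: "- A \<in> sets borel"
  using A_borel by simp

lemma positive_staying: "positive_operator staying"
  by (rule positive_operator_stay[OF Compl_A_borel A_borel])

lemma positive_entering: "positive_operator entering"
  by (rule positive_operator_jump[OF Compl_A_borel A_borel])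

lemma positive_occupation: "positive_operator occupation"
  by (rule positive_operator_green[OF positive_staying])

lemmas staying_measurable = positive_operator_measurable[OF positive_staying]
lemmas entering_measurable = positive_operator_measurable[OF positive_entering]
lemmas occupation_measurable = positive_operator_measurable[OF positive_occupation]
lemmas step_measurable = positive_operator_measurable[OF positive_operator_step]

lemma exit_prob_measurable: "exit_prob \<in> borel_measurable borel"
  by (rule entering_measurable) simp

lemma step_eq_staying_entering:
  "f \<in> borel_measurable borel \<Longrightarrow> step f x = staying f x + entering f x"
  by (rule step_eq_stay_jump[OF Compl_A_borel A_borel])

lemma occupation_unfold:
  "f \<in> borel_measurable borel \<Longrightarrow> occupation f x = f x + occupation (staying f) x"
  by (rule green_unfold_right[OF positive_staying])

lemma entering_indicator: "entering (\<lambda>y. indicator A y * f y) = entering f"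
proof -
  have "(\<lambda>y. indicator A y * (indicator A y * f y)) = (\<lambda>y. indicator A y * f y)"
    by (auto simp: indicator_def)
  then show ?thesis by (simp only: jump_def[abs_def])
qed

lemma exit_prob_eq: "exit_prob x = indicator (- A) x * emeasure (K x) A"
  using A_borel by (simp add: jump_def step_def)

lemma exit_prob_le_1: "exit_prob x \<le> 1"
  using stay_jump_one[OF Compl_A_borel A_borel, of x] by (metis add.commute le_iff_add)

lemma exit_prob_in_A: "x \<in> A \<Longrightarrow> exit_prob x = 0"
  by (simp add: jump_def)

lemma entering_in_A: "x \<in> A \<Longrightarrow> entering f x = 0"
  by (simp add: jump_def)

lemma entering_eq_0:
  assumes f: "f \<in> borel_measurable borel" and "exit_prob x = 0"
  shows "entering f x = 0"
proof (cases "x \<in> A")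
  case False
  then have "(\<integral>\<^sup>+y. indicator A y \<partial>K x) = 0"
    using assms(2) A_borel by (simp add: exit_prob_eq)
  then have "AE y in K x. (indicator A y :: ennreal) = 0"
    using A_borel by (subst (asm) nn_integral_0_iff_AE) simp_all
  then have "AE y in K x. indicator A y * f y = 0"
    by eventually_elim simp
  then have "step (\<lambda>y. indicator A y * f y) x = 0"
    unfolding step_def using A_borel f by (subst nn_integral_0_iff_AE) simp_all
  then show ?thesis by (simp add: jump_def)
qed (rule entering_in_A)

text \<open>Write R for \<open>entering\<close> and r for \<open>exit_prob\<close>. Where r
  vanishes, so does R f, and 0 times any value is 0. Thus dividing by r loses nothing, which is how
  exit measures, weighted with r, still determine all of R f.\<close>

lemma exit_prob_mult_divide:
  assumes "f \<in> borel_measurable borel"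
  shows "exit_prob x * (entering f x / exit_prob x) = entering f x"
proof (cases "exit_prob x = 0")
  case True
  then show ?thesis using entering_eq_0[OF assms] by simp
next
  case False
  moreover have "exit_prob x < \<infinity>"
    using exit_prob_le_1[of x] by (rule le_less_trans) simp
  ultimately show ?thesis
    by (simp add: ennreal_times_divide mult.commute[of "exit_prob x"] mult_divide_eq_ennreal)
qed

text \<open>Lower semicontinuity of K(., V) at x, on a neighbourhood cut down to the interior of the
  complement: every point of G then lies off A, and a step into V is a crossing because V lies in
  A.\<close>

lemma crossing_lower_bound:
  assumes V: "open V" "V \<subseteq> A" and x: "x \<in> interior (- A)" and pos: "emeasure (K x) V > 0"
  obtains G \<delta> where "open G" "x \<in> G" "G \<subseteq> - A" "\<delta> > 0" "\<delta> < \<infinity>"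
    "\<And>y. y \<in> G \<Longrightarrow> \<delta> \<le> entering (indicator V) y"
proof -
  have step_V: "step (indicator V) y = emeasure (K y) V" for y
    using V(1) by (simp add: step_def)
  \<comment> \<open>The semicontinuity lemma is stated for powers; here it is needed for one
    step.\<close>
  have "(step ^^ 1) (indicator V) x > 0"
    using pos by (simp add: step_V)
  then obtain U \<delta> where U: "open U" "x \<in> U" "\<delta> > 0" "\<delta> < \<infinity>"
    "\<And>y. y \<in> U \<Longrightarrow> \<delta> \<le> (step ^^ 1) (indicator V) y"
    using funpow_step_lower_bound[OF V(1)] by metis
  have V_eq: "(\<lambda>y. indicator A y * indicator V y) = (indicator V :: 'a \<Rightarrow> ennreal)"
  proof
    fix y
    show "indicator A y * indicator V y = (indicator V y :: ennreal)"
      using V(2) by (cases "y \<in> V") auto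
  qed
  show ?thesis
  proof (rule that)
    show "open (U \<inter> interior (- A))" by (intro open_Int open_interior U(1))
    show "x \<in> U \<inter> interior (- A)" by (intro IntI U(2) x)
    show sub: "U \<inter> interior (- A) \<subseteq> - A" using interior_subset[of "- A"] by blast
    show "\<delta> \<le> entering (indicator V) y" if "y \<in> U \<inter> interior (- A)" for y
    proof -
      have "y \<in> - A" using sub that by blast
      then show ?thesis using U(5)[of y] that by (simp add: jump_def V_eq)
    qed
  qed fact+
qed

lemma transition_point:
  obtains x where "x \<in> interior (- A)" "emeasure (K x) (interior A) > 0"
proof -
  obtain x where x: "x \<in> interior (- A)" "measure (K x) (interior A) > 0"
    using transition unfolding step_law_eq by blast
  interpret prob_space "K x" by (rule prob_space_K)
  show ?thesis using x that by (simp add: emeasure_eq_measure)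
qed

text \<open>The statement says that a crossing occurs almost surely from every starting point. A
  uniform positive lower bound suffices, by the zero-one law with W = UNIV; it comes from the
  minimum principle.\<close>

lemma occupation_exit_prob: "occupation exit_prob x = 1"
proof -
  have m: "jump_prob (- A) A \<in> borel_measurable borel"
    by (rule jump_prob_measurable[OF Compl_A_borel A_borel])
  obtain x0 where x0: "x0 \<in> interior (- A)" "emeasure (K x0) (interior A) > 0"
    by (rule transition_point)
  obtain G \<delta> where G: "open G" "x0 \<in> G" "\<delta> > 0" "\<delta> < \<infinity>"
    "\<And>y. y \<in> G \<Longrightarrow> \<delta> \<le> entering (indicator (interior A)) y"
    using crossing_lower_bound[OF open_interior interior_subset x0] by metis
  have G_ge: "\<delta> \<le> jump_prob (- A) A y" if "y \<in> G" for y
  proof -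
    have "\<delta> \<le> entering (indicator (interior A)) y" by (rule G(5)[OF that])
    also have "\<dots> \<le> exit_prob y"
      by (rule positive_operator_mono[OF positive_entering]) (auto simp: indicator_def)
    also have "\<dots> \<le> jump_prob (- A) A y"
      using jump_prob_unfold[OF Compl_A_borel A_borel, of y] by simp
    finally show ?thesis .
  qed
  have ge: "\<delta> \<le> jump_prob (- A) A y" for y
    using G(1,2) by (intro superharmonic_minimum[OF m _ G(1) _ G_ge]
        jump_prob_superharmonic[OF Compl_A_borel A_borel]) auto
  have "jump_prob (- A) A x = 1"
    by (rule jump_prob_zero_one[OF Compl_A_borel A_borel _ G(3,4) ge, of UNIV]) simp_all
  then show ?thesis by (simp only: jump_prob_def)
qed

text \<open>This predicate and the next two test invariance on functions, in operator form. Their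
  agreement with the kernels is the content of \<open>lf_invariant_measures_eq\<close>,
  \<open>lf_invariant_entrance_eq\<close> and \<open>lf_invariant_exit_eq\<close>.\<close>

definition invariant_measure :: "'a measure \<Rightarrow> bool" where
  "invariant_measure \<mu> \<longleftrightarrow> sets \<mu> = sets borel \<and> locally_finite_on UNIV \<mu> \<and>
    (\<forall>f\<in>borel_measurable borel. (\<integral>\<^sup>+x. step f x \<partial>\<mu>) = (\<integral>\<^sup>+x. f x \<partial>\<mu>))"

definition entrance_invariant :: "'a measure \<Rightarrow> bool" where
  "entrance_invariant \<nu> \<longleftrightarrow> sets \<nu> = sets (restrict_space borel A) \<and> locally_finite_on A \<nu> \<and>
    (\<forall>f\<in>borel_measurable borel. (\<integral>\<^sup>+x. occupation (entering f) x \<partial>\<nu>) = (\<integral>\<^sup>+x. f x \<partial>\<nu>))"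

text \<open>Where \<open>exit_prob\<close> vanishes, so does the numerator, and \<open>0 / 0 = 0\<close> agrees with the jump to the cemetery.\<close>

definition exit_invariant :: "'a measure \<Rightarrow> bool" where
  "exit_invariant \<kappa> \<longleftrightarrow> sets \<kappa> = sets (restrict_space borel (- A)) \<and> locally_finite_on (- A) \<kappa> \<and>
    (\<forall>f\<in>borel_measurable borel.
      (\<integral>\<^sup>+x. entering (occupation (\<lambda>y. exit_prob y * f y)) x / exit_prob x \<partial>\<kappa>) = (\<integral>\<^sup>+x. f x \<partial>\<kappa>))"

section \<open>Invariant measures are recovered from their crossings\<close>

context
  fixes \<mu> :: "'a measure"
  assumes \<mu>: "invariant_measure \<mu>"
begin

lemma sets_invariant: "sets \<mu> = sets (restrict_space borel UNIV)"
  using \<mu> by (simp add: invariant_measure_def)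

lemma borel_measurable_invariant: "f \<in> borel_measurable borel \<Longrightarrow> f \<in> borel_measurable \<mu>"
  by (rule measurable_borel_restrict[OF sets_invariant])

lemma nn_integral_invariant:
  assumes f: "f \<in> borel_measurable borel"
  shows "(\<integral>\<^sup>+x. f x \<partial>\<mu>) = (\<integral>\<^sup>+x. staying f x \<partial>\<mu>) + (\<integral>\<^sup>+x. entering f x \<partial>\<mu>)"
proof -
  have "(\<integral>\<^sup>+x. f x \<partial>\<mu>) = (\<integral>\<^sup>+x. step f x \<partial>\<mu>)"
    using \<mu> f by (simp only: invariant_measure_def)
  also have "\<dots> = (\<integral>\<^sup>+x. staying f x + entering f x \<partial>\<mu>)"
    by (simp only: step_eq_staying_entering[OF f])
  also have "\<dots> = (\<integral>\<^sup>+x. staying f x \<partial>\<mu>) + (\<integral>\<^sup>+x. entering f x \<partial>\<mu>)"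
    by (intro nn_integral_add borel_measurable_invariant staying_measurable entering_measurable f)
  finally show ?thesis .
qed

text \<open>Iterating \<mu> = \<mu>S + \<mu>R splits the mass by the last crossing in the past:
  \<mu> = \<mu>R(1 + S + ... + S^(n-1)) + \<mu>S^n. The remainder, the mass without a crossing in
  the last n steps, is dropped.\<close>

lemma nn_integral_entering_occupation_le:
  assumes f: "f \<in> borel_measurable borel"
  shows "(\<integral>\<^sup>+x. entering (occupation f) x \<partial>\<mu>) \<le> (\<integral>\<^sup>+x. f x \<partial>\<mu>)"
proof -
  note pow = funpow_measurable[OF positive_staying f]
  have "(\<Sum>k<n. \<integral>\<^sup>+x. entering ((staying ^^ k) f) x \<partial>\<mu>) + (\<integral>\<^sup>+x. (staying ^^ n) f x \<partial>\<mu>) = (\<integral>\<^sup>+x. f x \<partial>\<mu>)" for n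
  proof (induction n)
    case (Suc n)
    then show ?case
      using nn_integral_invariant[OF pow, of n] by (simp add: ac_simps)
  qed simp
  then have "(\<Sum>k<n. \<integral>\<^sup>+x. entering ((staying ^^ k) f) x \<partial>\<mu>) \<le> (\<integral>\<^sup>+x. f x \<partial>\<mu>)" for n
    by (metis le_iff_add)
  then have "(\<Sum>k. \<integral>\<^sup>+x. entering ((staying ^^ k) f) x \<partial>\<mu>) \<le> (\<integral>\<^sup>+x. f x \<partial>\<mu>)"
    unfolding suminf_eq_SUP by (intro SUP_least)
  also have "(\<Sum>k. \<integral>\<^sup>+x. entering ((staying ^^ k) f) x \<partial>\<mu>) = (\<integral>\<^sup>+x. (\<Sum>k. entering ((staying ^^ k) f) x) \<partial>\<mu>)"
    by (intro nn_integral_suminf[symmetric] borel_measurable_invariant entering_measurable pow)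
  also have "\<dots> = (\<integral>\<^sup>+x. entering (occupation f) x \<partial>\<mu>)"
    unfolding green_def[abs_def]
    by (intro nn_integral_cong positive_operator_suminf[OF positive_entering, symmetric] pow)
  finally show ?thesis .
qed

lemma entering_occupation_unfold:
  assumes f: "f \<in> borel_measurable borel"
  shows "(\<integral>\<^sup>+x. entering (occupation f) x \<partial>\<mu>) =
    (\<integral>\<^sup>+x. entering f x \<partial>\<mu>) + (\<integral>\<^sup>+x. entering (occupation (staying f)) x \<partial>\<mu>)"
proof -
  note m = occupation_measurable[OF staying_measurable[OF f]]
  have "occupation f = (\<lambda>x. f x + occupation (staying f) x)"
    using occupation_unfold[OF f] by (rule ext)
  then have "(\<integral>\<^sup>+x. entering (occupation f) x \<partial>\<mu>) = (\<integral>\<^sup>+x. entering (\<lambda>x. f x + occupation (staying f) x) x \<partial>\<mu>)"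
    by (simp only:)
  also have "\<dots> = (\<integral>\<^sup>+x. entering f x + entering (occupation (staying f)) x \<partial>\<mu>)"
    by (intro nn_integral_cong positive_operator_add[OF positive_entering f m])
  also have "\<dots> = (\<integral>\<^sup>+x. entering f x \<partial>\<mu>) + (\<integral>\<^sup>+x. entering (occupation (staying f)) x \<partial>\<mu>)"
    by (intro nn_integral_add borel_measurable_invariant entering_measurable m f)
  finally show ?thesis .
qed

text \<open>
  The measure \<open>\<mu>\<^sub>2\<close> given by \<open>f \<mapsto> \<integral> entering (occupation f) d\<mu>\<close> is dominated by \<open>\<mu>\<close> and excessive,
  hence invariant. It charges \<open>entering f\<close> as \<open>\<mu>\<close> does, and therefore also \<open>staying ^ k (entering f)\<close>;
  these functions fill up the space because \<open>occupation exit_prob = 1\<close>.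
\<close>

lemma nn_integral_entering_occupation:
  assumes f: "f \<in> borel_measurable borel"
  shows "(\<integral>\<^sup>+x. entering (occupation f) x \<partial>\<mu>) = (\<integral>\<^sup>+x. f x \<partial>\<mu>)"
proof -
  define \<mu>2 where "\<mu>2 = operator_measure \<mu> (\<lambda>f. entering (occupation f))"
  note pos = positive_operator_comp[OF positive_entering positive_occupation]
  have int2: "(\<integral>\<^sup>+x. g x \<partial>\<mu>2) = (\<integral>\<^sup>+x. entering (occupation g) x \<partial>\<mu>)" if "g \<in> borel_measurable borel" for g
    unfolding \<mu>2_def by (rule nn_integral_operator_measure[OF pos sets_invariant that])
  have sets2: "sets \<mu>2 = sets borel"
    unfolding \<mu>2_def by simp
  have m2: "g \<in> borel_measurable \<mu>2" if "g \<in> borel_measurable borel" for g :: "'a \<Rightarrow> ennreal"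
    using that sets2 by (simp cong: measurable_cong_sets)
  have le: "(\<integral>\<^sup>+x. g x \<partial>\<mu>2) \<le> (\<integral>\<^sup>+x. g x \<partial>\<mu>)" if "g \<in> borel_measurable borel" for g
    unfolding int2[OF that] by (rule nn_integral_entering_occupation_le[OF that])
  have unfold2: "(\<integral>\<^sup>+x. g x \<partial>\<mu>2) = (\<integral>\<^sup>+x. entering g x \<partial>\<mu>) + (\<integral>\<^sup>+x. staying g x \<partial>\<mu>2)"
    if "g \<in> borel_measurable borel" for g
    unfolding int2[OF that] int2[OF staying_measurable[OF that]] by (rule entering_occupation_unfold[OF that])
  have step2: "(\<integral>\<^sup>+x. step g x \<partial>\<mu>2) = (\<integral>\<^sup>+x. staying g x \<partial>\<mu>2) + (\<integral>\<^sup>+x. entering g x \<partial>\<mu>2)"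
    if "g \<in> borel_measurable borel" for g
    unfolding step_eq_staying_entering[OF that]
    by (intro nn_integral_add m2 staying_measurable entering_measurable that)
  have sets: "sets \<mu> = sets borel" and lf: "locally_finite_on UNIV \<mu>"
    using \<mu> by (simp_all add: invariant_measure_def)
  have emeasure_le: "emeasure \<mu>2 U \<le> emeasure \<mu> U" if "open U" for U
    using le[of "indicator U"] that sets sets2 by simp
  have lf2: "locally_finite_on UNIV \<mu>2"
    using lf unfolding locally_finite_UNIV_iff by (meson emeasure_le le_less_trans)
  \<comment> \<open>\<mu>2 K = \<mu>2 S + \<mu>2 R \<le> \<mu>2 S + \<mu>R = \<mu>2, where \<mu>2
    \<le> \<mu> gives the inequality and \<open>unfold2\<close> the last identity.\<close>
  have inv2: "(\<integral>\<^sup>+x. step g x \<partial>\<mu>2) = (\<integral>\<^sup>+x. g x \<partial>\<mu>2)" if "g \<in> borel_measurable borel" for g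
  proof (rule excessive_imp_invariant[OF sets2 lf2 _ that])
    fix g :: "'a \<Rightarrow> ennreal" assume g: "g \<in> borel_measurable borel"
    show "(\<integral>\<^sup>+x. step g x \<partial>\<mu>2) \<le> (\<integral>\<^sup>+x. g x \<partial>\<mu>2)"
      unfolding step2[OF g] unfold2[OF g]
      by (subst add.commute) (intro add_right_mono le entering_measurable g)
  qed
  obtain V :: "nat \<Rightarrow> 'a set" where V: "\<And>i. open (V i)" "incseq V" "(\<Union>i. V i) = UNIV" "\<And>i. emeasure \<mu> (V i) < \<infinity>"
    using locally_finite_exhaustion[OF sets lf] by metis
  have V_m: "indicator (V i) \<in> borel_measurable borel" for i
    using V(1) by simp
  \<comment> \<open>For k = 0, \<mu>2 = \<mu>2 S + \<mu>2 R (invariance) and \<mu>2 = \<mu>2 S +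
    \<mu>R are compared, and the common term is cancelled. The successor step cancels the common
    term \<mu>R from \<mu>2 = \<mu>R + \<mu>2 S and \<mu> = \<mu>R + \<mu>S. The sets V i keep all
    cancelled integrals finite.\<close>
  have eq: "(\<integral>\<^sup>+x. (staying ^^ k) (entering (indicator (V i))) x \<partial>\<mu>2) =
      (\<integral>\<^sup>+x. (staying ^^ k) (entering (indicator (V i))) x \<partial>\<mu>) \<and>
      (\<integral>\<^sup>+x. (staying ^^ k) (entering (indicator (V i))) x \<partial>\<mu>) < \<infinity>" for i k
  proof (induction k)
    case 0
    have fin: "(\<integral>\<^sup>+x. indicator (V i) x \<partial>\<mu>) < \<infinity>"
      using V(1,4) sets by simp
    then have fin2: "(\<integral>\<^sup>+x. indicator (V i) x \<partial>\<mu>2) < \<infinity>"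
      by (rule le_less_trans[OF le[OF V_m]])
    have "(\<integral>\<^sup>+x. staying (indicator (V i)) x \<partial>\<mu>2) + (\<integral>\<^sup>+x. entering (indicator (V i)) x \<partial>\<mu>2) =
        (\<integral>\<^sup>+x. staying (indicator (V i)) x \<partial>\<mu>2) + (\<integral>\<^sup>+x. entering (indicator (V i)) x \<partial>\<mu>)"
      using step2[OF V_m, of i] unfold2[OF V_m, of i] inv2[OF V_m, of i] by (metis add.commute)
    moreover have "(\<integral>\<^sup>+x. staying (indicator (V i)) x \<partial>\<mu>2) < \<infinity>"
      using fin2 unfolding unfold2[OF V_m] by simp
    moreover have "(\<integral>\<^sup>+x. entering (indicator (V i)) x \<partial>\<mu>) < \<infinity>"
      using fin unfolding nn_integral_invariant[OF V_m] by simp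
    ultimately show ?case by (auto simp: ennreal_add_left_cancel)
  next
    case (Suc k)
    let ?g = "(staying ^^ k) (entering (indicator (V i)))"
    have g: "?g \<in> borel_measurable borel"
      by (intro funpow_measurable[OF positive_staying] entering_measurable V_m)
    have fin: "(\<integral>\<^sup>+x. entering ?g x \<partial>\<mu>) < \<infinity>" "(\<integral>\<^sup>+x. staying ?g x \<partial>\<mu>) < \<infinity>"
      using Suc.IH unfolding nn_integral_invariant[OF g] by simp_all
    have "(\<integral>\<^sup>+x. entering ?g x \<partial>\<mu>) + (\<integral>\<^sup>+x. staying ?g x \<partial>\<mu>2) =
        (\<integral>\<^sup>+x. entering ?g x \<partial>\<mu>) + (\<integral>\<^sup>+x. staying ?g x \<partial>\<mu>)"
      using Suc.IH unfolding unfold2[OF g] nn_integral_invariant[OF g] by (simp add: add.commute)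
    then show ?case using fin by (auto simp: ennreal_add_left_cancel)
  qed
  \<comment> \<open>One index truncates both the series and the exhaustion: a diagonal version of
    the double supremum that gives \<open>occupation exit_prob\<close> = 1.\<close>
  define u where "u n x = (\<Sum>k<n. (staying ^^ k) (entering (indicator (V n))) x)" for n x
  have pow_m: "(staying ^^ k) (entering (indicator (V i))) \<in> borel_measurable borel" for k i
    by (intro funpow_measurable[OF positive_staying] entering_measurable V_m)
  have u_m: "u n \<in> borel_measurable borel" for n
    unfolding u_def[abs_def] by (intro borel_measurable_sum pow_m)
  have pow_mono: "(staying ^^ k) (entering (indicator (V i))) x \<le> (staying ^^ k) (entering (indicator (V j))) x"
    if "i \<le> j" for i j k x
  proof -
    have "V i \<subseteq> V j" using V(2) that by (simp add: incseq_def)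
    then have "(indicator (V i) y :: ennreal) \<le> indicator (V j) y" for y
      by (auto simp: indicator_def)
    then show ?thesis
      by (intro positive_operator_mono[OF positive_operator_funpow[OF positive_staying]]
          positive_operator_mono[OF positive_entering] entering_measurable V_m)
  qed
  have u_mono: "u m x \<le> u n x" if "m \<le> n" for m n x
  proof -
    have "u m x \<le> (\<Sum>k<m. (staying ^^ k) (entering (indicator (V n))) x)"
      unfolding u_def by (intro sum_mono pow_mono that)
    also have "\<dots> \<le> u n x"
      unfolding u_def using that by (intro sum_mono2) auto
    finally show ?thesis .
  qed
  have u_sup: "1 \<le> (SUP n. u n x)" for x
  proof -
    have V_sup: "(\<lambda>y. SUP i. indicator (V i) y) = (\<lambda>_. 1 :: ennreal)"
    proof
      fix y
      obtain i where "y \<in> V i" using V(3) by blast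
      then have "(1 :: ennreal) \<le> (SUP i. indicator (V i) y)"
        using SUP_upper[of i UNIV "\<lambda>i. indicator (V i) y :: ennreal"] by simp
      moreover have "(SUP i. indicator (V i) y) \<le> (1 :: ennreal)"
        by (rule SUP_least) (simp add: indicator_def)
      ultimately show "(SUP i. indicator (V i) y) = (1 :: ennreal)" by (metis antisym)
    qed
    have inc: "incseq (\<lambda>i. indicator (V i) :: 'a \<Rightarrow> ennreal)"
      using V(2) by (intro incseq_SucI le_funI) (auto simp: indicator_def incseq_Suc_iff)
    have "1 = occupation (entering (\<lambda>y. SUP i. indicator (V i) y)) x"
      unfolding V_sup by (rule occupation_exit_prob[symmetric])
    also have "\<dots> = (SUP i. occupation (entering (indicator (V i))) x)"
      by (rule positive_operator_SUP[OF positive_operator_comp[OF positive_occupation positive_entering] V_m inc])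
    also have "\<dots> = (SUP i. SUP n. \<Sum>k<n. (staying ^^ k) (entering (indicator (V i))) x)"
      by (simp only: green_def suminf_eq_SUP)
    also have "\<dots> \<le> (SUP n. u n x)"
    proof (intro SUP_least)
      fix i n
      have "(\<Sum>k<n. (staying ^^ k) (entering (indicator (V i))) x) \<le>
          (\<Sum>k<n. (staying ^^ k) (entering (indicator (V (max i n)))) x)"
        by (intro sum_mono pow_mono) simp
      also have "\<dots> \<le> u (max i n) x"
        unfolding u_def by (intro sum_mono2) auto
      also have "\<dots> \<le> (SUP n. u n x)"
        by (rule SUP_upper) simp
      finally show "(\<Sum>k<n. (staying ^^ k) (entering (indicator (V i))) x) \<le> (SUP n. u n x)" .
    qed
    finally show ?thesis .
  qed
  \<comment> \<open>The factor n turns a supremum of at least 1 into \<infinity>, while each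
    integral stays finite.\<close>
  define h where "h n x = of_nat n * u n x" for n x
  have h_m: "h n \<in> borel_measurable borel" for n
    unfolding h_def[abs_def] using u_m by measurable
  have h_mono: "h n x \<le> h (Suc n) x" for n x
    unfolding h_def by (intro mult_mono u_mono) simp_all
  have h_sup: "(SUP n. h n x) = \<infinity>" for x
  proof (rule ccontr)
    assume "(SUP n. h n x) \<noteq> \<infinity>"
    then have "(SUP n. h n x) < top" by (simp only: less_top infinity_ennreal_def)
    then obtain m :: nat where m: "(SUP n. h n x) < of_nat m"
      using ennreal_Ex_less_of_nat by blast
    have "of_nat m \<le> (of_nat m :: ennreal) * (SUP n. u n x)"
      using mult_left_mono[OF u_sup, of "of_nat m"] by simp
    also have "\<dots> = (SUP n. of_nat m * u n x)"
      by (rule SUP_mult_left_ennreal)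
    also have "\<dots> \<le> (SUP n. h n x)"
    proof (rule SUP_least)
      fix n
      have "of_nat m * u n x \<le> h (max m n) x"
        unfolding h_def by (intro mult_mono u_mono) simp_all
      also have "\<dots> \<le> (SUP n. h n x)"
        by (rule SUP_upper) simp
      finally show "of_nat m * u n x \<le> (SUP n. h n x)" .
    qed
    finally show False using m by simp
  qed
  have h_eq: "(\<integral>\<^sup>+x. h n x \<partial>\<mu>2) = (\<integral>\<^sup>+x. h n x \<partial>\<mu>)" and h_fin: "(\<integral>\<^sup>+x. h n x \<partial>\<mu>) < \<infinity>" for n
  proof -
    have 1: "(\<integral>\<^sup>+x. h n x \<partial>\<mu>) = of_nat n * (\<Sum>k<n. \<integral>\<^sup>+x. (staying ^^ k) (entering (indicator (V n))) x \<partial>\<mu>)"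
      unfolding h_def u_def
      by (simp add: nn_integral_cmult nn_integral_sum borel_measurable_invariant[OF pow_m] borel_measurable_sum)
    have 2: "(\<integral>\<^sup>+x. h n x \<partial>\<mu>2) = of_nat n * (\<Sum>k<n. \<integral>\<^sup>+x. (staying ^^ k) (entering (indicator (V n))) x \<partial>\<mu>2)"
      unfolding h_def u_def
      by (simp add: nn_integral_cmult nn_integral_sum m2[OF pow_m] borel_measurable_sum)
    show "(\<integral>\<^sup>+x. h n x \<partial>\<mu>2) = (\<integral>\<^sup>+x. h n x \<partial>\<mu>)"
      unfolding 1 2 using eq by simp
    show "(\<integral>\<^sup>+x. h n x \<partial>\<mu>) < \<infinity>"
      unfolding 1 using eq by (simp add: ennreal_mult_less_top ennreal_sum_less_top of_nat_less_top)
  qed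
  \<comment> \<open>On both parts of h n, the truncation of f and the rest, \<mu>2 is at most \<mu>.
    The totals agree and are finite, so there is equality on each part.\<close>
  have b_eq: "(\<integral>\<^sup>+x. min (f x) (h n x) \<partial>\<mu>2) = (\<integral>\<^sup>+x. min (f x) (h n x) \<partial>\<mu>)" for n
  proof (rule antisym)
    let ?b = "\<lambda>x. min (f x) (h n x)" and ?d = "\<lambda>x. h n x - min (f x) (h n x)"
    have b: "?b \<in> borel_measurable borel" and d: "?d \<in> borel_measurable borel"
      using f h_m by measurable
    show "(\<integral>\<^sup>+x. ?b x \<partial>\<mu>2) \<le> (\<integral>\<^sup>+x. ?b x \<partial>\<mu>)" by (rule le[OF b])
    have split: "?b x + ?d x = h n x" for x
      by (rule add_diff_inverse_ennreal) simp
    have "(\<integral>\<^sup>+x. ?d x \<partial>\<mu>) + (\<integral>\<^sup>+x. ?b x \<partial>\<mu>) = (\<integral>\<^sup>+x. ?b x + ?d x \<partial>\<mu>)"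
      by (subst add.commute) (intro nn_integral_add[symmetric] borel_measurable_invariant b d)
    also have "\<dots> = (\<integral>\<^sup>+x. ?b x + ?d x \<partial>\<mu>2)"
      unfolding split by (rule h_eq[symmetric])
    also have "\<dots> = (\<integral>\<^sup>+x. ?d x \<partial>\<mu>2) + (\<integral>\<^sup>+x. ?b x \<partial>\<mu>2)"
      by (subst (2) add.commute) (intro nn_integral_add m2 b d)
    also have "\<dots> \<le> (\<integral>\<^sup>+x. ?d x \<partial>\<mu>) + (\<integral>\<^sup>+x. ?b x \<partial>\<mu>2)"
      by (intro add_right_mono le d)
    finally have "(\<integral>\<^sup>+x. ?d x \<partial>\<mu>) + (\<integral>\<^sup>+x. ?b x \<partial>\<mu>) \<le> (\<integral>\<^sup>+x. ?d x \<partial>\<mu>) + (\<integral>\<^sup>+x. ?b x \<partial>\<mu>2)" .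
    moreover have "(\<integral>\<^sup>+x. ?d x \<partial>\<mu>) < \<infinity>"
      by (rule le_less_trans[OF nn_integral_mono h_fin]) (rule diff_le_self_ennreal)
    ultimately show "(\<integral>\<^sup>+x. ?b x \<partial>\<mu>) \<le> (\<integral>\<^sup>+x. ?b x \<partial>\<mu>2)"
      unfolding ennreal_add_left_cancel_le by auto
  qed
  have "(\<integral>\<^sup>+x. entering (occupation f) x \<partial>\<mu>) = (\<integral>\<^sup>+x. f x \<partial>\<mu>2)"
    by (rule int2[OF f, symmetric])
  also have "\<dots> = (SUP n. \<integral>\<^sup>+x. min (f x) (h n x) \<partial>\<mu>2)"
    by (rule nn_integral_eq_SUP_min[OF m2[OF f] m2[OF h_m] h_mono h_sup])
  also have "\<dots> = (SUP n. \<integral>\<^sup>+x. min (f x) (h n x) \<partial>\<mu>)"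
    by (simp only: b_eq)
  also have "\<dots> = (\<integral>\<^sup>+x. f x \<partial>\<mu>)"
    by (rule nn_integral_eq_SUP_min[symmetric, OF borel_measurable_invariant[OF f]
          borel_measurable_invariant[OF h_m] h_mono h_sup])
  finally show ?thesis .
qed

end

text \<open>Both measures satisfy \<mu> = \<mu>RE, and the right-hand side depends on \<mu>R
  only.\<close>

lemma invariant_measure_eqI:
  assumes \<mu>: "invariant_measure \<mu>" and \<mu>': "invariant_measure \<mu>'"
    and eq: "\<And>f. f \<in> borel_measurable borel \<Longrightarrow> (\<integral>\<^sup>+x. entering f x \<partial>\<mu>) = (\<integral>\<^sup>+x. entering f x \<partial>\<mu>')"
  shows "\<mu> = \<mu>'"
proof (rule measure_eqI)
  have sets: "sets \<mu> = sets borel" "sets \<mu>' = sets borel"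
    using \<mu> \<mu>' by (simp_all add: invariant_measure_def)
  then show "sets \<mu> = sets \<mu>'" by simp
  fix B assume "B \<in> sets \<mu>"
  then have B: "B \<in> sets borel" using sets by simp
  then have m: "indicator B \<in> borel_measurable borel" by simp
  have "(\<integral>\<^sup>+x. indicator B x \<partial>\<mu>) = (\<integral>\<^sup>+x. indicator B x \<partial>\<mu>')"
    using nn_integral_entering_occupation[OF \<mu> m] nn_integral_entering_occupation[OF \<mu>' m]
      eq[OF occupation_measurable[OF m]] by simp
  then show "emeasure \<mu> B = emeasure \<mu>' B"
    using B sets by simp
qed

section \<open>Lifting entrance- and exit-invariant measures to the chain\<close>

lemma crossing_neighbourhood_finite_measure:
  assumes sets: "sets \<nu> = sets (restrict_space borel A)" and lf: "locally_finite_on A \<nu>"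
  obtains V x where "open V" "V \<subseteq> A" "emeasure \<nu> V < \<infinity>" "x \<in> interior (- A)" "emeasure (K x) V > 0"
proof -
  obtain x where x: "x \<in> interior (- A)" "emeasure (K x) (interior A) > 0"
    by (rule transition_point)
  \<comment> \<open>The interior of A itself may have infinite \<nu>-measure. It is covered by
    countably many open pieces of finite measure, and K x cannot vanish on all of them since it
    charges their union.\<close>
  let ?F = "{V. open V \<and> V \<subseteq> A \<and> emeasure \<nu> V < \<infinity>}"
  obtain F' where F': "F' \<subseteq> ?F" "countable F'" "\<Union>F' = \<Union>?F"
    using Lindelof[of ?F] by blast
  have "interior A \<subseteq> \<Union>F'"
  proof
    fix y assume "y \<in> interior A"
    then obtain V where "open V" "y \<in> V" "V \<subseteq> A" "emeasure \<nu> V < \<infinity>"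
      using locally_finite_on_open_subset[OF sets A_borel lf] by metis
    then show "y \<in> \<Union>F'" unfolding F'(3) by blast
  qed
  have open_F': "V \<in> sets borel" if "V \<in> F'" for V
    using F'(1) that by (intro borel_open) blast
  have "\<exists>V\<in>F'. emeasure (K x) V > 0"
  proof (rule ccontr)
    assume "\<not> (\<exists>V\<in>F'. emeasure (K x) V > 0)"
    then have "V \<in> null_sets (K x)" if "V \<in> F'" for V
      using that open_F' by (intro null_setsI) (auto simp: not_less)
    then have "(\<Union>V\<in>F'. V) \<in> null_sets (K x)"
      using F'(2) by (intro null_sets_UN')
    then have "\<Union>F' \<in> null_sets (K x)" by simp
    from null_sets_subset[OF this _ \<open>interior A \<subseteq> \<Union>F'\<close>]
    have "interior A \<in> null_sets (K x)" by simp
    then show False using x(2) null_setsD1[of "interior A" "K x"] by simp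
  qed
  then obtain V where "V \<in> F'" "emeasure (K x) V > 0" by blast
  then show ?thesis using F'(1) x(1) that by blast
qed

text \<open>Invariance of \<mu> = \<nu>E rests on E = 1 + ES and \<nu>ER = \<nu>. Local finiteness
  cannot be read off from \<nu>E, as E has no bound at hand; it is obtained backwards from \<mu>R =
  \<nu>.\<close>

lemma entrance_invariant_lift:
  assumes \<nu>: "entrance_invariant \<nu>"
  defines "\<mu> \<equiv> operator_measure \<nu> occupation"
  shows "invariant_measure \<mu>"
    and "f \<in> borel_measurable borel \<Longrightarrow> (\<integral>\<^sup>+x. entering f x \<partial>\<mu>) = (\<integral>\<^sup>+x. f x \<partial>\<nu>)"
proof -
  have sets\<nu>: "sets \<nu> = sets (restrict_space borel A)" and lf: "locally_finite_on A \<nu>"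
    and inv: "\<And>f. f \<in> borel_measurable borel \<Longrightarrow> (\<integral>\<^sup>+x. occupation (entering f) x \<partial>\<nu>) = (\<integral>\<^sup>+x. f x \<partial>\<nu>)"
    using \<nu> unfolding entrance_invariant_def by blast+
  note m = measurable_borel_restrict[OF sets\<nu>]
  have int: "(\<integral>\<^sup>+x. f x \<partial>\<mu>) = (\<integral>\<^sup>+x. occupation f x \<partial>\<nu>)" if "f \<in> borel_measurable borel" for f
    unfolding \<mu>_def by (rule nn_integral_operator_measure[OF positive_occupation sets\<nu> that])
  show ent: "(\<integral>\<^sup>+x. entering f x \<partial>\<mu>) = (\<integral>\<^sup>+x. f x \<partial>\<nu>)" if "f \<in> borel_measurable borel" for f
    unfolding int[OF entering_measurable[OF that]] by (rule inv[OF that])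
  have sets: "sets \<mu> = sets borel" unfolding \<mu>_def by simp
  have step: "(\<integral>\<^sup>+x. step f x \<partial>\<mu>) = (\<integral>\<^sup>+x. f x \<partial>\<mu>)" if f: "f \<in> borel_measurable borel" for f
  proof -
    have "step f = (\<lambda>x. staying f x + entering f x)"
      using step_eq_staying_entering[OF f] by (rule ext)
    then have "(\<integral>\<^sup>+x. step f x \<partial>\<mu>) = (\<integral>\<^sup>+x. occupation (\<lambda>x. staying f x + entering f x) x \<partial>\<nu>)"
      using int[OF step_measurable[OF f]] by (simp only:)
    also have "\<dots> = (\<integral>\<^sup>+x. occupation (staying f) x + occupation (entering f) x \<partial>\<nu>)"
      by (intro nn_integral_cong positive_operator_add[OF positive_occupation] staying_measurable entering_measurable f)
    also have "\<dots> = (\<integral>\<^sup>+x. occupation (staying f) x \<partial>\<nu>) + (\<integral>\<^sup>+x. occupation (entering f) x \<partial>\<nu>)"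
      by (intro nn_integral_add m occupation_measurable staying_measurable entering_measurable f)
    also have "\<dots> = (\<integral>\<^sup>+x. f x \<partial>\<nu>) + (\<integral>\<^sup>+x. occupation (staying f) x \<partial>\<nu>)"
      unfolding inv[OF f] by (rule add.commute)
    also have "\<dots> = (\<integral>\<^sup>+x. f x + occupation (staying f) x \<partial>\<nu>)"
      by (intro nn_integral_add[symmetric] m occupation_measurable staying_measurable f)
    also have "\<dots> = (\<integral>\<^sup>+x. f x \<partial>\<mu>)"
      unfolding int[OF f] by (simp only: occupation_unfold[OF f, symmetric])
    finally show ?thesis .
  qed
  obtain V x where V: "open V" "V \<subseteq> A" "emeasure \<nu> V < \<infinity>" "x \<in> interior (- A)" "emeasure (K x) V > 0"
    using crossing_neighbourhood_finite_measure[OF sets\<nu> lf] by metis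
  obtain G \<delta> where G: "open G" "x \<in> G" "\<delta> > 0" "\<And>y. y \<in> G \<Longrightarrow> \<delta> \<le> entering (indicator V) y"
    using crossing_lower_bound[OF V(1,2,4,5)] by metis
  \<comment> \<open>All points of G cross into V with probability at least \<delta>, and the
    crossings that land in V have total mass \<nu> V, which is finite.\<close>
  have "\<delta> * emeasure \<mu> G \<le> (\<integral>\<^sup>+x. entering (indicator V) x \<partial>\<mu>)"
    using G sets by (intro mult_emeasure_le_nn_integral) auto
  also have "\<dots> = (\<integral>\<^sup>+x. indicator V x \<partial>\<nu>)"
    using V(1) by (intro ent) auto
  also have "\<dots> = emeasure \<nu> V"
    using V(1,2) A_borel sets\<nu> by (intro nn_integral_indicator) (simp add: sets_restrict_space_iff)
  also have "\<dots> < \<infinity>" by fact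
  finally have "emeasure \<mu> G < \<infinity>"
    using G(3) by (auto simp: ennreal_mult_less_top)
  then have "locally_finite_on UNIV \<mu>"
    using G(1,2) step by (intro locally_finite_if_excessive[OF sets, of G]) auto
  then show "invariant_measure \<mu>"
    unfolding invariant_measure_def using sets step by blast
qed

text \<open>The operator f \<mapsto> R f / r turns \<kappa> into the corresponding entrance measure
  (\<kappa> / r) R, which is then lifted by E as before.\<close>

lemma exit_invariant_lift:
  assumes \<kappa>: "exit_invariant \<kappa>"
  defines "\<mu> \<equiv> operator_measure \<kappa> (\<lambda>f x. entering (occupation f) x / exit_prob x)"
  shows "invariant_measure \<mu>"
    and "f \<in> borel_measurable borel \<Longrightarrow> (\<integral>\<^sup>+x. exit_prob x * f x \<partial>\<mu>) = (\<integral>\<^sup>+x. f x \<partial>\<kappa>)"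
proof -
  let ?T = "\<lambda>f x. entering f x / exit_prob x"
  have sets\<kappa>: "sets \<kappa> = sets (restrict_space borel (- A))" and lf: "locally_finite_on (- A) \<kappa>"
    and inv: "\<And>f. f \<in> borel_measurable borel \<Longrightarrow>
      (\<integral>\<^sup>+x. ?T (occupation (\<lambda>y. exit_prob y * f y)) x \<partial>\<kappa>) = (\<integral>\<^sup>+x. f x \<partial>\<kappa>)"
    using \<kappa> unfolding exit_invariant_def by blast+
  note m = measurable_borel_restrict[OF sets\<kappa>]
  have "(\<lambda>x. inverse (exit_prob x)) \<in> borel_measurable borel"
    using exit_prob_measurable by measurable
  from positive_operator_mult_left[OF positive_entering this]
  have pos_T: "positive_operator ?T"
    by (simp add: divide_ennreal_def mult.commute)
  note T_m = positive_operator_measurable[OF pos_T]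
  note pos = positive_operator_comp[OF pos_T positive_occupation]
  have int: "(\<integral>\<^sup>+x. f x \<partial>\<mu>) = (\<integral>\<^sup>+x. ?T (occupation f) x \<partial>\<kappa>)" if "f \<in> borel_measurable borel" for f
    unfolding \<mu>_def by (rule nn_integral_operator_measure[OF pos sets\<kappa> that])
  show weighted: "(\<integral>\<^sup>+x. exit_prob x * f x \<partial>\<mu>) = (\<integral>\<^sup>+x. f x \<partial>\<kappa>)" if "f \<in> borel_measurable borel" for f
  proof -
    have "(\<lambda>x. exit_prob x * f x) \<in> borel_measurable borel"
      using exit_prob_measurable that by measurable
    from int[OF this] show ?thesis by (simp only: inv[OF that])
  qed
  \<comment> \<open>The invariance of \<kappa> is tested on R f / r. The weight r inside the exit
    operator cancels the denominator, so (\<kappa> / r) R is invariant for ER.\<close>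
  have ent: "(\<integral>\<^sup>+x. ?T (occupation (entering f)) x \<partial>\<kappa>) = (\<integral>\<^sup>+x. ?T f x \<partial>\<kappa>)" if "f \<in> borel_measurable borel" for f
    using inv[OF T_m[OF that]] by (simp only: exit_prob_mult_divide[OF that])
  have sets: "sets \<mu> = sets borel" unfolding \<mu>_def by simp
  have step: "(\<integral>\<^sup>+x. step f x \<partial>\<mu>) = (\<integral>\<^sup>+x. f x \<partial>\<mu>)" if f: "f \<in> borel_measurable borel" for f
  proof -
    note E = positive_operator_add[OF pos]
    note E_m = occupation_measurable[OF staying_measurable[OF f]]
    have "step f = (\<lambda>x. staying f x + entering f x)"
      using step_eq_staying_entering[OF f] by (rule ext)
    then have "(\<integral>\<^sup>+x. step f x \<partial>\<mu>) = (\<integral>\<^sup>+x. ?T (occupation (\<lambda>x. staying f x + entering f x)) x \<partial>\<kappa>)"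
      using int[OF step_measurable[OF f]] by (simp only:)
    also have "\<dots> = (\<integral>\<^sup>+x. ?T (occupation (staying f)) x + ?T (occupation (entering f)) x \<partial>\<kappa>)"
      by (intro nn_integral_cong E staying_measurable entering_measurable f)
    also have "\<dots> = (\<integral>\<^sup>+x. ?T (occupation (staying f)) x \<partial>\<kappa>) + (\<integral>\<^sup>+x. ?T (occupation (entering f)) x \<partial>\<kappa>)"
      by (intro nn_integral_add m T_m E_m occupation_measurable entering_measurable f)
    also have "\<dots> = (\<integral>\<^sup>+x. ?T f x \<partial>\<kappa>) + (\<integral>\<^sup>+x. ?T (occupation (staying f)) x \<partial>\<kappa>)"
      unfolding ent[OF f] by (rule add.commute)
    also have "\<dots> = (\<integral>\<^sup>+x. ?T f x + ?T (occupation (staying f)) x \<partial>\<kappa>)"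
      by (intro nn_integral_add[symmetric] m T_m E_m f)
    also have "\<dots> = (\<integral>\<^sup>+x. ?T (\<lambda>x. f x + occupation (staying f) x) x \<partial>\<kappa>)"
      by (intro nn_integral_cong positive_operator_add[OF pos_T, symmetric] E_m f)
    also have "(\<lambda>x. f x + occupation (staying f) x) = occupation f"
      using occupation_unfold[OF f] by (intro ext) simp
    finally show ?thesis unfolding int[OF f] .
  qed
  obtain x where x: "x \<in> interior (- A)" "emeasure (K x) (interior A) > 0"
    by (rule transition_point)
  obtain V where V: "open V" "x \<in> V" "V \<subseteq> - A" "emeasure \<kappa> V < \<infinity>"
    using locally_finite_on_open_subset[OF sets\<kappa> Compl_A_borel lf x(1)] by metis
  obtain G \<delta> where G: "open G" "x \<in> G" "\<delta> > 0" "\<And>y. y \<in> G \<Longrightarrow> \<delta> \<le> entering (indicator (interior A)) y"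
    using crossing_lower_bound[OF open_interior interior_subset x] by metis
  have ge: "\<delta> \<le> exit_prob y" if "y \<in> G" for y
    using G(4)[OF that]
    by (rule order_trans) (rule positive_operator_mono[OF positive_entering], auto simp: indicator_def)
  \<comment> \<open>As \<kappa> = r \<mu>, with r at least \<delta> on G and \<kappa> finite on V,
    the measure \<mu> is finite on the intersection, which contains x and so is non-empty.\<close>
  have "\<delta> * emeasure \<mu> (G \<inter> V) \<le> (\<integral>\<^sup>+x. exit_prob x * indicator V x \<partial>\<mu>)"
    using G V sets ge by (intro mult_emeasure_le_nn_integral) auto
  also have "\<dots> = (\<integral>\<^sup>+x. indicator V x \<partial>\<kappa>)"
    using V(1) by (intro weighted) auto
  also have "\<dots> = emeasure \<kappa> V"
    using V(1,3) Compl_A_borel sets\<kappa> by (intro nn_integral_indicator) (simp add: sets_restrict_space_iff)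
  also have "\<dots> < \<infinity>" by fact
  finally have "emeasure \<mu> (G \<inter> V) < \<infinity>"
    using G(3) by (auto simp: ennreal_mult_less_top)
  then have "locally_finite_on UNIV \<mu>"
    using G(1,2) V(1,2) step by (intro locally_finite_if_excessive[OF sets, of "G \<inter> V"]) auto
  then show "invariant_measure \<mu>"
    unfolding invariant_measure_def using sets step by blast
qed

end

section \<open>First entrance and exit along paths\<close>

lemma measurable_with_cemetery:
  assumes E: "E \<in> sets borel"
    and range: "\<And>\<omega>. \<omega> \<in> space M \<Longrightarrow> g \<omega> \<in> insert None (Some ` E)"
    and meas: "\<And>B. B \<in> sets (restrict_space borel E) \<Longrightarrow> {\<omega> \<in> space M. g \<omega> \<in> Some ` B} \<in> sets M"
  shows "g \<in> M \<rightarrow>\<^sub>M with_cemetery E"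
  unfolding with_cemetery_def
proof (rule measurable_measure_of)
  have sub: "B \<subseteq> E" if "B \<in> sets (restrict_space borel E)" for B
    using sets.sets_into_space[OF that] by (simp add: space_restrict_space)
  show "insert {None} ((`) Some ` sets (restrict_space borel E)) \<subseteq> Pow (insert None (Some ` E))"
    using sub by blast
  show "g \<in> space M \<rightarrow> insert None (Some ` E)"
    using range by blast
  fix C assume "C \<in> insert {None} ((`) Some ` sets (restrict_space borel E))"
  then consider "C = {None}" | B where "B \<in> sets (restrict_space borel E)" "C = Some ` B" by blast
  then show "g -` C \<inter> space M \<in> sets M"
  proof cases
    case 1
    have "E \<in> sets (restrict_space borel E)"
      using E by (simp add: sets_restrict_space_iff)
    moreover have "g -` C \<inter> space M = space M - {\<omega> \<in> space M. g \<omega> \<in> Some ` E}"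
      using range 1 by auto
    ultimately show ?thesis using meas by auto
  next
    case 2
    then have "g -` C \<inter> space M = {\<omega> \<in> space M. g \<omega> \<in> Some ` B}" by auto
    then show ?thesis using meas[OF 2(1)] by simp
  qed
qed

lemma sets_with_cemetery: "sets (with_cemetery E) =
  sigma_sets (insert None (Some ` E)) (insert {None} ((`) Some ` sets (restrict_space borel E)))"
proof -
  have "insert {None} ((`) Some ` sets (restrict_space borel E)) \<subseteq> Pow (insert None (Some ` E))"
    using sets.sets_into_space[of _ "restrict_space borel E"] by (auto simp: space_restrict_space)
  then show ?thesis
    unfolding with_cemetery_def by (rule sets_measure_of)
qed

lemma Some_image_in_with_cemetery:
  "B \<in> sets (restrict_space borel E) \<Longrightarrow> Some ` B \<in> sets (with_cemetery E)"
  unfolding sets_with_cemetery by (intro sigma_sets.Basic) blast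

lemma Some_vimage_with_cemetery:
  assumes "E \<in> sets borel" "C \<in> sets (with_cemetery E)"
  shows "Some -` C \<inter> E \<in> sets (restrict_space borel E)"
proof -
  have "Some \<in> restrict_space borel E \<rightarrow>\<^sub>M with_cemetery E"
  proof (rule measurable_with_cemetery[OF assms(1)])
    fix B assume B: "B \<in> sets (restrict_space borel E)"
    have "{\<omega> \<in> space (restrict_space borel E). Some \<omega> \<in> Some ` B} = B"
      using sets.sets_into_space[OF B] by auto
    then show "{\<omega> \<in> space (restrict_space borel E). Some \<omega> \<in> Some ` B} \<in> sets (restrict_space borel E)"
      using B by simp
  qed (simp add: space_restrict_space)
  from measurable_sets[OF this assms(2)] show ?thesis
    by (simp add: space_restrict_space)
qed

context markov_chain
begin

text \<open>Entrance times name the landing index: a first jump at step k, from time k to time k +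
  1, gives the time k + 1, and the \<open>- 1\<close> in the exit state leads back to k.\<close>

lemma entrance_time_first_jump:
  assumes "\<omega> \<in> no_jump (- A) A k" "\<omega> k \<in> - A" "\<omega> (Suc k) \<in> A"
  shows "entrance_time A \<omega> 1 = enat (Suc k)"
proof -
  let ?S = "{j. enat j > 0 \<and> \<omega> (j - 1) \<in> - A \<and> \<omega> j \<in> A}"
  have "Inf (enat ` ?S) = enat (Suc k)"
  proof (rule antisym)
    show "Inf (enat ` ?S) \<le> enat (Suc k)"
      using assms by (intro Inf_lower imageI) (simp add: zero_enat_def)
    show "enat (Suc k) \<le> Inf (enat ` ?S)"
    proof (rule Inf_greatest)
      fix j' assume "j' \<in> enat ` ?S"
      then obtain j where j: "j' = enat j" "j > 0" "\<omega> (j - 1) \<in> - A" "\<omega> j \<in> A"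
        by (auto simp: zero_enat_def)
      then obtain i where "j = Suc i" by (cases j) auto
      then have "\<not> i < k" using j assms(1) by (auto simp: no_jump_def)
      then show "enat (Suc k) \<le> j'" using j(1) \<open>j = Suc i\<close> by simp
    qed
  qed
  then show ?thesis by simp
qed

lemma entrance_time_no_jump:
  assumes "\<not> (\<exists>k. \<omega> k \<in> - A \<and> \<omega> (Suc k) \<in> A)"
  shows "entrance_time A \<omega> 1 = \<infinity>"
proof -
  have "{j. enat j > 0 \<and> \<omega> (j - 1) \<in> - A \<and> \<omega> j \<in> A} = {}"
  proof (rule equals0I)
    fix j assume "j \<in> {j. enat j > 0 \<and> \<omega> (j - 1) \<in> - A \<and> \<omega> j \<in> A}"
    then show False using assms by (cases j) (auto simp: zero_enat_def)
  qed
  then have "Inf (enat ` {j. enat j > 0 \<and> \<omega> (j - 1) \<in> - A \<and> \<omega> j \<in> A}) = \<infinity>"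
    by (simp only: image_empty Inf_enat_def simp_thms if_True)
  then show ?thesis by simp
qed

lemma entrance_exit_state_cases:
  obtains k where "\<omega> \<in> no_jump (- A) A k" "\<omega> k \<in> - A" "\<omega> (Suc k) \<in> A"
      "entrance_state A \<omega> 1 = Some (\<omega> (Suc k))" "exit_state A \<omega> 1 = Some (\<omega> k)"
    | "\<not> (\<exists>k. \<omega> k \<in> - A \<and> \<omega> (Suc k) \<in> A)" "entrance_state A \<omega> 1 = None" "exit_state A \<omega> 1 = None"
proof (cases "\<exists>k. \<omega> k \<in> - A \<and> \<omega> (Suc k) \<in> A")
  case True
  then obtain k where k: "\<omega> \<in> no_jump (- A) A k" "\<omega> k \<in> - A" "\<omega> (Suc k) \<in> A"
    unfolding first_jump_iff[symmetric] by blast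
  then show ?thesis
    using that(1)[of k] entrance_time_first_jump[OF k]
    unfolding entrance_state_def exit_state_def by simp
next
  case False
  then show ?thesis
    using that(2) entrance_time_no_jump[OF False]
    unfolding entrance_state_def exit_state_def by simp
qed

lemma no_jump_unique:
  assumes "\<omega> \<in> no_jump C D k" "\<omega> k \<in> C" "\<omega> (Suc k) \<in> D"
    and "\<omega> \<in> no_jump C D l" "\<omega> l \<in> C" "\<omega> (Suc l) \<in> D"
  shows "k = l"
  using assms by (cases k l rule: linorder_cases) (auto simp: no_jump_def)

text \<open>The intersection with \<open>UNIV\<close> brings the event into the shape of
  \<open>emeasure_first_jump\<close>.\<close>

lemma entrance_state_in_iff:
  "entrance_state A \<omega> 1 \<in> Some ` B \<longleftrightarrow>
    (\<exists>k. \<omega> \<in> no_jump (- A) A k \<and> \<omega> k \<in> - A \<inter> UNIV \<and> \<omega> (Suc k) \<in> A \<inter> B)"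
  (is "?L \<longleftrightarrow> ?R")
proof (cases rule: entrance_exit_state_cases[of \<omega> A])
  case (1 k)
  have "?L \<longleftrightarrow> \<omega> (Suc k) \<in> B"
    unfolding 1(4) by (rule inj_image_mem_iff) simp
  also have "\<dots> \<longleftrightarrow> ?R"
  proof
    assume "\<omega> (Suc k) \<in> B"
    then show ?R using 1(1-3) by (intro exI[of _ k]) simp
  next
    assume ?R
    then obtain l where l: "\<omega> \<in> no_jump (- A) A l" "\<omega> l \<in> - A" "\<omega> (Suc l) \<in> A" "\<omega> (Suc l) \<in> B"
      by (elim exE conjE IntE)
    then show "\<omega> (Suc k) \<in> B" using no_jump_unique[OF l(1-3) 1(1-3)] by simp
  qed
  finally show ?thesis .
next
  case 2
  have "\<not> ?L" unfolding 2(2) by (simp add: image_iff)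
  moreover have "\<not> ?R" using 2(1) by (metis IntD1)
  ultimately show ?thesis by (simp only:)
qed

lemma exit_state_in_iff:
  "exit_state A \<omega> 1 \<in> Some ` B \<longleftrightarrow>
    (\<exists>k. \<omega> \<in> no_jump (- A) A k \<and> \<omega> k \<in> - A \<inter> B \<and> \<omega> (Suc k) \<in> A \<inter> UNIV)"
  (is "?L \<longleftrightarrow> ?R")
proof (cases rule: entrance_exit_state_cases[of \<omega> A])
  case (1 k)
  have "?L \<longleftrightarrow> \<omega> k \<in> B"
    unfolding 1(5) by (rule inj_image_mem_iff) simp
  also have "\<dots> \<longleftrightarrow> ?R"
  proof
    assume "\<omega> k \<in> B"
    then show ?R using 1(1-3) by (intro exI[of _ k]) simp
  next
    assume ?R
    then obtain l where l: "\<omega> \<in> no_jump (- A) A l" "\<omega> l \<in> - A" "\<omega> (Suc l) \<in> A" "\<omega> l \<in> B"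
      by (elim exE conjE IntE)
    then show "\<omega> k \<in> B" using no_jump_unique[OF l(1-3) 1(1-3)] by simp
  qed
  finally show ?thesis .
next
  case 2
  have "\<not> ?L" unfolding 2(3) by (simp add: image_iff)
  moreover have "\<not> ?R" using 2(1) by (metis IntD1)
  ultimately show ?thesis by (simp only:)
qed

lemma first_jump_measurable:
  assumes [measurable]: "C \<in> sets borel" "D \<in> sets borel" "B \<in> sets borel" "B' \<in> sets borel"
  shows "{\<omega>. \<exists>k. \<omega> \<in> no_jump C D k \<and> \<omega> k \<in> C \<inter> B \<and> \<omega> (Suc k) \<in> D \<inter> B'} \<in> sets (P x)"
proof -
  have [measurable]: "no_jump C D k \<in> sets (\<Pi>\<^sub>M n\<in>UNIV. borel)" for k
    by (rule no_jump_measurable) fact+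
  have "{\<omega> \<in> space (P x). \<exists>k. \<omega> \<in> no_jump C D k \<and> \<omega> k \<in> C \<inter> B \<and> \<omega> (Suc k) \<in> D \<inter> B'} \<in> sets (P x)"
    by measurable
  then show ?thesis by simp
qed

end

section \<open>The entrance and exit kernels as operators\<close>

context transition_chain
begin

lemma lf_invariant_measures_eq:
  "lf_invariant_measures UNIV (\<lambda>x B. emeasure (K x) B) = {\<mu>. invariant_measure \<mu>}"
proof -
  have iff: "(\<forall>B\<in>sets (restrict_space borel UNIV). (\<integral>\<^sup>+x. emeasure (K x) B \<partial>\<mu>) = emeasure \<mu> B) \<longleftrightarrow>
    (\<forall>f\<in>borel_measurable borel. (\<integral>\<^sup>+x. step f x \<partial>\<mu>) = (\<integral>\<^sup>+x. f x \<partial>\<mu>))"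
    if sets: "sets \<mu> = sets (restrict_space borel UNIV)" for \<mu>
  proof -
    have "(\<integral>\<^sup>+x. emeasure (K x) B \<partial>\<mu>) = (\<integral>\<^sup>+x. step (indicator B) x \<partial>\<mu>)"
      if "B \<in> sets (restrict_space borel UNIV)" for B
      using that by (simp add: step_def)
    then have "(\<forall>B\<in>sets (restrict_space borel UNIV). (\<integral>\<^sup>+x. emeasure (K x) B \<partial>\<mu>) = emeasure \<mu> B) \<longleftrightarrow>
      (\<forall>B\<in>sets (restrict_space borel UNIV). (\<integral>\<^sup>+x. step (indicator B) x \<partial>\<mu>) = emeasure \<mu> B)"
      by (intro ball_cong refl) (simp only:)
    also have "\<dots> \<longleftrightarrow> (\<forall>f\<in>borel_measurable borel. (\<integral>\<^sup>+x. step f x \<partial>\<mu>) = (\<integral>\<^sup>+x. f x \<partial>\<mu>))"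
      by (rule invariance_sets_iff_functions[OF positive_operator_step sets]) simp_all
    finally show ?thesis .
  qed
  have "sets (restrict_space borel UNIV) = sets (borel :: 'a measure)" by simp
  then show ?thesis
    unfolding lf_invariant_measures_def borel_measure_on_def invariant_on_def invariant_measure_def
    using iff by (intro Collect_cong) (simp cong: conj_cong)
qed

lemma entering_eq: "x \<in> - A \<Longrightarrow> entering f x = (\<integral>\<^sup>+y. indicator A y * f y \<partial>K x)"
  by (simp add: jump_def step_def)

lemma emeasure_entrance_state:
  assumes "B \<in> sets borel"
  shows "emeasure (P x) {\<omega> \<in> space (P x). entrance_state A \<omega> 1 \<in> Some ` B} = occupation (entering (indicator B)) x"
  using emeasure_first_jump[OF Compl_A_borel A_borel, of UNIV B x] assms
  by (simp only: entrance_state_in_iff space_P UNIV_I simp_thms) simp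

lemma emeasure_exit_state:
  assumes "B \<in> sets borel"
  shows "emeasure (P x) {\<omega> \<in> space (P x). exit_state A \<omega> 1 \<in> Some ` B} = occupation (\<lambda>y. exit_prob y * indicator B y) x"
proof -
  have "(indicator UNIV :: 'a \<Rightarrow> ennreal) = (\<lambda>_. 1)" by auto
  then show ?thesis
    using emeasure_first_jump[OF Compl_A_borel A_borel, of B UNIV x] assms
    by (simp only: exit_state_in_iff space_P UNIV_I simp_thms mult.commute) simp
qed

lemma entrance_state_measurable: "(\<lambda>\<omega>. entrance_state A \<omega> 1) \<in> P x \<rightarrow>\<^sub>M with_cemetery A"
proof (rule measurable_with_cemetery[OF A_borel])
  show "entrance_state A \<omega> 1 \<in> insert None (Some ` A)" for \<omega>
    by (cases rule: entrance_exit_state_cases[of \<omega> A]) simp_all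
  fix B assume "B \<in> sets (restrict_space borel A)"
  then have "B \<in> sets borel" using A_borel by (simp add: sets_restrict_space_iff)
  from first_jump_measurable[OF Compl_A_borel A_borel _ this, of UNIV x]
  show "{\<omega> \<in> space (P x). entrance_state A \<omega> 1 \<in> Some ` B} \<in> sets (P x)"
    by (simp only: entrance_state_in_iff space_P UNIV_I simp_thms) simp
qed

lemma exit_state_measurable: "(\<lambda>\<omega>. exit_state A \<omega> 1) \<in> P x \<rightarrow>\<^sub>M with_cemetery (- A)"
proof (rule measurable_with_cemetery[OF Compl_A_borel])
  show "exit_state A \<omega> 1 \<in> insert None (Some ` (- A))" for \<omega>
    by (cases rule: entrance_exit_state_cases[of \<omega> A]) simp_all
  fix B assume "B \<in> sets (restrict_space borel (- A))"
  then have "B \<in> sets borel" using Compl_A_borel by (simp add: sets_restrict_space_iff)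
  from first_jump_measurable[OF Compl_A_borel A_borel this, of UNIV x]
  show "{\<omega> \<in> space (P x). exit_state A \<omega> 1 \<in> Some ` B} \<in> sets (P x)"
    by (simp only: exit_state_in_iff space_P UNIV_I simp_thms) simp
qed

lemma emeasure_entrance_kernel:
  assumes B: "B \<in> sets (restrict_space borel A)"
  shows "emeasure (entrance_kernel P A (Some x)) (Some ` B) = occupation (entering (indicator B)) x"
proof -
  have "emeasure (entrance_kernel P A (Some x)) (Some ` B) =
      emeasure (P x) ((\<lambda>\<omega>. entrance_state A \<omega> 1) -` (Some ` B) \<inter> space (P x))"
    unfolding entrance_kernel_def option.case
    by (rule emeasure_distr[OF entrance_state_measurable Some_image_in_with_cemetery[OF B]])
  also have "(\<lambda>\<omega>. entrance_state A \<omega> 1) -` (Some ` B) \<inter> space (P x) =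
      {\<omega> \<in> space (P x). entrance_state A \<omega> 1 \<in> Some ` B}"
    by blast
  finally show ?thesis
    using B A_borel by (simp only: emeasure_entrance_state sets_restrict_space_iff space_borel Int_UNIV_right)
qed

lemma lf_invariant_entrance_eq:
  "lf_invariant_measures A (\<lambda>x B. emeasure (entrance_kernel P A (Some x)) (Some ` B)) =
    {\<nu>. entrance_invariant \<nu>}"
proof -
  have iff: "(\<forall>B\<in>sets (restrict_space borel A).
      (\<integral>\<^sup>+x. emeasure (entrance_kernel P A (Some x)) (Some ` B) \<partial>\<nu>) = emeasure \<nu> B) \<longleftrightarrow>
    (\<forall>f\<in>borel_measurable borel. (\<integral>\<^sup>+x. occupation (entering f) x \<partial>\<nu>) = (\<integral>\<^sup>+x. f x \<partial>\<nu>))"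
    if sets: "sets \<nu> = sets (restrict_space borel A)" for \<nu>
  proof -
    have "(\<forall>B\<in>sets (restrict_space borel A).
        (\<integral>\<^sup>+x. emeasure (entrance_kernel P A (Some x)) (Some ` B) \<partial>\<nu>) = emeasure \<nu> B) \<longleftrightarrow>
      (\<forall>B\<in>sets (restrict_space borel A). (\<integral>\<^sup>+x. occupation (entering (indicator B)) x \<partial>\<nu>) = emeasure \<nu> B)"
      by (intro ball_cong refl) (simp only: emeasure_entrance_kernel)
    also have "\<dots> \<longleftrightarrow> (\<forall>f\<in>borel_measurable borel. (\<integral>\<^sup>+x. occupation (entering f) x \<partial>\<nu>) = (\<integral>\<^sup>+x. f x \<partial>\<nu>))"
      by (rule invariance_sets_iff_functions[OF positive_operator_comp[OF positive_occupation positive_entering] sets A_borel])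
        (simp only: entering_indicator)
    finally show ?thesis .
  qed
  show ?thesis
    unfolding lf_invariant_measures_def borel_measure_on_def invariant_on_def entrance_invariant_def
    by (intro Collect_cong conj_cong refl) (rule iff)
qed

lemma AE_exit_state: "AE \<omega> in P x. exit_state A \<omega> 1 \<noteq> None"
proof -
  interpret prob_space "P x" by (rule law_prob)
  have "{\<omega> \<in> space (P x). exit_state A \<omega> 1 \<noteq> None} = {\<omega> \<in> space (P x). exit_state A \<omega> 1 \<in> Some ` UNIV}"
    by (auto simp: image_iff)
  moreover have "emeasure (P x) {\<omega> \<in> space (P x). exit_state A \<omega> 1 \<in> Some ` UNIV} = 1"
    using occupation_exit_prob[of x] by (subst emeasure_exit_state) simp_all
  moreover have "{\<omega> \<in> space (P x). exit_state A \<omega> 1 \<in> Some ` UNIV} \<in> sets (P x)"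
    using first_jump_measurable[OF Compl_A_borel A_borel, of UNIV UNIV x]
    by (simp only: exit_state_in_iff space_P UNIV_I simp_thms) simp
  ultimately show ?thesis
    by (subst prob_Collect_eq_1[symmetric]) (simp_all add: measure_def)
qed

text \<open>Needed for all sets of the space with cemetery: the exit kernel is a
  \<open>measure_of\<close>, and its additivity is checked on the whole sigma-algebra. As the exit
  state is almost surely not \<open>None\<close>, it is irrelevant whether C contains
  \<open>None\<close>, and measurability in x becomes evident.\<close>

lemma emeasure_exit_state_with_cemetery:
  assumes C: "C \<in> sets (with_cemetery (- A))"
  shows "emeasure (P x) {\<omega> \<in> space (P x). exit_state A \<omega> 1 \<in> C} =
    occupation (\<lambda>y. exit_prob y * indicator (Some -` C \<inter> - A) y) x"
proof -
  have m: "Some -` C \<inter> - A \<in> sets (restrict_space borel (- A))"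
    by (rule Some_vimage_with_cemetery[OF Compl_A_borel C])
  then have m': "Some -` C \<inter> - A \<in> sets borel"
    using Compl_A_borel by (simp add: sets_restrict_space_iff)
  have C_image: "{\<omega> \<in> space (P x). exit_state A \<omega> 1 \<in> D} \<in> sets (P x)" if "D \<in> sets (with_cemetery (- A))" for D
    using measurable_sets[OF exit_state_measurable that] by (simp add: vimage_def Int_def conj_commute)
  have "emeasure (P x) {\<omega> \<in> space (P x). exit_state A \<omega> 1 \<in> C} =
      emeasure (P x) {\<omega> \<in> space (P x). exit_state A \<omega> 1 \<in> Some ` (Some -` C \<inter> - A)}"
  proof (rule emeasure_eq_AE)
    show "AE \<omega> in P x. \<omega> \<in> {\<omega> \<in> space (P x). exit_state A \<omega> 1 \<in> C} \<longleftrightarrow>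
        \<omega> \<in> {\<omega> \<in> space (P x). exit_state A \<omega> 1 \<in> Some ` (Some -` C \<inter> - A)}"
      using AE_exit_state
    proof eventually_elim
      case (elim \<omega>)
      then obtain k where "\<omega> k \<in> - A" "exit_state A \<omega> 1 = Some (\<omega> k)"
        by (cases rule: entrance_exit_state_cases[of \<omega> A]) simp_all
      then show ?case by (simp add: image_iff)
    qed
  qed (intro C_image C Some_image_in_with_cemetery m)+
  then show ?thesis by (simp only: emeasure_exit_state[OF m'])
qed

lemma emeasure_exit_kernel:
  assumes B: "B \<in> sets (restrict_space borel (- A))" and x: "x \<in> - A"
  shows "emeasure (exit_kernel P A (Some x)) (Some ` B) =
    entering (occupation (\<lambda>y. exit_prob y * indicator B y)) x / exit_prob x"
proof -
  have B': "B \<in> sets borel" "B \<subseteq> - A"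
    using B Compl_A_borel by (simp_all add: sets_restrict_space_iff)
  have m: "occupation (\<lambda>y. exit_prob y * indicator D y) \<in> borel_measurable borel" if "D \<in> sets borel" for D
    using exit_prob_measurable that by (intro occupation_measurable borel_measurable_times_ennreal) auto
  have prob: "exit_prob x = emeasure (K x) A"
    using x by (simp add: exit_prob_eq)
  interpret prob_space "K x" by (rule prob_space_K)
  show ?thesis
  proof (cases "x \<in> exit_points P A")
    \<comment> \<open>The kernel sends x to the cemetery, and the quotient is 0 / 0 = 0: both sides
      vanish.\<close>
    case False
    then have "exit_prob x = 0"
      using x by (simp add: prob exit_points_def step_law_eq emeasure_eq_measure not_less measure_le_0_iff)
    moreover have "entering (occupation (\<lambda>y. exit_prob y * indicator B y)) x = 0"
      by (rule entering_eq_0[OF m[OF B'(1)] \<open>exit_prob x = 0\<close>])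
    moreover have "emeasure (return (with_cemetery (- A)) None) (Some ` B) = 0"
      using Some_image_in_with_cemetery[OF B] by (simp add: indicator_def image_iff)
    ultimately show ?thesis
      using False unfolding exit_kernel_def by simp
  next
    case True
    let ?W = "with_cemetery (- A)" and ?U = "uniform_measure (K x) A"
    let ?F = "\<lambda>C z. emeasure (P z) {\<omega> \<in> space (P z). exit_state A \<omega> 1 \<in> C}"
    let ?G = "\<lambda>C. \<integral>\<^sup>+z\<in>A. ?F C z \<partial>?U"
    have F_m: "(\<lambda>z. ?F C z * indicator A z) \<in> borel_measurable borel" if "C \<in> sets ?W" for C
    proof -
      have "Some -` C \<inter> - A \<in> sets borel"
        using Some_vimage_with_cemetery[OF Compl_A_borel that] Compl_A_borel by (simp add: sets_restrict_space_iff)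
      then show ?thesis
        unfolding emeasure_exit_state_with_cemetery[OF that]
        using A_borel by (intro borel_measurable_times_ennreal m) auto
    qed
    have U_m: "f \<in> borel_measurable ?U" if "f \<in> borel_measurable borel" for f :: "'a \<Rightarrow> ennreal"
      using that by (simp cong: measurable_cong_sets)
    have kernel: "exit_kernel P A (Some x) = measure_of (space ?W) (sets ?W) ?G"
      using True unfolding exit_kernel_def by (simp add: step_law_eq)
    \<comment> \<open>The prescribed set function has to be a measure before it can be evaluated;
      additivity is that of each path law, integrated over the landing point z.\<close>
    have "emeasure (exit_kernel P A (Some x)) (Some ` B) = ?G (Some ` B)"
      unfolding kernel
    proof (rule emeasure_measure_of_sigma)
      show "sigma_algebra (space ?W) (sets ?W)" by (rule sets.sigma_algebra_axioms)
      show "positive (sets ?W) ?G" by (simp add: positive_def)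
      show "countably_additive (sets ?W) ?G"
      proof (rule countably_additiveI)
        fix C :: "nat \<Rightarrow> 'a option set"
        assume C: "range C \<subseteq> sets ?W" "disjoint_family C"
        have add: "(\<Sum>i. ?F (C i) z) = ?F (\<Union>i. C i) z" for z
        proof -
          let ?D = "\<lambda>i. {\<omega> \<in> space (P z). exit_state A \<omega> 1 \<in> C i}"
          have "range ?D \<subseteq> sets (P z)"
            using measurable_sets[OF exit_state_measurable, of _ z] C(1)
            by (auto simp: vimage_def Int_def conj_commute)
          moreover have "disjoint_family ?D"
            using C(2) unfolding disjoint_family_on_def by blast
          moreover have "(\<Union>i. ?D i) = {\<omega> \<in> space (P z). exit_state A \<omega> 1 \<in> (\<Union>i. C i)}" by blast
          ultimately show ?thesis using suminf_emeasure[of ?D "P z"] by (simp only:)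
        qed
        have "(\<Sum>i. ?G (C i)) = (\<integral>\<^sup>+z. (\<Sum>i. ?F (C i) z * indicator A z) \<partial>?U)"
          using C(1) by (intro nn_integral_suminf[symmetric] U_m F_m) blast
        also have "\<dots> = ?G (\<Union>i. C i)"
          by (simp only: ennreal_suminf_multc add)
        finally show "(\<Sum>i. ?G (C i)) = ?G (\<Union>i. C i)" .
      qed
    qed (rule Some_image_in_with_cemetery[OF B])
    also have "\<dots> = (\<integral>\<^sup>+z. occupation (\<lambda>y. exit_prob y * indicator B y) z * indicator A z \<partial>?U)"
      by (simp only: emeasure_exit_state[OF B'(1)])
    \<comment> \<open>One indicator of A comes from the set integral, the other from the conditional
      law; they merge into the single one inside \<open>entering\<close>.\<close>
    also have "\<dots> = (\<integral>\<^sup>+z. occupation (\<lambda>y. exit_prob y * indicator B y) z * indicator A z * indicator A z \<partial>K x) / emeasure (K x) A"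
      using A_borel m[OF B'(1)] by (intro nn_integral_uniform_measure) (auto intro!: borel_measurable_times_ennreal)
    also have "(\<integral>\<^sup>+z. occupation (\<lambda>y. exit_prob y * indicator B y) z * indicator A z * indicator A z \<partial>K x) =
        entering (occupation (\<lambda>y. exit_prob y * indicator B y)) x"
      unfolding entering_eq[OF x] by (intro nn_integral_cong) (simp split: split_indicator)
    finally show ?thesis by (simp only: prob)
  qed
qed

lemma lf_invariant_exit_eq:
  "lf_invariant_measures (- A) (\<lambda>x B. emeasure (exit_kernel P A (Some x)) (Some ` B)) =
    {\<kappa>. exit_invariant \<kappa>}"
proof -
  let ?T = "\<lambda>f x. entering (occupation (\<lambda>y. exit_prob y * f y)) x / exit_prob x"
  have T: "positive_operator ?T"
  proof -
    have "(\<lambda>x. inverse (exit_prob x)) \<in> borel_measurable borel"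
      using exit_prob_measurable by measurable
    from positive_operator_mult_left[OF positive_operator_mult_right[OF
          positive_operator_comp[OF positive_entering positive_occupation] exit_prob_measurable] this]
    show ?thesis by (simp add: divide_ennreal_def mult.commute)
  qed
  \<comment> \<open>\<open>exit_prob\<close> vanishes on A, so the weighted argument does not see
    values there.\<close>
  have T_ind: "?T (\<lambda>y. indicator (- A) y * f y) = ?T f" for f
  proof -
    have "(\<lambda>y. exit_prob y * (indicator (- A) y * f y)) = (\<lambda>y. exit_prob y * f y)"
      using exit_prob_in_A by (auto split: split_indicator)
    then show ?thesis by (simp only:)
  qed
  have iff: "(\<forall>B\<in>sets (restrict_space borel (- A)).
      (\<integral>\<^sup>+x. emeasure (exit_kernel P A (Some x)) (Some ` B) \<partial>\<kappa>) = emeasure \<kappa> B) \<longleftrightarrow>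
    (\<forall>f\<in>borel_measurable borel. (\<integral>\<^sup>+x. ?T f x \<partial>\<kappa>) = (\<integral>\<^sup>+x. f x \<partial>\<kappa>))"
    if sets: "sets \<kappa> = sets (restrict_space borel (- A))" for \<kappa>
  proof -
    have "(\<integral>\<^sup>+x. emeasure (exit_kernel P A (Some x)) (Some ` B) \<partial>\<kappa>) = (\<integral>\<^sup>+x. ?T (indicator B) x \<partial>\<kappa>)"
      if B: "B \<in> sets (restrict_space borel (- A))" for B
      using space_eq_restrict[OF sets] by (intro nn_integral_cong emeasure_exit_kernel[OF B]) simp
    then have "(\<forall>B\<in>sets (restrict_space borel (- A)).
        (\<integral>\<^sup>+x. emeasure (exit_kernel P A (Some x)) (Some ` B) \<partial>\<kappa>) = emeasure \<kappa> B) \<longleftrightarrow>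
      (\<forall>B\<in>sets (restrict_space borel (- A)). (\<integral>\<^sup>+x. ?T (indicator B) x \<partial>\<kappa>) = emeasure \<kappa> B)"
      by (intro ball_cong refl) (simp only:)
    also have "\<dots> \<longleftrightarrow> (\<forall>f\<in>borel_measurable borel. (\<integral>\<^sup>+x. ?T f x \<partial>\<kappa>) = (\<integral>\<^sup>+x. f x \<partial>\<kappa>))"
      by (rule invariance_sets_iff_functions[OF T sets Compl_A_borel T_ind])
    finally show ?thesis .
  qed
  show ?thesis
    unfolding lf_invariant_measures_def borel_measure_on_def invariant_on_def exit_invariant_def
    by (intro Collect_cong conj_cong refl) (rule iff)
qed

section \<open>The two bijections\<close>

lemma entrance_measure_eq:
  assumes sets: "sets \<mu> = sets borel"
  shows "entrance_measure P A \<mu> = restrict_space (operator_measure \<mu> entering) A"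
proof -
  let ?N = "restrict_space (operator_measure \<mu> entering) A"
  have sets': "sets \<mu> = sets (restrict_space borel UNIV)" using sets by simp
  have space_N: "space ?N = A"
    using sets_eq_imp_space_eq[OF sets_operator_measure[of \<mu> entering]] by (simp add: space_restrict_space)
  have sets_N: "sets ?N = sets (restrict_space borel A)"
    by (intro sets_restrict_space_cong) simp
  have "entrance_measure P A \<mu> = measure_of A (sets (restrict_space borel A)) (emeasure ?N)"
    unfolding entrance_measure_def
  proof (rule measure_of_eq)
    show sub: "sets (restrict_space borel A) \<subseteq> Pow A"
      using sets.sets_into_space[of _ "restrict_space borel A"] by (auto simp: space_restrict_space)
    fix B assume "B \<in> sigma_sets A (sets (restrict_space borel A))"
    then have B: "B \<in> sets (restrict_space borel A)"
      using sets.sigma_sets_eq[of "restrict_space borel A"] by (simp add: space_restrict_space)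
    then have B': "B \<in> sets borel" "B \<subseteq> A"
      using A_borel by (simp_all add: sets_restrict_space_iff)
    have "emeasure ?N B = emeasure (operator_measure \<mu> entering) B"
      using B' A_borel by (intro emeasure_restrict_space) auto
    also have "\<dots> = (\<integral>\<^sup>+x. entering (indicator B) x \<partial>\<mu>)"
      by (rule emeasure_operator_measure[OF positive_entering sets' B'(1)])
    also have "\<dots> = (\<integral>\<^sup>+x\<in>- A. emeasure (step_law P x) B \<partial>\<mu>)"
    proof (rule nn_integral_cong)
      fix x
      have "(\<lambda>y. indicator A y * indicator B y) = (indicator B :: 'a \<Rightarrow> ennreal)"
      proof
        fix y show "indicator A y * indicator B y = (indicator B y :: ennreal)"
          using B'(2) by (cases "y \<in> B") auto
      qed
      then show "entering (indicator B) x = emeasure (step_law P x) B * indicator (- A) x"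
        using B'(1) by (simp add: jump_def step_def step_law_eq mult.commute)
    qed
    finally show "(\<integral>\<^sup>+x\<in>- A. emeasure (step_law P x) B \<partial>\<mu>) = emeasure ?N B" ..
  qed
  also have "\<dots> = measure_of (space ?N) (sets ?N) (emeasure ?N)"
    by (simp only: space_N sets_N)
  also have "\<dots> = ?N" by (rule measure_of_of_measure)
  finally show ?thesis .
qed

lemma
  assumes "sets \<mu> = sets borel"
  shows sets_entrance_measure: "sets (entrance_measure P A \<mu>) = sets (restrict_space borel A)"
    and nn_integral_entrance_measure: "f \<in> borel_measurable borel \<Longrightarrow>
      (\<integral>\<^sup>+x. f x \<partial>entrance_measure P A \<mu>) = (\<integral>\<^sup>+x. entering f x \<partial>\<mu>)"
proof -
  have sets': "sets \<mu> = sets (restrict_space borel UNIV)" using assms by simp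
  show "sets (entrance_measure P A \<mu>) = sets (restrict_space borel A)"
    unfolding entrance_measure_eq[OF assms] by (intro sets_restrict_space_cong) simp
  assume f: "f \<in> borel_measurable borel"
  have m: "(\<lambda>x. indicator A x * f x) \<in> borel_measurable borel"
    using A_borel f by measurable
  have "(\<integral>\<^sup>+x. f x \<partial>entrance_measure P A \<mu>) = (\<integral>\<^sup>+x. f x * indicator A x \<partial>operator_measure \<mu> entering)"
    unfolding entrance_measure_eq[OF assms] using A_borel by (intro nn_integral_restrict_space) simp
  also have "\<dots> = (\<integral>\<^sup>+x. indicator A x * f x \<partial>operator_measure \<mu> entering)"
    by (simp only: mult.commute)
  also have "\<dots> = (\<integral>\<^sup>+x. entering f x \<partial>\<mu>)"
    unfolding nn_integral_operator_measure[OF positive_entering sets' m] entering_indicator ..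
  finally show "(\<integral>\<^sup>+x. f x \<partial>entrance_measure P A \<mu>) = (\<integral>\<^sup>+x. entering f x \<partial>\<mu>)" .
qed

lemma
  assumes "sets \<mu> = sets borel"
  shows sets_exit_measure: "sets (exit_measure P A \<mu>) = sets (restrict_space borel (- A))"
    and nn_integral_exit_measure: "f \<in> borel_measurable borel \<Longrightarrow>
      (\<integral>\<^sup>+x. f x \<partial>exit_measure P A \<mu>) = (\<integral>\<^sup>+x. exit_prob x * f x \<partial>\<mu>)"
proof -
  have sets_r: "sets (restrict_space \<mu> (- A)) = sets (restrict_space borel (- A))"
    by (intro sets_restrict_space_cong assms)
  then show "sets (exit_measure P A \<mu>) = sets (restrict_space borel (- A))"
    by (simp add: exit_measure_def)
  assume f: "f \<in> borel_measurable borel"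
  have K_m: "(\<lambda>x. emeasure (step_law P x) A) \<in> borel_measurable borel"
    using step_measurable[of "indicator A"] A_borel by (simp add: step_def[abs_def] step_law_eq)
  have "(\<integral>\<^sup>+x. f x \<partial>exit_measure P A \<mu>) =
      (\<integral>\<^sup>+x. emeasure (step_law P x) A * f x \<partial>restrict_space \<mu> (- A))"
    unfolding exit_measure_def
    by (intro nn_integral_density measurable_borel_restrict[OF sets_r] K_m f)
  also have "\<dots> = (\<integral>\<^sup>+x. emeasure (step_law P x) A * f x * indicator (- A) x \<partial>\<mu>)"
    using Compl_A_borel assms by (intro nn_integral_restrict_space) simp
  also have "\<dots> = (\<integral>\<^sup>+x. exit_prob x * f x \<partial>\<mu>)"
    by (simp only: exit_prob_eq step_law_eq ac_simps)
  finally show "(\<integral>\<^sup>+x. f x \<partial>exit_measure P A \<mu>) = (\<integral>\<^sup>+x. exit_prob x * f x \<partial>\<mu>)" .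
qed

lemma entrance_measure_bij:
  "bij_betw (entrance_measure P A) {\<mu>. invariant_measure \<mu>} {\<nu>. entrance_invariant \<nu>}"
  unfolding bij_betw_def
proof
  show "inj_on (entrance_measure P A) {\<mu>. invariant_measure \<mu>}"
  proof (rule inj_onI, unfold mem_Collect_eq)
    fix \<mu> \<mu>' assume \<mu>: "invariant_measure \<mu>" "invariant_measure \<mu>'"
      and eq: "entrance_measure P A \<mu> = entrance_measure P A \<mu>'"
    then have "sets \<mu> = sets borel" "sets \<mu>' = sets borel"
      by (simp_all add: invariant_measure_def)
    then show "\<mu> = \<mu>'"
      using eq by (intro invariant_measure_eqI \<mu>) (simp add: nn_integral_entrance_measure[symmetric])
  qed
  show "entrance_measure P A ` {\<mu>. invariant_measure \<mu>} = {\<nu>. entrance_invariant \<nu>}"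
  proof (intro antisym subsetI)
    fix \<nu> assume "\<nu> \<in> entrance_measure P A ` {\<mu>. invariant_measure \<mu>}"
    then obtain \<mu> where \<mu>: "invariant_measure \<mu>" and \<nu>: "\<nu> = entrance_measure P A \<mu>" by blast
    then have sets: "sets \<mu> = sets borel" and lf: "locally_finite_on UNIV \<mu>"
      by (simp_all add: invariant_measure_def)
    note int = nn_integral_entrance_measure[OF sets]
    have "locally_finite_on A \<nu>"
      unfolding \<nu>
    proof (rule locally_finite_on_if_dominated[OF sets_entrance_measure[OF sets] A_borel lf sets])
      fix f :: "'a \<Rightarrow> ennreal" assume f: "f \<in> borel_measurable borel"
      show "(\<integral>\<^sup>+x. f x \<partial>entrance_measure P A \<mu>) \<le> (\<integral>\<^sup>+x. f x \<partial>\<mu>)"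
        unfolding int[OF f] nn_integral_invariant[OF \<mu> f] by simp
    qed
    \<comment> \<open>\<mu>R integrates ER f to \<integral> RE(R f) d\<mu>, which is \<integral> R f
      d\<mu> by \<mu> = \<mu>RE.\<close>
    moreover have "(\<integral>\<^sup>+x. occupation (entering f) x \<partial>\<nu>) = (\<integral>\<^sup>+x. f x \<partial>\<nu>)"
      if f: "f \<in> borel_measurable borel" for f
      unfolding \<nu> int[OF f] int[OF occupation_measurable[OF entering_measurable[OF f]]]
      by (rule nn_integral_entering_occupation[OF \<mu> entering_measurable[OF f]])
    ultimately show "\<nu> \<in> {\<nu>. entrance_invariant \<nu>}"
      using sets_entrance_measure[OF sets] \<nu> by (simp add: entrance_invariant_def)
  next
    fix \<nu> assume "\<nu> \<in> {\<nu>. entrance_invariant \<nu>}"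
    then have \<nu>: "entrance_invariant \<nu>" by simp
    let ?\<mu> = "operator_measure \<nu> occupation"
    note \<mu> = entrance_invariant_lift(1)[OF \<nu>]
    have "sets \<nu> = sets (restrict_space borel A)"
      using \<nu> by (simp add: entrance_invariant_def)
    then have "\<nu> = entrance_measure P A ?\<mu>"
      by (rule measure_on_eqI[OF _ sets_entrance_measure A_borel])
        (simp_all add: nn_integral_entrance_measure entrance_invariant_lift(2)[OF \<nu>])
    then show "\<nu> \<in> entrance_measure P A ` {\<mu>. invariant_measure \<mu>}"
      using \<mu> by blast
  qed
qed

lemma exit_measure_bij:
  "bij_betw (exit_measure P A) {\<mu>. invariant_measure \<mu>} {\<kappa>. exit_invariant \<kappa>}"
  unfolding bij_betw_def
proof
  have divide_m: "(\<lambda>x. entering f x / exit_prob x) \<in> borel_measurable borel"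
    if "f \<in> borel_measurable borel" for f
    using entering_measurable[OF that] exit_prob_measurable by measurable
  show "inj_on (exit_measure P A) {\<mu>. invariant_measure \<mu>}"
  proof (rule inj_onI, unfold mem_Collect_eq)
    fix \<mu> \<mu>' assume \<mu>: "invariant_measure \<mu>" "invariant_measure \<mu>'"
      and eq: "exit_measure P A \<mu> = exit_measure P A \<mu>'"
    then have sets: "sets \<mu> = sets borel" "sets \<mu>' = sets borel"
      by (simp_all add: invariant_measure_def)
    show "\<mu> = \<mu>'"
    proof (rule invariant_measure_eqI[OF \<mu>])
      fix f :: "'a \<Rightarrow> ennreal" assume f: "f \<in> borel_measurable borel"
      show "(\<integral>\<^sup>+x. entering f x \<partial>\<mu>) = (\<integral>\<^sup>+x. entering f x \<partial>\<mu>')"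
        \<comment> \<open>Testing the exit measures, which carry the weight r, on R f / r recovers
          the integrals of R f.\<close>
        using nn_integral_exit_measure[OF sets(1) divide_m[OF f]]
          nn_integral_exit_measure[OF sets(2) divide_m[OF f]] eq
        by (simp only: exit_prob_mult_divide[OF f])
    qed
  qed
  show "exit_measure P A ` {\<mu>. invariant_measure \<mu>} = {\<kappa>. exit_invariant \<kappa>}"
  proof (intro antisym subsetI)
    fix \<kappa> assume "\<kappa> \<in> exit_measure P A ` {\<mu>. invariant_measure \<mu>}"
    then obtain \<mu> where \<mu>: "invariant_measure \<mu>" and \<kappa>: "\<kappa> = exit_measure P A \<mu>" by blast
    then have sets: "sets \<mu> = sets borel" and lf: "locally_finite_on UNIV \<mu>"
      by (simp_all add: invariant_measure_def)
    note int = nn_integral_exit_measure[OF sets]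
    have "locally_finite_on (- A) \<kappa>"
      unfolding \<kappa>
    proof (rule locally_finite_on_if_dominated[OF sets_exit_measure[OF sets] Compl_A_borel lf sets])
      fix f :: "'a \<Rightarrow> ennreal" assume f: "f \<in> borel_measurable borel"
      have "exit_prob x * f x \<le> f x" for x
        using mult_right_mono[OF exit_prob_le_1[of x], of "f x"] by simp
      then show "(\<integral>\<^sup>+x. f x \<partial>exit_measure P A \<mu>) \<le> (\<integral>\<^sup>+x. f x \<partial>\<mu>)"
        unfolding int[OF f] by (intro nn_integral_mono)
    qed
    \<comment> \<open>The weight r of \<kappa> = r \<mu> cancels the denominator; what remains is
      \<mu> = \<mu>RE applied to r f.\<close>
    moreover have "(\<integral>\<^sup>+x. entering (occupation (\<lambda>y. exit_prob y * f y)) x / exit_prob x \<partial>\<kappa>) = (\<integral>\<^sup>+x. f x \<partial>\<kappa>)"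
      if f: "f \<in> borel_measurable borel" for f
    proof -
      have m: "(\<lambda>y. exit_prob y * f y) \<in> borel_measurable borel"
        using exit_prob_measurable f by measurable
      show ?thesis
        unfolding \<kappa> int[OF f] int[OF divide_m[OF occupation_measurable[OF m]]]
          exit_prob_mult_divide[OF occupation_measurable[OF m]]
        by (rule nn_integral_entering_occupation[OF \<mu> m])
    qed
    ultimately show "\<kappa> \<in> {\<kappa>. exit_invariant \<kappa>}"
      using sets_exit_measure[OF sets] \<kappa> by (simp add: exit_invariant_def)
  next
    fix \<kappa> assume "\<kappa> \<in> {\<kappa>. exit_invariant \<kappa>}"
    then have \<kappa>: "exit_invariant \<kappa>" by simp
    let ?\<mu> = "operator_measure \<kappa> (\<lambda>f x. entering (occupation f) x / exit_prob x)"
    note \<mu> = exit_invariant_lift(1)[OF \<kappa>]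
    have "sets \<kappa> = sets (restrict_space borel (- A))"
      using \<kappa> by (simp add: exit_invariant_def)
    then have "\<kappa> = exit_measure P A ?\<mu>"
      by (rule measure_on_eqI[OF _ sets_exit_measure Compl_A_borel])
        (simp_all add: nn_integral_exit_measure exit_invariant_lift(2)[OF \<kappa>])
    then show "\<kappa> \<in> exit_measure P A ` {\<mu>. invariant_measure \<mu>}"
      using \<mu> by blast
  qed
qed

end

theorem theorem3p3:
  fixes K :: "'a::{metric_space, second_countable_topology} \<Rightarrow> 'a measure"
    and P :: "'a \<Rightarrow> (nat \<Rightarrow> 'a) measure"
    and A :: "'a set"
  assumes "markov_chain K P"
    and "topologically_irreducible P"
    and "topologically_recurrent P"
    and "weak_Feller P"
    and "A \<in> sets borel"
    and "\<exists>x\<in>interior (- A). measure (step_law P x) (interior A) > 0"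
  shows "bij_betw (entrance_measure P A)
           (lf_invariant_measures UNIV (\<lambda>x B. emeasure (K x) B))
           (lf_invariant_measures A (\<lambda>x B. emeasure (entrance_kernel P A (Some x)) (Some ` B)))
       \<and> bij_betw (exit_measure P A)
           (lf_invariant_measures UNIV (\<lambda>x B. emeasure (K x) B))
           (lf_invariant_measures (- A) (\<lambda>x B. emeasure (exit_kernel P A (Some x)) (Some ` B)))"
proof -
  interpret markov_chain K P by fact
  interpret transition_chain K P A
    by unfold_locales (use assms in auto)
  show ?thesis
    unfolding lf_invariant_measures_eq lf_invariant_entrance_eq lf_invariant_exit_eq
    using entrance_measure_bij exit_measure_bij by (rule conjI)
qed

end
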